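(* Let $q(x^{(1)},x^{(2)},y^{(1)},y^{(2)})$ be a joint distribution on finite sets and let $r\ge2$ be a natural number. Then every pair $(R_{12},R_{21})$ admissible for $q$ with $r$ rounds of communication belongs to $\mathcal{R}_2(r)$, defined as the convex closure of the set of $(R_{12},R_{21})\in\mathbb{R}^2$ for which there exists $p(f_1,\dots,f_r,x^{(1)},x^{(2)},y^{(1)},y^{(2)})\in T_2(r)$ with, writing $\mathbf{F}=(F_1,\dots,F_r)$, $$R_{12}\ge I(X^{(1)};\mathbf{F}\mid X^{(2)}),\quad R_{21}\ge I(X^{(2)};\mathbf{F}\mid X^{(1)}),$$ $$R_{12}+R_{21}\ge I(X^{(1)};\mathbf{F}\mid X^{(2)})+I(X^{(2)};\mathbf{F}\mid X^{(1)})+I(Y^{(1)};Y^{(2)}\mid X^{(1)}X^{(2)}).$$ Here $T_2(r)$ is the set of joint distributions $p(f_1,\dots,f_r,x^{(1)},x^{(2)},y^{(1)},y^{(2)})$ such that: the marginal of $(X^{(1)},X^{(2)},Y^{(1)},Y^{(2)})$ equals $q$; $F_i-F_{1:i-1}X^{(1)}-X^{(2)}$ for odd $i$; $F_i-F_{1:i-1}X^{(2)}-X^{(1)}$ for even $i$; $Y^{(1)}-\mathbf{F}X^{(1)}-X^{(2)}Y^{(2)}$; $Y^{(2)}-\mathbf{F}X^{(2)}-X^{(1)}Y^{(1)}$; and for all $1\le i\le r$, $|\mathcal{F}_i|\le|\mathcal{F}_{i-1}|\cdots|\mathcal{F}_1||\mathcal{X}^{(1)}||\mathcal{Y}^{(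1)}||\mathcal{X}^{(2)}||\mathcal{Y}^{(2)}|+1$.
   Context: Two-node coordination problem. Fix finite alphabets and a joint pmf $q(x^{(1)},x^{(2)},y^{(1)},y^{(2)})$. For a natural number $r$, a code of blocklength $n$ with $r$ interactive rounds is as follows: node 1 observes $X^{(1)}_{1:n}$ and node 2 observes $X^{(2)}_{1:n}$, where $(X^{(1)}_i,X^{(2)}_i)_{i=1}^n$ are i.i.d. with the $(X^{(1)},X^{(2)})$-marginal of $q$; node 1 has private randomness $M_1$ and node 2 private randomness $M_2$, with $M_1$, $M_2$, $(X^{(1)}_{1:n},X^{(2)}_{1:n})$ mutually independent; there is no common randomness. Messages $C_1,\dots,C_r$ are sent, with $H(C_i\mid C_{1:i-1}X^{(1)}_{1:n}M_1)=0$ for odd $i$ and $H(C_i\mid C_{1:i-1}X^{(2)}_{1:n}M_2)=0$ for even $i$, and $\frac1n\sum_{i\text{ odd}}H(C_i)\le R_{12}$, $\frac1n\sum_{i\text{ even}}H(C_i)\le R_{21}$. Afterwards node 1 produces $\widehat Y^{(1)}_{1:n}$ as a function of $(X^{(1)}_{1:n},M_1,C_{1:r})$ and node 2 produces $\widehat Y^{(2)}_{1:n}$ as a function of $(X^{(2)}_{1:n},M_2,C_{1:r})$. The pair $(R_{12},R_{21})$ is admissible for $q$ with $r$ rounds if for every $\epsilon>0$ there is $n_0$ such that for all $n\ge n_0$ such a code exists for which the total variation ($\ell_1$) distance between the law of $(X^{(1)}_{1:n},X^{(2)}_{1:n},\widehat Y^{(1)}_{1:n},\widehat Y^{(2)}_{1:n})$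 and the law of $n$ i.i.d. copies of $(X^{(1)},X^{(2)},Y^{(1)},Y^{(2)})\sim q$ is at most $\epsilon$. The notation $A-B-C$ means $A$ and $C$ are conditionally independent given $B$; juxtaposition denotes joint random variables. *)

theory Defs
  imports "HOL-Probability.Probability"
begin

definition markov_chain :: "'o pmf \<Rightarrow> ('o \<Rightarrow> 'a) \<Rightarrow> ('o \<Rightarrow> 'b) \<Rightarrow> ('o \<Rightarrow> 'c) \<Rightarrow> bool" where
  "markov_chain p A B C \<longleftrightarrow>
     (\<forall>a b c. measure_pmf.prob p {w. A w = a \<and> B w = b \<and> C w = c} * measure_pmf.prob p {w. B w = b}
            = measure_pmf.prob p {w. A w = a \<and> B w = b} * measure_pmf.prob p {w. B w = b \<and> C w = c})"

definition cmi :: "'o pmf \<Rightarrow> ('o \<Rightarrow> 'a) \<Rightarrow> ('o \<Rightarrow> 'b) \<Rightarrow> ('o \<Rightarrow> 'c) \<Rightarrow> real" where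
  "cmi p A B C = prob_space.conditional_mutual_information (measure_pmf p) 2
      (count_space UNIV) (count_space UNIV) (count_space UNIV) A B C"

definition entropy_nat :: "'w measure \<Rightarrow> ('w \<Rightarrow> nat) \<Rightarrow> ennreal" where
  "entropy_nat P C = (\<Sum>c. ennreal (- measure P {w \<in> space P. C w = c}
                                     * log 2 (measure P {w \<in> space P. C w = c})))"

text \<open>Messages C_1..C_r (list positions 0..r-1). Round k+1 is odd iff k is even;
  odd rounds are sent by node 1 (function of previous messages, X1 block, M1),
  even rounds by node 2.\<close>
fun msgs :: "(nat \<Rightarrow> nat list \<Rightarrow> 'x1 list \<Rightarrow> real \<Rightarrow> nat) \<Rightarrow> (nat \<Rightarrow> nat list \<Rightarrow> 'x2 list \<Rightarrow> real \<Rightarrow> nat)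
              \<Rightarrow> nat \<Rightarrow> 'x1 list \<Rightarrow> 'x2 list \<Rightarrow> real \<Rightarrow> real \<Rightarrow> nat list" where
  "msgs e1 e2 0 a b m1 m2 = []"
| "msgs e1 e2 (Suc k) a b m1 m2 =
     (let h = msgs e1 e2 k a b m1 m2
      in h @ [if even k then e1 (Suc k) h a m1 else e2 (Suc k) h b m2])"

text \<open>The probability space of a code of blocklength n: i.i.d. source block
  (as a list of pairs), private randomness M1 ~ mu1 and M2 ~ mu2, all independent.\<close>
definition code_space :: "nat \<Rightarrow> ('x1 \<times> 'x2 \<times> 'y1 \<times> 'y2) pmf \<Rightarrow> real measure \<Rightarrow> real measure
      \<Rightarrow> (('x1 \<times> 'x2) list \<times> real \<times> real) measure" where
  "code_space n q mu1 mu2 =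
     measure_pmf (replicate_pmf n (map_pmf (\<lambda>(x1, x2, y1, y2). (x1, x2)) q)) \<Otimes>\<^sub>M (mu1 \<Otimes>\<^sub>M mu2)"

definition code_msgs where
  "code_msgs e1 e2 r w = msgs e1 e2 r (map fst (fst w)) (map snd (fst w)) (fst (snd w)) (snd (snd w))"

definition code_output where
  "code_output e1 e2 d1 d2 r w =
     (let a = map fst (fst w); b = map snd (fst w); m1 = fst (snd w); m2 = snd (snd w);
          c = msgs e1 e2 r a b m1 m2
      in zip a (zip b (zip (d1 c a m1) (d2 c b m2))))"

definition is_code ::
  "nat \<Rightarrow> nat \<Rightarrow> real \<Rightarrow> real \<Rightarrow> ('x1 \<times> 'x2 \<times> 'y1 \<times> 'y2) pmf \<Rightarrow> real measure \<Rightarrow> real measure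
   \<Rightarrow> (nat \<Rightarrow> nat list \<Rightarrow> 'x1 list \<Rightarrow> real \<Rightarrow> nat) \<Rightarrow> (nat \<Rightarrow> nat list \<Rightarrow> 'x2 list \<Rightarrow> real \<Rightarrow> nat)
   \<Rightarrow> (nat list \<Rightarrow> 'x1 list \<Rightarrow> real \<Rightarrow> 'y1 list) \<Rightarrow> (nat list \<Rightarrow> 'x2 list \<Rightarrow> real \<Rightarrow> 'y2 list) \<Rightarrow> bool" where
  "is_code n r R12 R21 q mu1 mu2 e1 e2 d1 d2 \<longleftrightarrow>
     prob_space mu1 \<and> sets mu1 = sets borel \<and> prob_space mu2 \<and> sets mu2 = sets borel \<and>
     (\<forall>k h a. e1 k h a \<in> measurable mu1 (count_space UNIV)) \<and>
     (\<forall>k h b. e2 k h b \<in> measurable mu2 (count_space UNIV)) \<and>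
     (\<forall>c a. d1 c a \<in> measurable mu1 (count_space UNIV)) \<and>
     (\<forall>c b. d2 c b \<in> measurable mu2 (count_space UNIV)) \<and>
     (\<forall>c a m. length (d1 c a m) = n) \<and> (\<forall>c b m. length (d2 c b m) = n) \<and>
     (let P = code_space n q mu1 mu2;
          H = (\<lambda>k. entropy_nat P (\<lambda>w. code_msgs e1 e2 r w ! k));
          S1 = (\<Sum>k\<in>{k. k < r \<and> even k}. H k);
          S2 = (\<Sum>k\<in>{k. k < r \<and> odd k}. H k)
      in S1 \<noteq> \<infinity> \<and> enn2real S1 \<le> real n * R12 \<and> S2 \<noteq> \<infinity> \<and> enn2real S2 \<le> real n * R21)"

definition code_l1 where
  "code_l1 n q mu1 mu2 e1 e2 d1 d2 r =
     (let P = code_space n q mu1 mu2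
      in \<Sum>z\<in>{zs. length zs = n}.
           \<bar>measure P {w \<in> space P. code_output e1 e2 d1 d2 r w = z} - pmf (replicate_pmf n q) z\<bar>)"

definition admissible :: "('x1 \<times> 'x2 \<times> 'y1 \<times> 'y2) pmf \<Rightarrow> nat \<Rightarrow> real \<Rightarrow> real \<Rightarrow> bool" where
  "admissible q r R12 R21 \<longleftrightarrow>
     (\<forall>\<epsilon>>0. \<exists>n0. \<forall>n\<ge>n0. \<exists>mu1 mu2 e1 e2 d1 d2.
        is_code n r R12 R21 q mu1 mu2 e1 e2 d1 d2 \<and> code_l1 n q mu1 mu2 e1 e2 d1 d2 r \<le> \<epsilon>)"

text \<open>Outcomes of p: (F, X1, X2, Y1, Y2) with F = [F_1,...,F_r] (list positions 0..r-1).\<close>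
definition T2 :: "('x1::finite \<times> 'x2::finite \<times> 'y1::finite \<times> 'y2::finite) pmf \<Rightarrow> nat
                  \<Rightarrow> (nat list \<times> 'x1 \<times> 'x2 \<times> 'y1 \<times> 'y2) pmf set" where
  "T2 q r = {p.
     map_pmf (\<lambda>(f, x1, x2, y1, y2). (x1, x2, y1, y2)) p = q \<and>
     (\<exists>A :: nat \<Rightarrow> nat set.
        (\<forall>i<r. finite (A i) \<and>
           card (A i) \<le> (\<Prod>j<i. card (A j)) * CARD('x1) * CARD('y1) * CARD('x2) * CARD('y2) + 1) \<and>
        (\<forall>(f, x1, x2, y1, y2) \<in> set_pmf p. length f = r \<and> (\<forall>i<r. f ! i \<in> A i))) \<and>
     (\<forall>i<r. even i \<longrightarrow> markov_chain p (\<lambda>(f, x1, x2, y1, y2). f ! i)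
                                        (\<lambda>(f, x1, x2, y1, y2). (take i f, x1))
                                        (\<lambda>(f, x1, x2, y1, y2). x2)) \<and>
     (\<forall>i<r. odd i \<longrightarrow> markov_chain p (\<lambda>(f, x1, x2, y1, y2). f ! i)
                                       (\<lambda>(f, x1, x2, y1, y2). (take i f, x2))
                                       (\<lambda>(f, x1, x2, y1, y2). x1)) \<and>
     markov_chain p (\<lambda>(f, x1, x2, y1, y2). y1) (\<lambda>(f, x1, x2, y1, y2). (f, x1))
                    (\<lambda>(f, x1, x2, y1, y2). (x2, y2)) \<and>
     markov_chain p (\<lambda>(f, x1, x2, y1, y2). y2) (\<lambda>(f, x1, x2, y1, y2). (f, x2))
                    (\<lambda>(f, x1, x2, y1, y2). (x1, y1))}"

definition R2_points :: "('x1::finite \<times> 'x2::finite \<times> 'y1::finite \<times> 'y2::finite) pmf \<Rightarrow> nat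
                         \<Rightarrow> (real \<times> real) set" where
  "R2_points q r = {(R12, R21). \<exists>p \<in> T2 q r.
     (let I1 = cmi p (\<lambda>(f, x1, x2, y1, y2). x1) (\<lambda>(f, x1, x2, y1, y2). f) (\<lambda>(f, x1, x2, y1, y2). x2);
          I2 = cmi p (\<lambda>(f, x1, x2, y1, y2). x2) (\<lambda>(f, x1, x2, y1, y2). f) (\<lambda>(f, x1, x2, y1, y2). x1);
          I3 = cmi p (\<lambda>(f, x1, x2, y1, y2). y1) (\<lambda>(f, x1, x2, y1, y2). y2)
                     (\<lambda>(f, x1, x2, y1, y2). (x1, x2))
      in R12 \<ge> I1 \<and> R21 \<ge> I2 \<and> R12 + R21 \<ge> I1 + I2 + I3)}"

definition R2 :: "('x1::finite \<times> 'x2::finite \<times> 'y1::finite \<times> 'y2::finite) pmf \<Rightarrow> nat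
                  \<Rightarrow> (real \<times> real) set" where
  "R2 q r = closure (convex hull (R2_points q r))"

end

theory Submission
  imports Defs
begin

text \<open>
  Given the source blocks, the law of the transcript \<open>C\<close> and of the outputs is a product of a
  factor depending on the first block and a factor depending on the second one, so the private
  randomness can be eliminated at once.  The rates then dominate \<open>I(X1;C|X2)\<close> and
  \<open>I(X2;C|X1)\<close>, and the sum rate dominates \<open>H(C)\<close>, which is at least
  \<open>I(X1;C|X2) + I(X2;C|X1) + H(C|X1 X2)\<close> because interaction cannot increase \<open>I(X1;X2)\<close>;
  moreover \<open>H(C|X1 X2)\<close> is at least \<open>I(Y1;Y2|X1 X2)\<close>, which is close to its value for the
  i.i.d. law.  Adding the past of the first source and the future of the second one to the first
  message turns these block bounds into averages of single-letter bounds, with output laws only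
  close to \<open>q\<close>.

  If a rate pair were outside the closed convex region, a linear functional would separate it.
  Some letter does not exceed the average of this functional; its auxiliary alphabets are
  shrunk by passing to basic solutions of a linear system that preserves the functional, and a
  limit along vanishing errors, which exists since the alphabets are now bounded, lies in the
  region and contradicts the separation.
\<close>

section \<open>Entropy of finitely supported laws\<close>

text \<open>Messages are natural numbers of finite entropy, while entropies here are sums over a
  finite support. Hence every code is cut off at a level \<open>N\<close> chosen after the code,
  which perturbs rates and output law by amounts vanishing as \<open>N\<close> grows. The past of
  one source is paired with the future of the other because \<open>H(X1|C X2)\<close> is expanded
  from the left and \<open>H(X2|C X1)\<close> from the right, and both expansions must condition on
  the same variable. It can join the first message because that message is computed without
  knowledge of \<open>X2\<close>; later rounds have it in their history. The sum-rate condition is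
  carried by slacks: a rate point is (I1 + s1, I2 + s2) with s1, s2 nonnegative and s1 + s2 at least
  I(Y1;Y2|X1 X2), which depends on \<open>q\<close> only. The slacks are common to all letters of a
  code, so choosing a letter and shrinking its alphabets has to control just one linear functional
  of (I1, I2). Besides the equations that fix the law of the history, a single further equation does
  this, which is the \<open>+ 1\<close> of the cardinality bounds.\<close>

definition pr :: "'o pmf \<Rightarrow> ('o \<Rightarrow> 'a) \<Rightarrow> 'a \<Rightarrow> real" where
  "pr p X x = measure_pmf.prob p {w. X w = x}"

text \<open>Written as an expectation over the support. On an infinite support the sum defaults to
  0, so facts about the actual value assume finiteness.\<close>

definition ent :: "'o pmf \<Rightarrow> ('o \<Rightarrow> 'a) \<Rightarrow> real" where
  "ent p X = (\<Sum>w\<in>set_pmf p. pmf p w * - log 2 (pr p X (X w)))"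

abbreviation rv_pair :: "('o \<Rightarrow> 'a) \<Rightarrow> ('o \<Rightarrow> 'b) \<Rightarrow> 'o \<Rightarrow> 'a \<times> 'b" (infixr "&&" 66) where
  "A && B \<equiv> \<lambda>w. (A w, B w)"

text \<open>The conditional mutual information \<open>I(A;B|C)\<close> as four entropies;
  \<open>cmi_eq_cinf\<close> identifies it with \<open>cmi\<close>.\<close>

definition cinf :: "'o pmf \<Rightarrow> ('o \<Rightarrow> 'a) \<Rightarrow> ('o \<Rightarrow> 'b) \<Rightarrow> ('o \<Rightarrow> 'c) \<Rightarrow> real" where
  "cinf p A B C = ent p (A && C) + ent p (B && C)
     - ent p (A && B && C) - ent p C"

lemma pr_nonneg [simp]: "0 \<le> pr p X x"
  by (simp add: pr_def)

lemma pr_le_1 [simp]: "pr p X x \<le> 1"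
  by (simp add: pr_def)

lemma prob_finite_support:
  assumes "finite (set_pmf p)"
  shows "measure_pmf.prob p E = (\<Sum>w\<in>{w\<in>set_pmf p. w \<in> E}. pmf p w)"
proof -
  have "measure_pmf.prob p E = measure_pmf.prob p (E \<inter> set_pmf p)"
    by (simp add: measure_Int_set_pmf)
  also have "\<dots> = (\<Sum>w\<in>E \<inter> set_pmf p. pmf p w)"
    by (rule measure_measure_pmf_finite) (use assms in auto)
  also have "E \<inter> set_pmf p = {w\<in>set_pmf p. w \<in> E}"
    by auto
  finally show ?thesis .
qed

lemma pr_finite_support:
  assumes "finite (set_pmf p)"
  shows "pr p X x = (\<Sum>w\<in>{w\<in>set_pmf p. X w = x}. pmf p w)"
  unfolding pr_def using prob_finite_support[OF assms, of "{w. X w = x}"] by simp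

lemma pr_finite_superset:
  assumes "finite S" "set_pmf p \<subseteq> S"
  shows "pr p X x = (\<Sum>w\<in>{w\<in>S. X w = x}. pmf p w)"
proof -
  have "finite (set_pmf p)" using assms finite_subset by blast
  then have "pr p X x = (\<Sum>w\<in>{w\<in>set_pmf p. X w = x}. pmf p w)" by (rule pr_finite_support)
  also have "\<dots> = (\<Sum>w\<in>{w\<in>S. X w = x}. pmf p w)"
    by (rule sum.mono_neutral_left) (use assms in \<open>auto simp: pmf_eq_0_set_pmf\<close>)
  finally show ?thesis .
qed

lemma pr_pos: "w \<in> set_pmf p \<Longrightarrow> pr p X (X w) > 0"
  unfolding pr_def
  by (metis (mono_tags, lifting) disjoint_iff measure_pmf_zero_iff mem_Collect_eq zero_less_measure_iff)

lemma pr_eq_0_iff: "pr p X x = 0 \<longleftrightarrow> x \<notin> X ` set_pmf p"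
  unfolding pr_def measure_pmf_zero_iff by auto

lemma pr_cong_support:
  assumes "\<And>v. v \<in> set_pmf p \<Longrightarrow> X v = x \<longleftrightarrow> Y v = y"
  shows "pr p X x = pr p Y y"
  unfolding pr_def by (rule measure_pmf.finite_measure_eq_AE) (use assms in \<open>auto simp: AE_measure_pmf_iff\<close>)

lemma pr_mono_support:
  assumes "\<And>v. v \<in> set_pmf p \<Longrightarrow> X v = x \<Longrightarrow> Y v = y"
  shows "pr p X x \<le> pr p Y y"
  unfolding pr_def by (rule measure_pmf.finite_measure_mono_AE) (use assms in \<open>auto simp: AE_measure_pmf_iff\<close>)

lemma pr_map: "pr (map_pmf T p) X x = pr p (\<lambda>w. X (T w)) x"
  by (simp add: pr_def vimage_def)

lemma pr_id: "pr p (\<lambda>w. w) x = pmf p x"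
  by (simp add: pr_def measure_pmf_single)

lemma pr_conj: "measure_pmf.prob p {w. A w = a \<and> B w = b} = pr p (A && B) (a, b)"
  by (simp add: pr_def)

lemma pr_conj3: "measure_pmf.prob p {w. A w = a \<and> B w = b \<and> C w = c} = pr p (A && B && C) (a, b, c)"
  by (simp add: pr_def)

lemma sum_support_rv:
  fixes g :: "'a \<Rightarrow> real"
  assumes "finite (set_pmf p)"
  shows "(\<Sum>w\<in>set_pmf p. pmf p w * g (X w)) = (\<Sum>x\<in>X ` set_pmf p. pr p X x * g x)"
proof -
  have "(\<Sum>w\<in>set_pmf p. pmf p w * g (X w)) =
      (\<Sum>x\<in>X ` set_pmf p. \<Sum>w\<in>{w\<in>set_pmf p. X w = x}. pmf p w * g (X w))"
    by (rule sum.image_gen[OF assms])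
  also have "\<dots> = (\<Sum>x\<in>X ` set_pmf p. pr p X x * g x)"
    by (intro sum.cong) (auto simp: pr_finite_support[OF assms] sum_distrib_right intro!: sum.cong)
  finally show ?thesis .
qed

lemma sum_pr_eq_1:
  assumes "finite (set_pmf p)" "finite V" "X ` set_pmf p \<subseteq> V"
  shows "(\<Sum>x\<in>V. pr p X x) = 1"
proof -
  have "(\<Sum>x\<in>V. pr p X x) = (\<Sum>x\<in>X ` set_pmf p. pr p X x)"
    by (rule sum.mono_neutral_right) (use assms in \<open>auto simp: pr_eq_0_iff\<close>)
  also have "\<dots> = (\<Sum>w\<in>set_pmf p. pmf p w)"
    using sum_support_rv[OF assms(1), of "\<lambda>_. 1" X] by simp
  also have "\<dots> = 1"
    using assms(1) by (simp add: sum_pmf_eq_1)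
  finally show ?thesis .
qed

lemma pr_marginal:
  assumes "finite (set_pmf p)" "finite V" "\<And>w. w \<in> set_pmf p \<Longrightarrow> X w = x \<Longrightarrow> Y w \<in> V"
  shows "pr p X x = (\<Sum>y\<in>V. pr p (X && Y) (x, y))"
proof -
  have "(\<Sum>y\<in>V. pr p (X && Y) (x, y)) =
      (\<Sum>y\<in>V. \<Sum>w\<in>{w\<in>{w\<in>set_pmf p. X w = x}. Y w = y}. pmf p w)"
    by (intro sum.cong) (auto simp: pr_finite_support[OF assms(1)] intro!: sum.cong)
  also have "\<dots> = (\<Sum>w\<in>{w\<in>set_pmf p. X w = x}. pmf p w)"
    by (rule sum.group) (use assms in auto)
  finally show ?thesis by (simp add: pr_finite_support[OF assms(1)])
qed

lemma ent_alt:
  assumes "finite (set_pmf p)" "finite V" "X ` set_pmf p \<subseteq> V"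
  shows "ent p X = (\<Sum>x\<in>V. - (pr p X x * log 2 (pr p X x)))"
proof -
  have "ent p X = (\<Sum>x\<in>X ` set_pmf p. pr p X x * - log 2 (pr p X x))"
    unfolding ent_def by (rule sum_support_rv[OF assms(1), of "\<lambda>x. - log 2 (pr p X x)"])
  also have "\<dots> = (\<Sum>x\<in>V. pr p X x * - log 2 (pr p X x))"
    by (rule sum.mono_neutral_left) (use assms in \<open>auto simp: pr_eq_0_iff\<close>)
  finally show ?thesis by simp
qed

text \<open>Entropy sees only the partition that a variable induces on the support. This is how
  rebracketed tuples, renamed letters and encodings of different types are exchanged
  throughout.\<close>

lemma ent_cong:
  assumes "\<And>v w. v \<in> set_pmf p \<Longrightarrow> w \<in> set_pmf p \<Longrightarrow> X v = X w \<longleftrightarrow> Y v = Y w"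
  shows "ent p X = ent p Y"
proof -
  have "pr p X (X w) = pr p Y (Y w)" if "w \<in> set_pmf p" for w
    by (rule pr_cong_support) (rule assms[OF _ that])
  then show ?thesis by (simp add: ent_def)
qed

lemma ent_mono:
  assumes "\<And>v w. v \<in> set_pmf p \<Longrightarrow> w \<in> set_pmf p \<Longrightarrow> Y v = Y w \<Longrightarrow> X v = X w"
  shows "ent p X \<le> ent p Y"
  unfolding ent_def
proof (rule sum_mono)
  fix w assume w: "w \<in> set_pmf p"
  have "pr p Y (Y w) \<le> pr p X (X w)"
    by (rule pr_mono_support) (rule assms[OF _ w])
  then show "pmf p w * - log 2 (pr p X (X w)) \<le> pmf p w * - log 2 (pr p Y (Y w))"
    using pr_pos[OF w, of X] pr_pos[OF w, of Y] by (intro mult_left_mono) auto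
qed

lemma ent_map:
  assumes "finite (set_pmf p)"
  shows "ent (map_pmf T p) X = ent p (\<lambda>w. X (T w))"
proof -
  let ?V = "(\<lambda>w. X (T w)) ` set_pmf p"
  have "ent (map_pmf T p) X = (\<Sum>x\<in>?V. - (pr (map_pmf T p) X x * log 2 (pr (map_pmf T p) X x)))"
    by (rule ent_alt) (use assms in auto)
  also have "\<dots> = ent p (\<lambda>w. X (T w))"
    unfolding pr_map by (rule ent_alt[symmetric]) (use assms in auto)
  finally show ?thesis .
qed

lemma ent_const: "ent p (\<lambda>_. c) = 0"
  by (simp add: ent_def pr_def)

text \<open>This is \<open>I(A;B|C) >= 0\<close>. The ratio p(ac) p(bc) / (p(abc) p(c)) has
  expectation at most 1, and \<open>ln x <= x - 1\<close> bounds the expectation of its logarithm by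
  0.\<close>

lemma ent_submodular:
  assumes fin: "finite (set_pmf p)"
  shows "ent p (A && B && C) + ent p C \<le> ent p (A && C) + ent p (B && C)"
proof -
  let ?S = "set_pmf p"
  define abc where "abc w = pr p (A && B && C) (A w, B w, C w)" for w
  define ac where "ac w = pr p (A && C) (A w, C w)" for w
  define bc where "bc w = pr p (B && C) (B w, C w)" for w
  define c where "c w = pr p C (C w)" for w
  have pos: "abc w > 0" "ac w > 0" "bc w > 0" "c w > 0" if "w \<in> ?S" for w
    unfolding abc_def ac_def bc_def c_def
    using pr_pos[OF that, of "\<lambda>w. (A w, B w, C w)"] pr_pos[OF that, of "\<lambda>w. (A w, C w)"]
      pr_pos[OF that, of "\<lambda>w. (B w, C w)"] pr_pos[OF that, of C] by auto
  let ?AS = "A ` ?S" and ?BS = "B ` ?S" and ?CS = "C ` ?S"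
  define g where "g = (\<lambda>(x, y, z). pr p (A && C) (x, z) * pr p (B && C) (y, z)
      / (pr p (A && B && C) (x, y, z) * pr p C z))"
  have "(\<Sum>w\<in>?S. pmf p w * (ac w * bc w / (abc w * c w)))
      = (\<Sum>w\<in>?S. pmf p w * g (A w, B w, C w))"
    by (simp add: g_def abc_def ac_def bc_def c_def)
  also have "\<dots> = (\<Sum>t\<in>(A && B && C) ` ?S. pr p (A && B && C) t * g t)"
    by (rule sum_support_rv[OF fin])
  also have "\<dots> = (\<Sum>t\<in>(A && B && C) ` ?S.
      case t of (x, y, z) \<Rightarrow> pr p (A && C) (x, z) * pr p (B && C) (y, z) / pr p C z)"
  proof (rule sum.cong[OF refl])
    fix t assume "t \<in> (A && B && C) ` ?S"
    then obtain w where "w \<in> ?S" "t = (A w, B w, C w)" by auto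
    then show "pr p (A && B && C) t * g t = (case t of (x, y, z) \<Rightarrow>
        pr p (A && C) (x, z) * pr p (B && C) (y, z) / pr p C z)"
      using pr_pos[of w p "\<lambda>w. (A w, B w, C w)"] by (simp add: g_def)
  qed
  \<comment> \<open>Extending the sum from attained triples to the whole box only adds nonnegative
    terms, and on the box the sums over \<open>y\<close>, then over \<open>x\<close> and
    \<open>z\<close>, are marginalizations.\<close>
  also have "\<dots> \<le> (\<Sum>t\<in>?AS \<times> ?BS \<times> ?CS.
      case t of (x, y, z) \<Rightarrow> pr p (A && C) (x, z) * pr p (B && C) (y, z) / pr p C z)"
    by (rule sum_mono2) (use fin in auto)
  also have "\<dots> = (\<Sum>x\<in>?AS. \<Sum>y\<in>?BS. \<Sum>z\<in>?CS.
      pr p (A && C) (x, z) * pr p (B && C) (y, z) / pr p C z)"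
    by (simp add: sum.cartesian_product)
  also have "\<dots> = (\<Sum>x\<in>?AS. \<Sum>z\<in>?CS. \<Sum>y\<in>?BS.
      pr p (A && C) (x, z) * pr p (B && C) (y, z) / pr p C z)"
    by (intro sum.cong refl sum.swap)
  also have "\<dots> = (\<Sum>x\<in>?AS. \<Sum>z\<in>?CS. pr p (A && C) (x, z))"
  proof (intro sum.cong refl)
    fix x z assume "z \<in> ?CS"
    then have z: "pr p C z > 0" using pr_pos[of _ p C] by auto
    have "pr p C z = (\<Sum>y\<in>?BS. pr p (C && B) (z, y))"
      by (rule pr_marginal) (use fin in auto)
    also have "\<dots> = (\<Sum>y\<in>?BS. pr p (B && C) (y, z))"
      by (intro sum.cong refl pr_cong_support) auto
    finally have "pr p (A && C) (x, z) * (\<Sum>y\<in>?BS. pr p (B && C) (y, z)) / pr p C z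
        = pr p (A && C) (x, z)"
      using z by simp
    then show "(\<Sum>y\<in>?BS. pr p (A && C) (x, z) * pr p (B && C) (y, z) / pr p C z)
        = pr p (A && C) (x, z)"
      by (simp add: sum_distrib_left sum_divide_distrib)
  qed
  also have "\<dots> = (\<Sum>t\<in>?AS \<times> ?CS. pr p (A && C) t)"
    by (simp add: sum.cartesian_product)
  also have "\<dots> = 1"
    by (rule sum_pr_eq_1) (use fin in auto)
  finally have le1: "(\<Sum>w\<in>?S. pmf p w * (ac w * bc w / (abc w * c w))) \<le> 1" .
  have "ent p (A && B && C) + ent p C - ent p (A && C) - ent p (B && C)
      = (\<Sum>w\<in>?S. pmf p w * (log 2 (ac w) + log 2 (bc w) - log 2 (abc w) - log 2 (c w)))"
    unfolding ent_def abc_def ac_def bc_def c_def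
    by (simp add: sum.distrib sum_subtractf sum_negf algebra_simps)
  also have "\<dots> = (\<Sum>w\<in>?S. pmf p w * log 2 (ac w * bc w / (abc w * c w)))"
  proof (intro sum.cong refl)
    fix w assume "w \<in> ?S"
    note pos[OF this]
    then show "pmf p w * (log 2 (ac w) + log 2 (bc w) - log 2 (abc w) - log 2 (c w))
        = pmf p w * log 2 (ac w * bc w / (abc w * c w))"
      by (simp add: log_mult log_divide)
  qed
  also have "\<dots> \<le> (\<Sum>w\<in>?S. pmf p w * ((ac w * bc w / (abc w * c w) - 1) / ln 2))"
    using pos by (intro sum_mono mult_left_mono) (auto simp: log_def intro!: divide_right_mono ln_le_minus_one)
  also have "\<dots> = ((\<Sum>w\<in>?S. pmf p w * (ac w * bc w / (abc w * c w))) - (\<Sum>w\<in>?S. pmf p w)) / ln 2"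
    by (simp add: sum_divide_distrib sum_subtractf algebra_simps diff_divide_distrib)
  also have "\<dots> \<le> 0"
    using le1 fin by (simp add: sum_pmf_eq_1 divide_nonpos_pos)
  finally show ?thesis by linarith
qed

lemma ent_subadditive:
  assumes "finite (set_pmf p)"
  shows "ent p (A && B) \<le> ent p A + ent p B"
proof -
  have "ent p (\<lambda>w. (A w, B w, ())) + ent p (\<lambda>w. ()) \<le> ent p (\<lambda>w. (A w, ())) + ent p (\<lambda>w. (B w, ()))"
    by (rule ent_submodular[OF assms])
  moreover have "ent p (\<lambda>w. (A w, B w, ())) = ent p (A && B)"
    "ent p (\<lambda>w. (A w, ())) = ent p A" "ent p (\<lambda>w. (B w, ())) = ent p B"
    by (auto intro!: ent_cong)
  ultimately show ?thesis by (simp add: ent_const)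
qed

lemma cinf_nonneg: "finite (set_pmf p) \<Longrightarrow> 0 \<le> cinf p A B C"
  using ent_submodular[of p A B C] by (simp add: cinf_def)

lemma cinf_map:
  "finite (set_pmf p) \<Longrightarrow> cinf (map_pmf T p) A B C = cinf p (\<lambda>w. A (T w)) (\<lambda>w. B (T w)) (\<lambda>w. C (T w))"
  by (simp add: cinf_def ent_map)

lemma cinf_cong:
  assumes "\<And>v w. v \<in> set_pmf p \<Longrightarrow> w \<in> set_pmf p \<Longrightarrow> A v = A w \<longleftrightarrow> A' v = A' w"
    and "\<And>v w. v \<in> set_pmf p \<Longrightarrow> w \<in> set_pmf p \<Longrightarrow> B v = B w \<longleftrightarrow> B' v = B' w"
    and "\<And>v w. v \<in> set_pmf p \<Longrightarrow> w \<in> set_pmf p \<Longrightarrow> C v = C w \<longleftrightarrow> C' v = C' w"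
  shows "cinf p A B C = cinf p A' B' C'"
  unfolding cinf_def
  by (intro arg_cong2[where f = "(-)"] arg_cong2[where f = "(+)"] ent_cong) (simp_all add: assms)

lemma markov_chain_pr:
  "markov_chain p A B C \<longleftrightarrow> (\<forall>a b c. pr p (A && B && C) (a, b, c) * pr p B b
     = pr p (A && B) (a, b) * pr p (B && C) (b, c))"
  unfolding markov_chain_def pr_conj pr_conj3 by (simp add: pr_def)

text \<open>Values never attained make both sides 0, so only attained ones matter. Two outcomes
  \<open>v\<close> and \<open>w\<close> are needed, since \<open>A v\<close> and \<open>C w\<close>
  may each occur with the same value of \<open>B\<close> without occurring together. In this form
  the condition visibly depends on induced partitions only.\<close>

lemma markov_chain_support:
  "markov_chain p A B C \<longleftrightarrow> (\<forall>v\<in>set_pmf p. \<forall>w\<in>set_pmf p. B v = B w \<longrightarrow>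
     pr p (A && B && C) (A v, B v, C w) * pr p B (B v)
     = pr p (A && B) (A v, B v) * pr p (B && C) (B w, C w))"
  (is "_ \<longleftrightarrow> ?R")
proof
  assume ?R
  show "markov_chain p A B C"
    unfolding markov_chain_pr
  proof (intro allI)
    fix a b c
    consider "(a, b) \<in> (A && B) ` set_pmf p" "(b, c) \<in> (B && C) ` set_pmf p"
      | "(a, b) \<notin> (A && B) ` set_pmf p" | "(b, c) \<notin> (B && C) ` set_pmf p"
      by argo
    then show "pr p (A && B && C) (a, b, c) * pr p B b
     = pr p (A && B) (a, b) * pr p (B && C) (b, c)"
    proof cases
      case 1
      obtain v where v: "v \<in> set_pmf p" "(a, b) = (A v, B v)" using 1(1) by blast
      obtain w where w: "w \<in> set_pmf p" "(b, c) = (B w, C w)" using 1(2) by blast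
      have "B v = B w" using v w by simp
      then have "pr p (A && B && C) (A v, B v, C w) * pr p B (B v)
          = pr p (A && B) (A v, B v) * pr p (B && C) (B w, C w)"
        using bspec[OF bspec[OF \<open>?R\<close> v(1)] w(1)] by (rule mp[rotated])
      then show ?thesis using v(2) w(2) by simp
    next
      case 2
      then have "pr p (A && B) (a, b) = 0" "pr p (A && B && C) (a, b, c) = 0"
        unfolding pr_eq_0_iff by auto
      then show ?thesis by simp
    next
      case 3
      then have "pr p (B && C) (b, c) = 0" "pr p (A && B && C) (a, b, c) = 0"
        unfolding pr_eq_0_iff by auto
      then show ?thesis by simp
    qed
  qed
next
  assume "markov_chain p A B C"
  then have *: "pr p (A && B && C) (A v, B v, C w) * pr p B (B v)
     = pr p (A && B) (A v, B v) * pr p (B && C) (B v, C w)" for v w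
    unfolding markov_chain_pr by blast
  show ?R
    by (intro ballI impI) (metis *)
qed

lemma markov_chain_cong:
  assumes "\<And>v w. v \<in> set_pmf p \<Longrightarrow> w \<in> set_pmf p \<Longrightarrow> A v = A w \<longleftrightarrow> A' v = A' w"
    and "\<And>v w. v \<in> set_pmf p \<Longrightarrow> w \<in> set_pmf p \<Longrightarrow> B v = B w \<longleftrightarrow> B' v = B' w"
    and "\<And>v w. v \<in> set_pmf p \<Longrightarrow> w \<in> set_pmf p \<Longrightarrow> C v = C w \<longleftrightarrow> C' v = C' w"
  shows "markov_chain p A B C \<longleftrightarrow> markov_chain p A' B' C'"
proof -
  have *: "pr p (A && B && C) (A v, B v, C w) = pr p (A' && B' && C') (A' v, B' v, C' w)"
    "pr p B (B v) = pr p B' (B' v)"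
    "pr p (A && B) (A v, B v) = pr p (A' && B') (A' v, B' v)"
    "pr p (B && C) (B w, C w) = pr p (B' && C') (B' w, C' w)"
    if "v \<in> set_pmf p" "w \<in> set_pmf p" for v w
    by (rule pr_cong_support, use assms[OF _ that(1)] assms[OF _ that(2)] in simp)+
  show ?thesis
    unfolding markov_chain_support by (intro ball_cong refl) (simp add: * assms(2))
qed

lemma markov_chain_map:
  "markov_chain (map_pmf T p) A B C \<longleftrightarrow>
   markov_chain p (\<lambda>w. A (T w)) (\<lambda>w. B (T w)) (\<lambda>w. C (T w))"
  by (simp add: markov_chain_pr pr_map)

text \<open>The equality case of \<open>ent_submodular\<close>: take logarithms of the defining
  identity at the outcomes of the support, where all four probabilities are positive, and
  average.\<close>

lemma markov_chain_ent:
  assumes fin: "finite (set_pmf p)" and mc: "markov_chain p A B C"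
  shows "ent p (A && B) + ent p (B && C) = ent p (A && B && C) + ent p B"
proof -
  have "log 2 (pr p (A && B && C) (A w, B w, C w)) + log 2 (pr p B (B w))
      = log 2 (pr p (A && B) (A w, B w)) + log 2 (pr p (B && C) (B w, C w))"
    if w: "w \<in> set_pmf p" for w
  proof -
    have "pr p (A && B && C) (A w, B w, C w) * pr p B (B w)
      = pr p (A && B) (A w, B w) * pr p (B && C) (B w, C w)"
      using mc unfolding markov_chain_pr by blast
    then have "log 2 (pr p (A && B && C) (A w, B w, C w) * pr p B (B w))
      = log 2 (pr p (A && B) (A w, B w) * pr p (B && C) (B w, C w))"
      by simp
    then show ?thesis
      using pr_pos[OF w, of "\<lambda>w. (A w, B w, C w)"] pr_pos[OF w, of "\<lambda>w. (A w, B w)"]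
        pr_pos[OF w, of "\<lambda>w. (B w, C w)"] pr_pos[OF w, of B] by (simp add: log_mult)
  qed
  then have "(\<Sum>w\<in>set_pmf p. pmf p w * (log 2 (pr p (A && B && C) (A w, B w, C w)) + log 2 (pr p B (B w))))
    = (\<Sum>w\<in>set_pmf p. pmf p w * (log 2 (pr p (A && B) (A w, B w)) + log 2 (pr p (B && C) (B w, C w))))"
    by (intro sum.cong) auto
  then show ?thesis
    unfolding ent_def by (simp add: sum.distrib distrib_left sum_negf)
qed

text \<open>The factors need not be probabilities. Summing out \<open>a\<close> or \<open>c\<close>
  acts on one factor only, so both sides become \<open>u a b * v b c\<close> times the two total
  sums.\<close>

lemma markov_chain_factor:
  fixes u :: "'a \<Rightarrow> 'b \<Rightarrow> real" and v :: "'b \<Rightarrow> 'c \<Rightarrow> real"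
  assumes fin: "finite (set_pmf p)"
    and fac: "\<And>a b c. pr p (A && B && C) (a, b, c) = u a b * v b c"
  shows "markov_chain p A B C"
  unfolding markov_chain_pr
proof (intro allI)
  fix a b c
  let ?A = "A ` set_pmf p" and ?C = "C ` set_pmf p"
  have 1: "pr p (A && B) (a', b) = (\<Sum>c\<in>?C. u a' b * v b c)" for a'
  proof -
    have "pr p (A && B) (a', b) = (\<Sum>c\<in>?C. pr p ((A && B) && C) ((a', b), c))"
      by (rule pr_marginal) (use fin in auto)
    also have "\<dots> = (\<Sum>c\<in>?C. pr p (A && B && C) (a', b, c))"
      by (intro sum.cong refl pr_cong_support) auto
    finally show ?thesis by (simp add: fac)
  qed
  have 2: "pr p (B && C) (b, c) = (\<Sum>a\<in>?A. u a b * v b c)"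
  proof -
    have "pr p (B && C) (b, c) = (\<Sum>a\<in>?A. pr p ((B && C) && A) ((b, c), a))"
      by (rule pr_marginal) (use fin in auto)
    also have "\<dots> = (\<Sum>a\<in>?A. pr p (A && B && C) (a, b, c))"
      by (intro sum.cong refl pr_cong_support) auto
    finally show ?thesis by (simp add: fac)
  qed
  have "pr p B b = (\<Sum>a\<in>?A. pr p (B && A) (b, a))"
    by (rule pr_marginal) (use fin in auto)
  also have "\<dots> = (\<Sum>a\<in>?A. pr p (A && B) (a, b))"
    by (intro sum.cong refl pr_cong_support) auto
  finally have 3: "pr p B b = (\<Sum>a\<in>?A. u a b) * (\<Sum>c\<in>?C. v b c)"
    by (simp add: 1 sum_distrib_left[symmetric] sum_distrib_right[symmetric])
  show "pr p (A && B && C) (a, b, c) * pr p B b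
     = pr p (A && B) (a, b) * pr p (B && C) (b, c)"
    unfolding fac 1 2 3 by (simp add: sum_distrib_left[symmetric] sum_distrib_right[symmetric])
qed

section \<open>The library notion of conditional mutual information expressed by entropies\<close>

lemma distributed_count_space_pmf:
  "distributed (measure_pmf p) (count_space UNIV) X (\<lambda>x. ennreal (pr p X x))"
proof -
  have "distr (measure_pmf p) (count_space UNIV) X = measure_pmf (map_pmf X p)"
    by (simp add: map_pmf_rep_eq)
  also have "\<dots> = density (count_space UNIV) (\<lambda>x. ennreal (pr p X x))"
    unfolding measure_pmf_eq_density[of "map_pmf X p"] pmf_map pr_def by (simp add: vimage_def)
  finally show ?thesis by (simp add: distributed_def)
qed

lemma mutual_information_pmf:
  fixes X :: "'o \<Rightarrow> 'a" and Y :: "'o \<Rightarrow> 'b"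
  assumes fin: "finite (set_pmf p)" and cnt: "countable (UNIV :: 'a set)" "countable (UNIV :: 'b set)"
  shows "prob_space.mutual_information (measure_pmf p) 2 (count_space UNIV) (count_space UNIV) X Y
    = ent p X + ent p Y - ent p (X && Y)"
proof -
  interpret information_space "measure_pmf p" 2
    by standard simp
  let ?XY = "\<lambda>w. (X w, Y w)"
  have pair: "count_space (UNIV :: 'a set) \<Otimes>\<^sub>M count_space (UNIV :: 'b set) = count_space UNIV"
    using pair_measure_countable[OF cnt] by simp
  let ?f = "\<lambda>t. pr p ?XY t * log 2 (pr p ?XY t / (pr p X (fst t) * pr p Y (snd t)))"
  have z: "?f t = 0" if "t \<notin> ?XY ` set_pmf p" for t
  proof -
    have "pr p ?XY t = 0" using that unfolding pr_eq_0_iff .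
    then show ?thesis by simp
  qed
  then have sub: "{t \<in> UNIV. ?f t \<noteq> 0} \<subseteq> ?XY ` set_pmf p" by blast
  have "prob_space.mutual_information (measure_pmf p) 2 (count_space UNIV) (count_space UNIV) X Y = integral\<^sup>L (count_space UNIV \<Otimes>\<^sub>M count_space UNIV) ?f"
  proof (rule mutual_information_distr)
    show "sigma_finite_measure (count_space (UNIV :: 'a set))" "sigma_finite_measure (count_space (UNIV :: 'b set))"
      using cnt by (auto intro!: sigma_finite_measure_count_space_countable)
    show "distributed (measure_pmf p) (count_space UNIV \<Otimes>\<^sub>M count_space UNIV) (\<lambda>x. (X x, Y x)) (\<lambda>x. ennreal (pr p ?XY x))"
      unfolding pair by (rule distributed_count_space_pmf)
  qed (simp_all add: distributed_count_space_pmf)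
  also have "\<dots> = (\<Sum>t\<in>?XY ` set_pmf p. ?f t)"
  proof -
    have fin': "finite (?XY ` set_pmf p)" using fin by (rule finite_imageI)
    have "integral\<^sup>L (count_space UNIV) ?f = (\<Sum>t | t \<in> UNIV \<and> ?f t \<noteq> 0. ?f t)"
      by (rule lebesgue_integral_count_space_finite_support) (rule finite_subset[OF sub fin'])
    also have "\<dots> = (\<Sum>t\<in>?XY ` set_pmf p. ?f t)"
      by (rule sum.mono_neutral_left[OF fin' sub]) blast
    finally show ?thesis unfolding pair .
  qed
  also have "\<dots> = (\<Sum>w\<in>set_pmf p. pmf p w * log 2 (pr p ?XY (?XY w) / (pr p X (X w) * pr p Y (Y w))))"
    using sum_support_rv[OF fin, of "\<lambda>t. log 2 (pr p ?XY t / (pr p X (fst t) * pr p Y (snd t)))" ?XY] by simp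
  also have "\<dots> = (\<Sum>w\<in>set_pmf p. pmf p w * - log 2 (pr p X (X w)) + pmf p w * - log 2 (pr p Y (Y w)) - pmf p w * - log 2 (pr p ?XY (?XY w)))"
  proof (intro sum.cong refl)
    fix w assume w: "w \<in> set_pmf p"
    show "pmf p w * log 2 (pr p ?XY (?XY w) / (pr p X (X w) * pr p Y (Y w)))
      = pmf p w * - log 2 (pr p X (X w)) + pmf p w * - log 2 (pr p Y (Y w)) - pmf p w * - log 2 (pr p ?XY (?XY w))"
      using pr_pos[OF w, of ?XY] pr_pos[OF w, of X] pr_pos[OF w, of Y]
      by (simp add: log_divide log_mult algebra_simps)
  qed
  finally show ?thesis unfolding ent_def by (simp only: sum.distrib sum_subtractf)
qed

text \<open>The library defines \<open>I(A;B|C)\<close> as \<open>I(A;BC) - I(A;C)\<close>, and the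
  entropy of \<open>A\<close> cancels. Countable types make the product of counting measures a
  counting measure again.\<close>

lemma cmi_eq_cinf:
  fixes A :: "'o \<Rightarrow> 'a" and B :: "'o \<Rightarrow> 'b" and C :: "'o \<Rightarrow> 'c"
  assumes fin: "finite (set_pmf p)"
    and cnt: "countable (UNIV :: 'a set)" "countable (UNIV :: 'b set)" "countable (UNIV :: 'c set)"
  shows "cmi p A B C = cinf p A B C"
proof -
  have pair: "count_space (UNIV :: 'b set) \<Otimes>\<^sub>M count_space (UNIV :: 'c set) = count_space UNIV"
    using pair_measure_countable[OF cnt(2,3)] by simp
  have "countable (UNIV \<times> UNIV :: ('b \<times> 'c) set)"
    using cnt(2,3) by (rule countable_SIGMA)
  then have cnt': "countable (UNIV :: ('b \<times> 'c) set)" by simp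
  have "prob_space (measure_pmf p)" by (rule prob_space_measure_pmf)
  then show ?thesis
    unfolding cmi_def cinf_def
    by (simp add: prob_space.conditional_mutual_information_def pair mutual_information_pmf fin cnt cnt')
qed

section \<open>Block bounds and single-letterization of entropies\<close>

lemma take_Suc_eq_iff:
  assumes "k < length c" "k < length c'"
  shows "take (Suc k) c = take (Suc k) c' \<longleftrightarrow> take k c = take k c' \<and> c ! k = c' ! k"
  using assms by (simp add: take_Suc_conv_app_nth)

text \<open>Chain rule over the rounds: round \<open>k\<close> contributes
  \<open>I(X1;C_k|C_<k X2)\<close>, which is at most the entropy of the message if the round is
  counted and is 0 by the Markov chain otherwise. The predicate \<open>s\<close> selects the counted
  rounds, so that one lemma serves both directions.\<close>

lemma rate_bound:
  assumes fin: "finite (set_pmf P)"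
    and len: "\<And>w. w \<in> set_pmf P \<Longrightarrow> length (C w) = r"
    and mc: "\<And>k. k < r \<Longrightarrow> \<not> s k \<Longrightarrow>
      markov_chain P (\<lambda>w. C w ! k) (\<lambda>w. (take k (C w), X2 w)) X1"
  shows "cinf P X1 C X2 \<le> (\<Sum>k\<in>{k. k < r \<and> s k}. ent P (\<lambda>w. C w ! k))"
proof -
  have "cinf P X1 (\<lambda>w. take k (C w)) X2 \<le> (\<Sum>j\<in>{j. j < k \<and> s j}. ent P (\<lambda>w. C w ! j))"
    if "k \<le> r" for k using that
  proof (induction k)
    case 0
    have "ent P (\<lambda>w. (take 0 (C w), X2 w)) = ent P X2"
      "ent P (\<lambda>w. (X1 w, take 0 (C w), X2 w)) = ent P (X1 && X2)"
      by (auto intro!: ent_cong)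
    then show ?case by (simp add: cinf_def)
  next
    case (Suc k)
    let ?c = "\<lambda>w. C w ! k" and ?T = "\<lambda>w. take k (C w)" and ?T' = "\<lambda>w. take (Suc k) (C w)"
    note iff = take_Suc_eq_iff[of k "C v" "C w" for v w]
    have e1: "ent P (?c && ?T && X2) = ent P (?T' && X2)"
      by (rule ent_cong) (use Suc.prems in \<open>auto simp: iff len\<close>)
    have e2: "ent P ((?T && X2) && X1) = ent P (X1 && ?T && X2)"
      by (rule ent_cong) auto
    have e3: "ent P (?c && (?T && X2) && X1) = ent P (X1 && ?T' && X2)"
      by (rule ent_cong) (use Suc.prems in \<open>auto simp: iff len\<close>)
    show ?case
    proof (cases "s k")
      case True
      have "ent P (?c && ?T && X2) \<le> ent P ?c + ent P (?T && X2)"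
        by (rule ent_subadditive[OF fin])
      moreover have "ent P (X1 && ?T && X2) \<le> ent P (?c && (?T && X2) && X1)"
        by (rule ent_mono) auto
      moreover have "{j. j < Suc k \<and> s j} = insert k {j. j < k \<and> s j}"
        using True by (auto simp: less_Suc_eq)
      ultimately show ?thesis
        using Suc unfolding cinf_def e1 e3 by simp
    next
      case False
      have "{j. j < Suc k \<and> s j} = {j. j < k \<and> s j}"
        using False by (auto simp: less_Suc_eq)
      moreover have "ent P (?c && ?T && X2) + ent P ((?T && X2) && X1)
          = ent P (?c && (?T && X2) && X1) + ent P (?T && X2)"
        by (rule markov_chain_ent[OF fin]) (use mc[OF _ False] Suc.prems in simp)
      ultimately show ?thesis
        using Suc unfolding cinf_def e1 e2 e3 by simp
    qed
  qed
  from this[of r] have "cinf P X1 (\<lambda>w. take r (C w)) X2 \<le> (\<Sum>k\<in>{k. k < r \<and> s k}. ent P (\<lambda>w. C w ! k))"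
    by simp
  moreover have "cinf P X1 (\<lambda>w. take r (C w)) X2 = cinf P X1 C X2"
    unfolding cinf_def by (auto intro!: arg_cong2[where f = "(-)"] arg_cong2[where f = "(+)"] ent_cong simp: len)
  ultimately show ?thesis by simp
qed

text \<open>No round increases \<open>I(X1;X2|C_<k)\<close>: a message of the first node is
  independent of \<open>X2\<close> given the history and \<open>X1\<close>, so adding it to
  \<open>X1\<close> leaves the information about \<open>X2\<close> unchanged, and moving it into the
  condition subtracts \<open>I(C_k;X2|C_<k) >= 0\<close>. Rounds of the second node are
  symmetric.\<close>

lemma interactive_information_le:
  assumes fin: "finite (set_pmf P)"
    and len: "\<And>w. w \<in> set_pmf P \<Longrightarrow> length (C w) = r"
    and mc1: "\<And>k. k < r \<Longrightarrow> s k \<Longrightarrow>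
      markov_chain P (\<lambda>w. C w ! k) (\<lambda>w. (take k (C w), X1 w)) X2"
    and mc2: "\<And>k. k < r \<Longrightarrow> \<not> s k \<Longrightarrow>
      markov_chain P (\<lambda>w. C w ! k) (\<lambda>w. (take k (C w), X2 w)) X1"
  shows "cinf P X1 X2 C \<le> ent P X1 + ent P X2 - ent P (X1 && X2)"
proof -
  have "cinf P X1 X2 (\<lambda>w. take k (C w)) \<le> ent P X1 + ent P X2 - ent P (X1 && X2)"
    if "k \<le> r" for k using that
  proof (induction k)
    case 0
    have "ent P (\<lambda>w. (X1 w, take 0 (C w))) = ent P X1" "ent P (\<lambda>w. (X2 w, take 0 (C w))) = ent P X2"
      "ent P (\<lambda>w. (X1 w, X2 w, take 0 (C w))) = ent P (X1 && X2)"
      by (auto intro!: ent_cong)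
    moreover have "ent P (\<lambda>w. take 0 (C w)) = 0" by (simp add: ent_const)
    ultimately show ?case by (simp add: cinf_def)
  next
    case (Suc k)
    let ?c = "\<lambda>w. C w ! k" and ?T = "\<lambda>w. take k (C w)" and ?T' = "\<lambda>w. take (Suc k) (C w)"
    note iff = take_Suc_eq_iff[of k "C v" "C w" for v w]
    have e1: "ent P (X1 && ?T') = ent P (?c && ?T && X1)"
      "ent P (X2 && ?T') = ent P (?c && ?T && X2)"
      "ent P (X1 && X2 && ?T') = ent P (?c && (?T && X1) && X2)"
      "ent P (X1 && X2 && ?T') = ent P (?c && (?T && X2) && X1)"
      "ent P (X1 && ?c && ?T) = ent P (?c && ?T && X1)"
      "ent P (X2 && ?c && ?T) = ent P (?c && ?T && X2)"
      "ent P ?T' = ent P (?c && ?T)"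
      by (rule ent_cong; use Suc.prems in \<open>auto simp: iff len\<close>)+
    have e2: "ent P (X1 && ?T) = ent P (?T && X1)"
      "ent P (X2 && ?T) = ent P (?T && X2)"
      "ent P (X1 && X2 && ?T) = ent P ((?T && X1) && X2)"
      "ent P (X1 && X2 && ?T) = ent P ((?T && X2) && X1)"
      by (rule ent_cong; auto)+
    have "cinf P X1 X2 ?T' \<le> cinf P X1 X2 ?T"
    proof (cases "s k")
      case True
      have "ent P (?c && ?T && X1) + ent P ((?T && X1) && X2)
          = ent P (?c && (?T && X1) && X2) + ent P (?T && X1)"
        by (rule markov_chain_ent[OF fin]) (use mc1[OF _ True] Suc.prems in simp)
      moreover have "ent P (X2 && ?c && ?T) + ent P ?T \<le> ent P (X2 && ?T) + ent P (?c && ?T)"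
        by (rule ent_submodular[OF fin])
      ultimately show ?thesis
        using e1 e2 unfolding cinf_def by linarith
    next
      case False
      have "ent P (?c && ?T && X2) + ent P ((?T && X2) && X1)
          = ent P (?c && (?T && X2) && X1) + ent P (?T && X2)"
        by (rule markov_chain_ent[OF fin]) (use mc2[OF _ False] Suc.prems in simp)
      moreover have "ent P (X1 && ?c && ?T) + ent P ?T \<le> ent P (X1 && ?T) + ent P (?c && ?T)"
        by (rule ent_submodular[OF fin])
      ultimately show ?thesis
        using e1 e2 unfolding cinf_def by linarith
    qed
    then show ?case using Suc by simp
  qed
  from this[of r] have "cinf P X1 X2 (\<lambda>w. take r (C w)) \<le> ent P X1 + ent P X2 - ent P (X1 && X2)"
    by simp
  moreover have "cinf P X1 X2 (\<lambda>w. take r (C w)) = cinf P X1 X2 C"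
    unfolding cinf_def by (auto intro!: arg_cong2[where f = "(-)"] arg_cong2[where f = "(+)"] ent_cong simp: len)
  ultimately show ?thesis by simp
qed

lemma ent_list_le:
  assumes fin: "finite (set_pmf P)"
    and len: "\<And>w. w \<in> set_pmf P \<Longrightarrow> length (C w) = r"
  shows "ent P C \<le> (\<Sum>k<r. ent P (\<lambda>w. C w ! k))"
proof -
  have "ent P (\<lambda>w. take k (C w)) \<le> (\<Sum>j<k. ent P (\<lambda>w. C w ! j))" if "k \<le> r" for k using that
  proof (induction k)
    case 0
    then show ?case by (simp add: ent_const)
  next
    case (Suc k)
    note iff = take_Suc_eq_iff[of k "C v" "C w" for v w]
    have "ent P (\<lambda>w. take (Suc k) (C w)) = ent P (\<lambda>w. (take k (C w), C w ! k))"
      by (rule ent_cong) (use Suc.prems in \<open>auto simp: iff len\<close>)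
    also have "\<dots> \<le> ent P (\<lambda>w. take k (C w)) + ent P (\<lambda>w. C w ! k)"
      by (rule ent_subadditive[OF fin])
    finally show ?case using Suc by simp
  qed
  from this[of r] have "ent P (\<lambda>w. take r (C w)) \<le> (\<Sum>k<r. ent P (\<lambda>w. C w ! k))" by simp
  moreover have "ent P (\<lambda>w. take r (C w)) = ent P C"
    by (rule ent_cong) (auto simp: len)
  ultimately show ?thesis by simp
qed

text \<open>The difference between \<open>H(C)\<close> and
  \<open>I(X1;C|X2) + I(X2;C|X1) + H(C|X1 X2)\<close> is exactly
  \<open>I(X1;X2) - I(X1;X2|C)\<close>. For the outputs, data processing along Y1 - (C X1 X2) - Y2
  gives \<open>I(Y1;Y2|X1 X2) <= I(Y1;C|X1 X2) <= H(C|X1 X2)\<close>.\<close>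

lemma sum_rate_bound:
  assumes fin: "finite (set_pmf P)"
    and len: "\<And>w. w \<in> set_pmf P \<Longrightarrow> length (C w) = r"
    and mc1: "\<And>k. k < r \<Longrightarrow> s k \<Longrightarrow>
      markov_chain P (\<lambda>w. C w ! k) (\<lambda>w. (take k (C w), X1 w)) X2"
    and mc2: "\<And>k. k < r \<Longrightarrow> \<not> s k \<Longrightarrow>
      markov_chain P (\<lambda>w. C w ! k) (\<lambda>w. (take k (C w), X2 w)) X1"
    and mcY: "markov_chain P Y1 (C && X1 && X2) Y2"
  shows "cinf P X1 C X2 + cinf P X2 C X1 + cinf P Y1 Y2 (X1 && X2)
    \<le> (\<Sum>k<r. ent P (\<lambda>w. C w ! k))"
proof -
  have 1: "cinf P X1 X2 C \<le> ent P X1 + ent P X2 - ent P (X1 && X2)"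
    by (rule interactive_information_le[OF fin len mc1 mc2])
  have 2: "ent P C \<le> (\<Sum>k<r. ent P (\<lambda>w. C w ! k))"
    by (rule ent_list_le[OF fin len])
  let ?X = "\<lambda>w. (X1 w, X2 w)"
  have 3: "ent P (Y1 && C && ?X) + ent P ((C && ?X) && Y2)
      = ent P (Y1 && (C && ?X) && Y2) + ent P (C && ?X)"
    by (rule markov_chain_ent[OF fin mcY])
  have 4: "ent P (Y1 && C && Y2 && ?X) + ent P (Y2 && ?X)
      \<le> ent P (Y1 && Y2 && ?X) + ent P (C && Y2 && ?X)"
    by (rule ent_submodular[OF fin])
  have 5: "ent P (Y1 && ?X) \<le> ent P (Y1 && C && ?X)"
    by (rule ent_mono) auto
  have 6: "ent P (Y1 && C && Y2 && ?X) = ent P (Y1 && (C && ?X) && Y2)"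
    "ent P (C && Y2 && ?X) = ent P ((C && ?X) && Y2)"
    "ent P (X1 && C && X2) = ent P (C && ?X)"
    "ent P (X2 && C && X1) = ent P (C && ?X)"
    "ent P (X1 && X2 && C) = ent P (C && ?X)"
    "ent P (X2 && X1) = ent P ?X"
    "ent P (X1 && C) = ent P (C && X1)"
    "ent P (X2 && C) = ent P (C && X2)"
    by (rule ent_cong; auto)+
  show ?thesis
    using 1 2 3 4 5 6 unfolding cinf_def by linarith
qed

text \<open>Bounds \<open>H(X1|C X2)\<close>: the letters of \<open>X1\<close> are revealed from
  left to right, and then the earlier letters of \<open>X2\<close> are dropped from the condition,
  which can only increase the conditional entropy.\<close>

lemma single_letter_forward:
  assumes fin: "finite (set_pmf P)"
    and len: "\<And>w. w \<in> set_pmf P \<Longrightarrow> length (X1 w) = n"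
  shows "ent P (X1 && C && X2) - ent P (C && X2) \<le>
    (\<Sum>i<n. ent P (\<lambda>w. (X1 w ! i, (C w, take i (X1 w), drop (Suc i) (X2 w)), X2 w ! i))
         - ent P (\<lambda>w. ((C w, take i (X1 w), drop (Suc i) (X2 w)), X2 w ! i)))"
proof -
  define g where "g i = ent P (\<lambda>w. (take i (X1 w), C w, X2 w))" for i
  have "g n = ent P (X1 && C && X2)" unfolding g_def
    by (rule ent_cong) (auto simp: len)
  moreover have "g 0 = ent P (C && X2)" unfolding g_def
    by (rule ent_cong) auto
  ultimately have "ent P (X1 && C && X2) - ent P (C && X2) = (\<Sum>i<n. g (Suc i) - g i)"
    by (simp add: sum_lessThan_telescope)
  also have "\<dots> \<le> (\<Sum>i<n. ent P (\<lambda>w. (X1 w ! i, (C w, take i (X1 w), drop (Suc i) (X2 w)), X2 w ! i))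
         - ent P (\<lambda>w. ((C w, take i (X1 w), drop (Suc i) (X2 w)), X2 w ! i)))"
  proof (rule sum_mono)
    fix i assume "i \<in> {..<n}"
    then have i: "i < n" by simp
    let ?F = "\<lambda>w. ((C w, take i (X1 w), drop (Suc i) (X2 w)), X2 w ! i)"
    note iff = take_Suc_eq_iff[of i "X1 v" "X1 w" for v w]
    have "ent P (\<lambda>w. (X1 w ! i, X2 w, ?F w)) + ent P ?F \<le> ent P (\<lambda>w. (X1 w ! i, ?F w)) + ent P (X2 && ?F)"
      by (rule ent_submodular[OF fin])
    moreover have "ent P (\<lambda>w. (X1 w ! i, X2 w, ?F w)) = g (Suc i)"
      unfolding g_def by (rule ent_cong) (use i in \<open>auto simp: iff len\<close>)
    moreover have "ent P (X2 && ?F) = g i"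
      unfolding g_def by (rule ent_cong) auto
    ultimately show "g (Suc i) - g i \<le> ent P (\<lambda>w. (X1 w ! i, ?F w)) - ent P ?F" by simp
  qed
  finally show ?thesis .
qed

text \<open>Bounds \<open>H(X2|C X1)\<close>, now revealing the letters from right to left and
  dropping the later letters of \<open>X1\<close>. The opposite order leaves the same conditioning
  triple as in the forward expansion.\<close>

lemma single_letter_backward:
  assumes fin: "finite (set_pmf P)"
    and len: "\<And>w. w \<in> set_pmf P \<Longrightarrow> length (X2 w) = n"
  shows "ent P (X2 && C && X1) - ent P (C && X1) \<le>
    (\<Sum>i<n. ent P (\<lambda>w. (X2 w ! i, (C w, take i (X1 w), drop (Suc i) (X2 w)), X1 w ! i))
         - ent P (\<lambda>w. ((C w, take i (X1 w), drop (Suc i) (X2 w)), X1 w ! i)))"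
proof -
  define g where "g i = ent P (\<lambda>w. (drop i (X2 w), C w, X1 w))" for i
  have "g 0 = ent P (X2 && C && X1)" unfolding g_def
    by (rule ent_cong) auto
  moreover have "g n = ent P (C && X1)" unfolding g_def
    by (rule ent_cong) (auto simp: len)
  ultimately have "ent P (X2 && C && X1) - ent P (C && X1) = (\<Sum>i<n. g i - g (Suc i))"
    by (simp add: sum_lessThan_telescope')
  also have "\<dots> \<le> (\<Sum>i<n. ent P (\<lambda>w. (X2 w ! i, (C w, take i (X1 w), drop (Suc i) (X2 w)), X1 w ! i))
         - ent P (\<lambda>w. ((C w, take i (X1 w), drop (Suc i) (X2 w)), X1 w ! i)))"
  proof (rule sum_mono)
    fix i assume "i \<in> {..<n}"
    then have i: "i < n" by simp
    let ?F = "\<lambda>w. ((C w, take i (X1 w), drop (Suc i) (X2 w)), X1 w ! i)"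
    have iff: "drop i (X2 w) = X2 w ! i # drop (Suc i) (X2 w)" if "w \<in> set_pmf P" for w
      using i len[OF that] by (simp add: Cons_nth_drop_Suc)
    have "ent P (\<lambda>w. (X2 w ! i, X1 w, ?F w)) + ent P ?F \<le> ent P (\<lambda>w. (X2 w ! i, ?F w)) + ent P (X1 && ?F)"
      by (rule ent_submodular[OF fin])
    moreover have "ent P (\<lambda>w. (X2 w ! i, X1 w, ?F w)) = g i"
      unfolding g_def by (rule ent_cong) (auto simp: iff)
    moreover have "ent P (X1 && ?F) = g (Suc i)"
      unfolding g_def by (rule ent_cong) auto
    ultimately show "g i - g (Suc i) \<le> ent P (\<lambda>w. (X2 w ! i, ?F w)) - ent P ?F" by simp
  qed
  finally show ?thesis .
qed

section \<open>Blocks of independent letters\<close>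

lemma finite_set_replicate_pmf:
  assumes "finite (set_pmf p)"
  shows "finite (set_pmf (replicate_pmf n p))"
proof -
  have "set_pmf (replicate_pmf n p) \<subseteq> {xs. set xs \<subseteq> set_pmf p \<and> length xs = n}"
    by (auto simp: set_replicate_pmf)
  then show ?thesis
    by (rule finite_subset) (rule finite_lists_length_eq[OF assms])
qed

lemma replicate_pmf_Suc_pair:
  "replicate_pmf (Suc n) p = map_pmf (\<lambda>(x, xs). x # xs) (pair_pmf p (replicate_pmf n p))"
  by (simp add: map_pmf_def pair_pmf_def bind_assoc_pmf bind_return_pmf)

lemma pmf_replicate_pmf:
  "pmf (replicate_pmf n p) xs = (if length xs = n then prod_list (map (pmf p) xs) else 0)"
proof (induction n arbitrary: xs)
  case 0
  then show ?case by (auto simp: indicator_def)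
next
  case (Suc n)
  show ?case
  proof (cases xs)
    case Nil
    then have "xs \<notin> set_pmf (replicate_pmf (Suc n) p)" unfolding set_replicate_pmf by simp
    then show ?thesis using Nil by (simp only: set_pmf_iff) simp
  next
    case (Cons y ys)
    have inj: "inj (\<lambda>(x, xs). x # xs)" by (auto simp: inj_on_def)
    have "pmf (replicate_pmf (Suc n) p) xs = pmf (pair_pmf p (replicate_pmf n p)) (y, ys)"
      unfolding replicate_pmf_Suc_pair Cons using pmf_map_inj'[OF inj, of _ "(y, ys)"] by simp
    then show ?thesis by (simp add: pmf_pair Suc Cons)
  qed
qed

lemma map_replicate_pmf: "map_pmf (map g) (replicate_pmf n p) = replicate_pmf n (map_pmf g p)"
proof (induction n)
  case (Suc n)
  have "map_pmf (map g) (replicate_pmf (Suc n) p)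
      = map_pmf (\<lambda>(x, xs). x # xs) (map_pmf (\<lambda>(x, xs). (g x, map g xs)) (pair_pmf p (replicate_pmf n p)))"
    unfolding replicate_pmf_Suc_pair map_pmf_comp by (simp add: case_prod_unfold)
  also have "\<dots> = replicate_pmf (Suc n) (map_pmf g p)"
    unfolding map_pair Suc replicate_pmf_Suc_pair ..
  finally show ?case .
qed simp

lemma nth_replicate_pmf:
  assumes "i < n"
  shows "map_pmf (\<lambda>xs. xs ! i) (replicate_pmf n p) = p"
  using assms
proof (induction n arbitrary: i)
  case (Suc n)
  show ?case
  proof (cases i)
    case 0
    then show ?thesis unfolding replicate_pmf_Suc_pair map_pmf_comp
      by (simp add: case_prod_unfold map_fst_pair_pmf)
  next
    case (Suc j)
    have "map_pmf (\<lambda>xs. xs ! i) (replicate_pmf (Suc n) p) = map_pmf (\<lambda>xs. xs ! j) (map_pmf snd (pair_pmf p (replicate_pmf n p)))"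
      unfolding replicate_pmf_Suc_pair map_pmf_comp using Suc by (simp add: case_prod_unfold)
    also have "\<dots> = p" unfolding map_snd_pair_pmf using Suc.IH[of j] Suc.prems Suc by simp
    finally show ?thesis .
  qed
qed simp

lemma ent_pair_pmf:
  assumes "finite (set_pmf p)" "finite (set_pmf q)"
  shows "ent (pair_pmf p q) (\<lambda>w. w) = ent p (\<lambda>w. w) + ent q (\<lambda>w. w)"
proof -
  have "ent (pair_pmf p q) (\<lambda>w. w) = (\<Sum>x\<in>set_pmf p. \<Sum>y\<in>set_pmf q. pmf p x * pmf q y * - log 2 (pmf p x * pmf q y))"
    unfolding ent_def pr_id set_pair_pmf sum.cartesian_product by (intro sum.cong) (auto simp: pmf_pair)
  also have "\<dots> = (\<Sum>x\<in>set_pmf p. \<Sum>y\<in>set_pmf q. pmf q y * (pmf p x * - log 2 (pmf p x)) + pmf p x * (pmf q y * - log 2 (pmf q y)))"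
  proof (intro sum.cong refl)
    fix x y assume "x \<in> set_pmf p" "y \<in> set_pmf q"
    then have "pmf p x > 0" "pmf q y > 0" by (auto simp: pmf_positive)
    then show "pmf p x * pmf q y * - log 2 (pmf p x * pmf q y) = pmf q y * (pmf p x * - log 2 (pmf p x)) + pmf p x * (pmf q y * - log 2 (pmf q y))"
      by (simp add: log_mult algebra_simps)
  qed
  also have "\<dots> = (\<Sum>y\<in>set_pmf q. pmf q y) * ent p (\<lambda>w. w) + (\<Sum>x\<in>set_pmf p. pmf p x) * ent q (\<lambda>w. w)"
    unfolding ent_def pr_id
    by (simp only: sum.distrib sum_distrib_left[symmetric] sum_distrib_right[symmetric])
  also have "\<dots> = ent p (\<lambda>w. w) + ent q (\<lambda>w. w)"
    using assms by (simp add: sum_pmf_eq_1)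
  finally show ?thesis .
qed

lemma ent_replicate_pmf:
  assumes fin: "finite (set_pmf p)"
  shows "ent (replicate_pmf n p) (map g) = real n * ent p g"
proof -
  define p' where "p' = map_pmf g p"
  have fin': "finite (set_pmf p')" using fin by (simp add: p'_def)
  have "ent (replicate_pmf n p') (\<lambda>w. w) = real n * ent p' (\<lambda>w. w)"
  proof (induction n)
    case 0
    then show ?case by (simp add: ent_def pr_def)
  next
    case (Suc n)
    have "ent (replicate_pmf (Suc n) p') (\<lambda>w. w) = ent (pair_pmf p' (replicate_pmf n p')) (\<lambda>w. w)"
      unfolding replicate_pmf_Suc_pair
      by (subst ent_map) (auto simp: fin' finite_set_replicate_pmf[OF fin'] intro!: ent_cong)
    then show ?case
      by (simp add: ent_pair_pmf fin' finite_set_replicate_pmf[OF fin'] Suc algebra_simps del: replicate_pmf.simps)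
  qed
  moreover have "ent (replicate_pmf n p') (\<lambda>w. w) = ent (replicate_pmf n p) (map g)"
    unfolding p'_def map_replicate_pmf[symmetric] by (rule ent_map) (rule finite_set_replicate_pmf[OF fin])
  moreover have "ent p' (\<lambda>w. w) = ent p g"
    unfolding p'_def by (rule ent_map[OF fin])
  ultimately show ?thesis by simp
qed

section \<open>An explicit continuity bound for entropy\<close>

lemma xlnx_increment_le:
  fixes s t :: real
  assumes "0 \<le> s" "s \<le> t" "t \<le> 1"
  shows "t * ln t - s * ln s \<le> t - s"
proof (cases "s = 0")
  case True
  have "t * ln t \<le> 0"
  proof (cases "t = 0")
    case False
    then show ?thesis using assms by (intro mult_nonneg_nonpos) (auto simp: ln_le_zero_iff)
  qed simp
  then show ?thesis unfolding True using assms by linarith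
next
  case False
  then have s: "s > 0" "t > 0" using assms by simp_all
  have "t * ln t - s * ln s = s * ln (t / s) + (t - s) * ln t"
    using s by (simp add: ln_div algebra_simps)
  also have "s * ln (t / s) \<le> s * (t / s - 1)"
    using s by (intro mult_left_mono ln_le_minus_one) auto
  also have "s * (t / s - 1) = t - s" using s by (simp add: field_simps)
  also have "(t - s) * ln t \<le> 0" using s assms by (intro mult_nonneg_nonpos) (auto simp: ln_le_zero_iff)
  finally show ?thesis by simp
qed

lemma abs_xlnx_le_sqrt:
  fixes x :: real
  assumes "0 \<le> x" "x \<le> 1"
  shows "\<bar>x * ln x\<bar> \<le> 2 * sqrt x"
proof (cases "x = 0")
  case False
  then have x: "x > 0" using assms by simp
  have "- ln x = 2 * ln (1 / sqrt x)" using x by (simp add: ln_div ln_sqrt)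
  also have "\<dots> \<le> 2 * (1 / sqrt x - 1)" using x by (intro mult_left_mono ln_le_minus_one) auto
  also have "\<dots> \<le> 2 / sqrt x" by simp
  finally have "x * - ln x \<le> x * (2 / sqrt x)" using x by (intro mult_left_mono) auto
  also have "\<dots> = 2 * sqrt x" using x by (simp add: field_simps)
  finally have "- (x * ln x) \<le> 2 * sqrt x" by simp
  moreover have "x * ln x \<le> 0" using x assms by (intro mult_nonneg_nonpos) (auto simp: ln_le_zero_iff)
  ultimately show ?thesis by simp
qed simp

text \<open>The modulus of continuity of \<open>x ln x\<close> with its logarithmic part made
  linear; the price is the additive error \<open>1 / K\<close>, where \<open>K\<close> is
  free.\<close>

lemma xlnx_diff_le:
  fixes s t K :: real
  assumes "0 \<le> s" "s \<le> t" "t \<le> 1" "K \<ge> 1"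
  shows "\<bar>t * ln t - s * ln s\<bar> \<le> (t - s) + (t - s) * ln K + 1 / K"
proof (cases "s = t")
  case True
  then show ?thesis using assms by simp
next
  case False
  then have st: "s < t" "t > 0" using assms by auto
  have lnK: "(t - s) * ln K \<ge> 0" using assms st by simp
  have a: "t * ln t - s * ln s \<le> t - s"
    by (rule xlnx_increment_le[OF assms(1-3)])
  have "- (t * ln t - s * ln s) \<le> - ((t - s) * ln t)"
  proof (cases "s = 0")
    case False
    then have s: "s > 0" using assms by simp
    have "s * ln s \<le> s * ln t" using s st by (intro mult_left_mono) auto
    then show ?thesis by (simp add: algebra_simps)
  qed simp
  also have "\<dots> \<le> (t - s) * - ln (t - s)"
    using st assms by simp
  \<comment> \<open>Scaling by \<open>K\<close> before using \<open>ln x <= x - 1\<close> trades the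
    unbounded slope at 0 for the error \<open>1 / K\<close>.\<close>
  also have "- ln (t - s) = ln (1 / ((t - s) * K)) + ln K"
    using st assms by (simp add: ln_div ln_mult)
  also have "(t - s) * (ln (1 / ((t - s) * K)) + ln K) \<le> (t - s) * ((1 / ((t - s) * K) - 1) + ln K)"
    using st assms by (intro mult_left_mono add_right_mono ln_le_minus_one) auto
  also have "\<dots> = 1 / K - (t - s) + (t - s) * ln K"
    using st assms by (simp add: field_simps)
  finally have b: "- (t * ln t - s * ln s) \<le> 1 / K - (t - s) + (t - s) * ln K" .
  have "1 / K \<ge> 0" using assms by simp
  with a b lnK st show ?thesis unfolding abs_le_iff by (smt (verit))
qed

text \<open>Taking \<open>K\<close> as the number of outcomes makes the errors \<open>1 / K\<close>
  add up to at most 1. This constant is harmless: for blocks the bound is divided by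
  \<open>n\<close> in the end, and the logarithm of the number of blocks is linear in
  \<open>n\<close>.\<close>

lemma ent_continuity_bound:
  assumes Z: "finite Z" "set_pmf P \<subseteq> Z" "set_pmf Q \<subseteq> Z"
    and d: "(\<Sum>z\<in>Z. \<bar>pmf P z - pmf Q z\<bar>) \<le> d"
  shows "\<bar>ent P X - ent Q X\<bar> \<le> (1 + d + d * ln (real (card Z))) / ln 2"
proof -
  have finP: "finite (set_pmf P)" and finQ: "finite (set_pmf Q)" using Z finite_subset by auto
  let ?V = "X ` Z" and ?K = "real (card Z)"
  have "Z \<noteq> {}" using Z(2) set_pmf_not_empty[of P] by auto
  then have K: "?K \<ge> 1" using Z(1) by (simp add: Suc_le_eq card_gt_0_iff)
  note prZ = pr_finite_superset[OF Z(1)]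
  define \<delta> where "\<delta> v = \<bar>pr P X v - pr Q X v\<bar>" for v
  have "(\<Sum>v\<in>?V. \<delta> v) \<le> (\<Sum>v\<in>?V. \<Sum>z\<in>{z\<in>Z. X z = v}. \<bar>pmf P z - pmf Q z\<bar>)"
    unfolding \<delta>_def prZ[OF Z(2)] prZ[OF Z(3)] sum_subtractf[symmetric] by (intro sum_mono sum_abs)
  also have "\<dots> = (\<Sum>z\<in>Z. \<bar>pmf P z - pmf Q z\<bar>)"
    by (rule sum.image_gen[symmetric, OF Z(1)])
  finally have \<delta>d: "(\<Sum>v\<in>?V. \<delta> v) \<le> d" using d by simp
  have pt: "\<bar>pr P X v * ln (pr P X v) - pr Q X v * ln (pr Q X v)\<bar> \<le> \<delta> v + \<delta> v * ln ?K + 1 / ?K" for v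
  proof (cases "pr Q X v \<le> pr P X v")
    case True
    then show ?thesis using xlnx_diff_le[of "pr Q X v" "pr P X v" ?K] K by (simp add: \<delta>_def)
  next
    case False
    then show ?thesis using xlnx_diff_le[of "pr P X v" "pr Q X v" ?K] K by (simp add: \<delta>_def abs_minus_commute)
  qed
  have "ent P X = (\<Sum>v\<in>?V. - (pr P X v * log 2 (pr P X v)))"
    by (rule ent_alt) (use Z finP in auto)
  moreover have "ent Q X = (\<Sum>v\<in>?V. - (pr Q X v * log 2 (pr Q X v)))"
    by (rule ent_alt) (use Z finQ in auto)
  ultimately have "ent P X - ent Q X = - ((\<Sum>v\<in>?V. pr P X v * ln (pr P X v) - pr Q X v * ln (pr Q X v)) / ln 2)"
    by (simp add: sum_negf sum_subtractf log_def sum_divide_distrib diff_divide_distrib)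
  then have "\<bar>ent P X - ent Q X\<bar> = \<bar>\<Sum>v\<in>?V. pr P X v * ln (pr P X v) - pr Q X v * ln (pr Q X v)\<bar> / ln 2"
    by (simp add: abs_divide)
  also have "\<bar>\<Sum>v\<in>?V. pr P X v * ln (pr P X v) - pr Q X v * ln (pr Q X v)\<bar> \<le> (\<Sum>v\<in>?V. \<delta> v + \<delta> v * ln ?K + 1 / ?K)"
    by (rule order_trans[OF sum_abs sum_mono[OF pt]])
  also have "\<dots> = (\<Sum>v\<in>?V. \<delta> v) + (\<Sum>v\<in>?V. \<delta> v) * ln ?K + real (card ?V) / ?K"
    by (simp add: sum.distrib sum_distrib_right)
  also have "\<dots> \<le> d + d * ln ?K + 1"
    using \<delta>d K card_image_le[OF Z(1), of X] by (intro add_mono mult_right_mono) (auto simp: divide_le_eq_1)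
  finally show ?thesis by (simp add: divide_right_mono algebra_simps)
qed

section \<open>Product form and Markov chains\<close>

text \<open>\<open>A\<close> is produced by the first node and \<open>C\<close> by the second one, from the common history \<open>G\<close>.\<close>

definition factors :: "'o pmf \<Rightarrow> ('o \<Rightarrow> 'a) \<Rightarrow> ('o \<Rightarrow> 'g) \<Rightarrow> ('o \<Rightarrow> 'c) \<Rightarrow> ('o \<Rightarrow> 'x) \<Rightarrow> ('o \<Rightarrow> 'y)
    \<Rightarrow> ('x \<Rightarrow> 'y \<Rightarrow> real) \<Rightarrow> ('a \<Rightarrow> 'g \<Rightarrow> 'x \<Rightarrow> real) \<Rightarrow> ('g \<Rightarrow> 'y \<Rightarrow> 'c \<Rightarrow> real) \<Rightarrow> bool" where
  "factors p A G C X Y W \<alpha> \<beta> \<longleftrightarrow> (\<forall>a g c x y.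
     pr p (A && G && C && X && Y) (a, g, c, x, y) = W x y * \<alpha> a g x * \<beta> g y c)"

text \<open>With \<open>X\<close> in the condition, the source weight \<open>W x y\<close> can be
  absorbed by the factor of the second node. Conditioning on \<open>Y\<close> allows the symmetric
  choice, and conditioning on both blocks either one.\<close>

lemma factors_markov_left:
  assumes fin: "finite (set_pmf p)" and f: "factors p A G C X Y W \<alpha> \<beta>"
  shows "markov_chain p A (G && X) (Y && C)"
proof (rule markov_chain_factor[OF fin])
  fix a b c
  have "pr p (A && (G && X) && Y && C) (a, b, c)
      = pr p (A && G && C && X && Y) (a, fst b, snd c, snd b, fst c)"
    by (rule pr_cong_support) (cases b; cases c; auto)
  then show "pr p (A && (G && X) && Y && C) (a, b, c)
      = (\<lambda>a b. \<alpha> a (fst b) (snd b)) a b * (\<lambda>b c. W (snd b) (fst c) * \<beta> (fst b) (fst c) (snd c)) b c"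
    using f by (simp add: factors_def)
qed

lemma factors_markov_right:
  assumes fin: "finite (set_pmf p)" and f: "factors p A G C X Y W \<alpha> \<beta>"
  shows "markov_chain p C (G && Y) (X && A)"
proof (rule markov_chain_factor[OF fin])
  fix a b c
  have "pr p (C && (G && Y) && X && A) (a, b, c)
      = pr p (A && G && C && X && Y) (snd c, fst b, a, fst c, snd b)"
    by (rule pr_cong_support) (cases b; cases c; auto)
  then show "pr p (C && (G && Y) && X && A) (a, b, c)
      = (\<lambda>a b. \<beta> (fst b) (snd b) a) a b * (\<lambda>b c. W (fst c) (snd b) * \<alpha> (snd c) (fst b) (fst c)) b c"
    using f by (simp add: factors_def)
qed

lemma factors_markov_both:
  assumes fin: "finite (set_pmf p)" and f: "factors p A G C X Y W \<alpha> \<beta>"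
  shows "markov_chain p A (G && X && Y) C"
proof (rule markov_chain_factor[OF fin])
  fix a b c
  have "pr p (A && (G && X && Y) && C) (a, b, c)
      = pr p (A && G && C && X && Y) (a, fst b, c, fst (snd b), snd (snd b))"
    by (rule pr_cong_support) (cases b; auto)
  then show "pr p (A && (G && X && Y) && C) (a, b, c)
      = (\<lambda>a b. W (fst (snd b)) (snd (snd b)) * \<alpha> a (fst b) (fst (snd b))) a b * (\<lambda>b c. \<beta> (fst b) (snd (snd b)) c) b c"
    using f[unfolded factors_def, rule_format, of a "fst b" c "fst (snd b)" "snd (snd b)"] by simp
qed

lemma split_at_iff:
  assumes "i < length z" "length u = i"
  shows "take i z = u \<and> z ! i = b \<and> drop (Suc i) z = s \<longleftrightarrow> z = u @ b # s"
proof
  assume "take i z = u \<and> z ! i = b \<and> drop (Suc i) z = s"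
  then show "z = u @ b # s" using id_take_nth_drop[OF assms(1)] by argo
next
  assume "z = u @ b # s"
  then show "take i z = u \<and> z ! i = b \<and> drop (Suc i) z = s" using assms(2) by auto
qed

text \<open>For \<open>W\<close> the mass function of a source pair this is the joint mass function
  of the two blocks. The guard on lengths is needed because \<open>zip\<close> truncates
  silently.\<close>

definition block_weight :: "nat \<Rightarrow> ('x \<times> 'y \<Rightarrow> real) \<Rightarrow> 'x list \<Rightarrow> 'y list \<Rightarrow> real" where
  "block_weight n W x y = (if length x = n \<and> length y = n then prod_list (map W (zip x y)) else 0)"

text \<open>The tail \<open>s\<close> of the first block is summed out against the known tail
  \<open>v\<close> of the second one. In \<open>letter_right\<close> the head \<open>t\<close> of
  the second block is summed out against the known head \<open>u\<close> of the first. The length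
  guard sits in the left factor only, which makes the product vanish.\<close>

definition letter_left where
  "letter_left n i W \<alpha> a = (\<lambda>(g, u, v) x. if length u = i \<and> length v = n - Suc i
     then \<Sum>s | length s = n - Suc i. prod_list (map W (zip s v)) * \<alpha> a g (u @ x # s) else (0::real))"

definition letter_right where
  "letter_right i W \<beta> = (\<lambda>(g, u, v) y c. \<Sum>t | length t = i. prod_list (map W (zip u t)) * \<beta> g (t @ y # v) c :: real)"

text \<open>Given the messages, the past of the first source and the future of the second one, the
  remaining letters of the two blocks are independent; hence the product form passes to a
  single letter.\<close>

lemma factors_single_letter:
  fixes X :: "'o \<Rightarrow> 'x::finite list" and Y :: "'o \<Rightarrow> 'y::finite list" and G :: "'o \<Rightarrow> 'g"
  assumes fin: "finite (set_pmf p)" and i: "i < n"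
    and lenX: "\<And>w. w \<in> set_pmf p \<Longrightarrow> length (X w) = n"
    and lenY: "\<And>w. w \<in> set_pmf p \<Longrightarrow> length (Y w) = n"
    and f: "factors p A G C X Y (block_weight n W) \<alpha> \<beta>"
  shows "factors p A (\<lambda>w. (G w, take i (X w), drop (Suc i) (Y w))) C (\<lambda>w. X w ! i) (\<lambda>w. Y w ! i)
    (\<lambda>x y. W (x, y)) (letter_left n i W \<alpha>) (letter_right i W \<beta>)"
  unfolding factors_def
proof (intro allI)
  fix a and gg :: "'g \<times> 'x list \<times> 'y list" and c x y
  obtain g u v where gg: "gg = (g, u, v)" by (cases gg) auto
  let ?E = "\<lambda>w. (A w, (G w, take i (X w), drop (Suc i) (Y w)), C w, X w ! i, Y w ! i)"
  show "pr p ?E (a, gg, c, x, y) = W (x, y) * letter_left n i W \<alpha> a gg x * letter_right i W \<beta> gg y c"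
  proof (cases "length u = i \<and> length v = n - Suc i")
    case False
    \<comment> \<open>Past and future of wrong length never occur, in agreement with the guard in
      \<open>letter_left\<close>.\<close>
    have "(a, gg, c, x, y) \<notin> ?E ` set_pmf p"
      using False i by (auto simp: gg lenX lenY)
    then have "pr p ?E (a, gg, c, x, y) = 0" by (simp add: pr_eq_0_iff)
    then show ?thesis using False by (auto simp: gg letter_left_def)
  next
    case True
    let ?S = "{s :: 'x list. length s = n - Suc i}" and ?T = "{t :: 'y list. length t = i}"
    have finS: "finite ?S" "finite ?T"
      using finite_lists_length_eq[of "UNIV :: 'x set"] finite_lists_length_eq[of "UNIV :: 'y set"] by auto
    have Xiff: "take i z = u \<and> z ! i = b \<and> drop (Suc i) z = s \<longleftrightarrow> z = u @ b # s"
      if "length z = n" for z :: "'x list" and b s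
      by (rule split_at_iff) (use that i True in simp_all)
    have Yiff: "take i z = t \<and> z ! i = b \<and> drop (Suc i) z = v \<longleftrightarrow> z = t @ b # v"
      if "length z = n" "length t = i" for z :: "'y list" and b t
      by (rule split_at_iff) (use that i in simp_all)
    have "pr p ?E (a, gg, c, x, y) = (\<Sum>st\<in>?S \<times> ?T.
        pr p (\<lambda>w. (?E w, (drop (Suc i) (X w), take i (Y w)))) ((a, gg, c, x, y), st))"
      by (rule pr_marginal) (use fin finS i in \<open>auto simp: lenX lenY\<close>)
    also have "\<dots> = (\<Sum>(s, t)\<in>?S \<times> ?T. pr p (A && G && C && X && Y) (a, g, c, u @ x # s, t @ y # v))"
    proof (rule sum.cong[OF refl])
      fix st assume "st \<in> ?S \<times> ?T"
      then obtain s t where st_eq: "st = (s, t)" and st: "length s = n - Suc i" "i = length t" by auto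
      have "pr p (\<lambda>w. (?E w, (drop (Suc i) (X w), take i (Y w)))) ((a, gg, c, x, y), (s, t))
          = pr p (A && G && C && X && Y) (a, g, c, u @ x # s, t @ y # v)"
      proof (rule pr_cong_support)
        fix w assume w: "w \<in> set_pmf p"
        show "(?E w, (drop (Suc i) (X w), take i (Y w))) = ((a, gg, c, x, y), (s, t))
          \<longleftrightarrow> (A w, G w, C w, X w, Y w) = (a, g, c, u @ x # s, t @ y # v)"
          unfolding gg prod.inject Xiff[OF lenX[OF w], symmetric] Yiff[OF lenY[OF w] st(2)[symmetric], symmetric]
          by blast
      qed
      then show "pr p (\<lambda>w. (?E w, (drop (Suc i) (X w), take i (Y w)))) ((a, gg, c, x, y), st)
          = (case st of (s, t) \<Rightarrow> pr p (A && G && C && X && Y) (a, g, c, u @ x # s, t @ y # v))"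
        by (simp add: st_eq)
    qed
    also have "\<dots> = (\<Sum>(s, t)\<in>?S \<times> ?T. W (x, y) * ((prod_list (map W (zip s v)) * \<alpha> a g (u @ x # s))
        * (prod_list (map W (zip u t)) * \<beta> g (t @ y # v) c)))"
    proof (rule sum.cong[OF refl])
      fix st assume "st \<in> ?S \<times> ?T"
      then obtain s t where st_eq: "st = (s, t)" and st: "length s = n - Suc i" "i = length t" by auto
      \<comment> \<open>Cut at position \<open>i\<close>, the weight pairs \<open>t\<close> with
        \<open>u\<close> and \<open>s\<close> with \<open>v\<close> only. Thus \<open>s\<close>
        meets just the first node's factor and \<open>t\<close> just the second node's, and the
        double sum splits.\<close>
      have "block_weight n W (u @ x # s) (t @ y # v) = prod_list (map W (zip u t)) * W (x, y) * prod_list (map W (zip s v))"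
        using st True i by (simp add: block_weight_def)
      then show "(case st of (s, t) \<Rightarrow> pr p (A && G && C && X && Y) (a, g, c, u @ x # s, t @ y # v))
        = (case st of (s, t) \<Rightarrow> W (x, y) * ((prod_list (map W (zip s v)) * \<alpha> a g (u @ x # s))
        * (prod_list (map W (zip u t)) * \<beta> g (t @ y # v) c)))"
        using f by (simp add: factors_def st_eq)
    qed
    also have "\<dots> = W (x, y) * ((\<Sum>s\<in>?S. prod_list (map W (zip s v)) * \<alpha> a g (u @ x # s))
        * (\<Sum>t\<in>?T. prod_list (map W (zip u t)) * \<beta> g (t @ y # v) c))"
      unfolding sum.cartesian_product[symmetric] sum_product by (simp only: sum_distrib_left)
    also have "\<dots> = W (x, y) * letter_left n i W \<alpha> a gg x * letter_right i W \<beta> gg y c"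
      using True by (simp add: gg letter_left_def letter_right_def)
    finally show ?thesis .
  qed
qed

section \<open>The interactive structure of a single letter\<close>

abbreviation "rvF \<equiv> \<lambda>(f, x1, x2, y1, y2). f"
abbreviation "rvX1 \<equiv> \<lambda>(f, x1, x2, y1, y2). x1"
abbreviation "rvX2 \<equiv> \<lambda>(f, x1, x2, y1, y2). x2"
abbreviation "rvY1 \<equiv> \<lambda>(f, x1, x2, y1, y2). y1"
abbreviation "rvY2 \<equiv> \<lambda>(f, x1, x2, y1, y2). y2"
abbreviation "rvFX1 \<equiv> \<lambda>(f, x1, x2, y1, y2). (f, x1)"
abbreviation "rvFX2 \<equiv> \<lambda>(f, x1, x2, y1, y2). (f, x2)"
abbreviation "rvXY2 \<equiv> \<lambda>(f, x1, x2, y1, y2). (x2, y2)"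
abbreviation "rvXY1 \<equiv> \<lambda>(f, x1, x2, y1, y2). (x1, y1)"
abbreviation "rvX12 \<equiv> \<lambda>(f, x1, x2, y1, y2). (x1, x2)"
abbreviation "rvMsg i \<equiv> \<lambda>(f, x1, x2, y1, y2). f ! i"
abbreviation "rvHist1 i \<equiv> \<lambda>(f, x1, x2, y1, y2). (take i f, x1)"
abbreviation "rvHist2 i \<equiv> \<lambda>(f, x1, x2, y1, y2). (take i f, x2)"

text \<open>The constraints of \<open>T2\<close> without the marginal and the alphabet sizes, which
  are only reached by approximation and by reduction, respectively.\<close>

definition interactive :: "nat \<Rightarrow> (nat list \<times> 'x1 \<times> 'x2 \<times> 'y1 \<times> 'y2) pmf \<Rightarrow> bool" where
  "interactive r p \<longleftrightarrow> (\<forall>w\<in>set_pmf p. length (fst w) = r) \<and>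
     (\<forall>i<r. even i \<longrightarrow> markov_chain p (rvMsg i) (rvHist1 i) rvX2) \<and>
     (\<forall>i<r. odd i \<longrightarrow> markov_chain p (rvMsg i) (rvHist2 i) rvX1) \<and>
     markov_chain p rvY1 rvFX1 rvXY2 \<and> markov_chain p rvY2 rvFX2 rvXY1"

text \<open>Every nonempty prefix of the encoded transcript reveals \<open>u\<close>, whereas the
  empty one reveals nothing. Round 0 is therefore the exceptional case below.\<close>

lemma take_encoded_eq_iff:
  assumes "length c = length c'" "c \<noteq> []" "inj \<phi>"
  shows "take k (\<phi> (c ! 0, u) # tl c) = take k (\<phi> (c' ! 0, u') # tl c') \<longleftrightarrow>
    k = 0 \<or> take k c = take k c' \<and> u = u'"
  using assms by (cases k; cases c; cases c') (auto dest: injD)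

text \<open>After round 0 the past and future letters belong to the history, and the chains are
  those of the single-letter product form. In round 0 they are part of the message itself; there
  \<open>msg0\<close> supplies a second factor equal to 1, expressing that nothing has yet been
  learnt about the second block.\<close>

lemma interactive_single_letter:
  fixes X1 :: "'o \<Rightarrow> 'x1::finite list" and X2 :: "'o \<Rightarrow> 'x2::finite list"
    and Y1 :: "'o \<Rightarrow> 'y1 list" and Y2 :: "'o \<Rightarrow> 'y2 list" and C :: "'o \<Rightarrow> nat list"
    and \<phi> :: "nat \<times> 'x1 list \<times> 'x2 list \<Rightarrow> nat"
  assumes fin: "finite (set_pmf P)" and i: "i < n" and r: "r \<ge> 1" and \<phi>: "inj \<phi>"
    and lenC: "\<And>w. w \<in> set_pmf P \<Longrightarrow> length (C w) = r"
    and lenX1: "\<And>w. w \<in> set_pmf P \<Longrightarrow> length (X1 w) = n"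
    and lenX2: "\<And>w. w \<in> set_pmf P \<Longrightarrow> length (X2 w) = n"
    and msg1: "\<And>k. k < r \<Longrightarrow> even k \<Longrightarrow>
      \<exists>\<alpha> \<beta>. factors P (\<lambda>w. C w ! k) (\<lambda>w. take k (C w)) (\<lambda>_. ()) X1 X2 (block_weight n W) \<alpha> \<beta>"
    and msg0: "factors P (\<lambda>w. C w ! 0) (\<lambda>w. take 0 (C w)) (\<lambda>_. ()) X1 X2 (block_weight n W) \<alpha>0 (\<lambda>_ _ _. 1)"
    and msg2: "\<And>k. k < r \<Longrightarrow> odd k \<Longrightarrow>
      \<exists>\<alpha> \<beta>. factors P (\<lambda>_. ()) (\<lambda>w. take k (C w)) (\<lambda>w. C w ! k) X1 X2 (block_weight n W) \<alpha> \<beta>"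
    and out: "\<exists>\<alpha> \<beta>. factors P (\<lambda>w. Y1 w ! i) C (\<lambda>w. Y2 w ! i) X1 X2 (block_weight n W) \<alpha> \<beta>"
  shows "interactive r (map_pmf (\<lambda>w. (\<phi> (C w ! 0, take i (X1 w), drop (Suc i) (X2 w)) # tl (C w),
      X1 w ! i, X2 w ! i, Y1 w ! i, Y2 w ! i)) P)"
proof -
  let ?u = "\<lambda>w. (take i (X1 w), drop (Suc i) (X2 w))"
  define F where "F w = \<phi> (C w ! 0, ?u w) # tl (C w)" for w
  have ne: "C w \<noteq> []" if "w \<in> set_pmf P" for w using lenC[OF that] r by auto
  have lenF: "length (F w) = r" if "w \<in> set_pmf P" for w
    using lenC[OF that] r by (simp add: F_def)
  have takeF: "take k (F v) = take k (F w) \<longleftrightarrow> k = 0 \<or> take k (C v) = take k (C w) \<and> ?u v = ?u w"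
    if "v \<in> set_pmf P" "w \<in> set_pmf P" for v w k
    unfolding F_def using that by (intro take_encoded_eq_iff \<phi>) (auto simp: lenC ne)
  have Feq: "F v = F w \<longleftrightarrow> C v = C w \<and> ?u v = ?u w" if "v \<in> set_pmf P" "w \<in> set_pmf P" for v w
    using takeF[OF that, of r] r that by (simp add: lenF lenC)
  have Fnth: "F w ! k = C w ! k" if "w \<in> set_pmf P" "k > 0" "k < r" for w k
    using that lenC[OF that(1)] ne[OF that(1)] by (cases "C w") (auto simp: F_def nth_Cons split: nat.splits)
  have "markov_chain P (\<lambda>w. F w ! k) (\<lambda>w. (take k (F w), X1 w ! i)) (\<lambda>w. X2 w ! i)"
    if k: "k < r" "even k" for k
  proof (cases "k = 0")
    case True
    \<comment> \<open>With second factor 1, \<open>letter_right\<close> reduces to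
      \<open>?\<beta>\<close>, a function of \<open>u\<close> alone. The second letter then occurs
      only in the source weight, which is free of the message.\<close>
    let ?\<alpha> = "letter_left n i W \<alpha>0" and ?\<beta> = "\<lambda>u. \<Sum>t | length t = i. prod_list (map W (zip u t))"
    have f: "factors P (\<lambda>w. C w ! 0) (\<lambda>w. (take 0 (C w), take i (X1 w), drop (Suc i) (X2 w))) (\<lambda>_. ())
        (\<lambda>w. X1 w ! i) (\<lambda>w. X2 w ! i) (\<lambda>x y. W (x, y)) ?\<alpha> (letter_right i W (\<lambda>_ _ _. 1))"
      by (rule factors_single_letter[OF fin i lenX1 lenX2 msg0])
    have "markov_chain P (\<lambda>w. (C w ! 0, ?u w)) (\<lambda>w. X1 w ! i) (\<lambda>w. X2 w ! i)"
    proof (rule markov_chain_factor[OF fin])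
      fix a :: "nat \<times> 'x1 list \<times> 'x2 list" and b c
      obtain a0 u v where a: "a = (a0, u, v)" by (cases a) auto
      have "pr P (\<lambda>w. ((C w ! 0, ?u w), X1 w ! i, X2 w ! i)) (a, b, c)
        = pr P (\<lambda>w. (C w ! 0, (take 0 (C w), take i (X1 w), drop (Suc i) (X2 w)), (), X1 w ! i, X2 w ! i))
            (a0, ([], u, v), (), b, c)"
        by (rule pr_cong_support) (auto simp: a)
      also have "\<dots> = W (b, c) * ?\<alpha> a0 ([], u, v) b * ?\<beta> u"
        using f by (simp add: factors_def letter_right_def)
      finally show "pr P (\<lambda>w. ((C w ! 0, ?u w), X1 w ! i, X2 w ! i)) (a, b, c)
        = (\<lambda>a b. ?\<alpha> (fst a) ([], snd a) b * ?\<beta> (fst (snd a))) a b * (\<lambda>b c. W (b, c)) b c"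
        by (simp add: a)
    qed
    also have "?this \<longleftrightarrow> markov_chain P (\<lambda>w. F w ! k) (\<lambda>w. (take k (F w), X1 w ! i)) (\<lambda>w. X2 w ! i)"
      unfolding True by (intro markov_chain_cong) (auto simp: F_def dest: injD[OF \<phi>])
    finally show ?thesis .
  next
    case False
    obtain \<alpha> \<beta> where "factors P (\<lambda>w. C w ! k) (\<lambda>w. take k (C w)) (\<lambda>_. ()) X1 X2 (block_weight n W) \<alpha> \<beta>"
      using msg1[OF k] by auto
    from factors_markov_left[OF fin factors_single_letter[OF fin i lenX1 lenX2 this]]
    have "markov_chain P (\<lambda>w. C w ! k) (\<lambda>w. ((take k (C w), ?u w), X1 w ! i)) (\<lambda>w. (X2 w ! i, ()))"
      by simp
    also have "?this \<longleftrightarrow> markov_chain P (\<lambda>w. F w ! k) (\<lambda>w. (take k (F w), X1 w ! i)) (\<lambda>w. X2 w ! i)"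
      using False k by (intro markov_chain_cong) (auto simp: takeF Fnth)
    finally show ?thesis .
  qed
  moreover have "markov_chain P (\<lambda>w. F w ! k) (\<lambda>w. (take k (F w), X2 w ! i)) (\<lambda>w. X1 w ! i)"
    if k: "k < r" "odd k" for k
  proof -
    have "k \<noteq> 0" using k by (auto intro: ccontr)
    obtain \<alpha> \<beta> where "factors P (\<lambda>_. ()) (\<lambda>w. take k (C w)) (\<lambda>w. C w ! k) X1 X2 (block_weight n W) \<alpha> \<beta>"
      using msg2[OF k] by auto
    from factors_markov_right[OF fin factors_single_letter[OF fin i lenX1 lenX2 this]]
    have "markov_chain P (\<lambda>w. C w ! k) (\<lambda>w. ((take k (C w), ?u w), X2 w ! i)) (\<lambda>w. (X1 w ! i, ()))"
      by simp
    also have "?this \<longleftrightarrow> markov_chain P (\<lambda>w. F w ! k) (\<lambda>w. (take k (F w), X2 w ! i)) (\<lambda>w. X1 w ! i)"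
      using \<open>k \<noteq> 0\<close> k by (intro markov_chain_cong) (auto simp: takeF Fnth)
    finally show ?thesis .
  qed
  moreover have "markov_chain P (\<lambda>w. Y1 w ! i) (\<lambda>w. (F w, X1 w ! i)) (\<lambda>w. (X2 w ! i, Y2 w ! i))
      \<and> markov_chain P (\<lambda>w. Y2 w ! i) (\<lambda>w. (F w, X2 w ! i)) (\<lambda>w. (X1 w ! i, Y1 w ! i))"
  proof
    obtain \<alpha> \<beta> where "factors P (\<lambda>w. Y1 w ! i) C (\<lambda>w. Y2 w ! i) X1 X2 (block_weight n W) \<alpha> \<beta>"
      using out by auto
    note f = factors_single_letter[OF fin i lenX1 lenX2 this]
    from factors_markov_left[OF fin f]
    have "markov_chain P (\<lambda>w. Y1 w ! i) (\<lambda>w. ((C w, ?u w), X1 w ! i)) (\<lambda>w. (X2 w ! i, Y2 w ! i))" by simp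
    also have "?this \<longleftrightarrow> markov_chain P (\<lambda>w. Y1 w ! i) (\<lambda>w. (F w, X1 w ! i)) (\<lambda>w. (X2 w ! i, Y2 w ! i))"
      by (intro markov_chain_cong) (auto simp: Feq)
    finally show "markov_chain P (\<lambda>w. Y1 w ! i) (\<lambda>w. (F w, X1 w ! i)) (\<lambda>w. (X2 w ! i, Y2 w ! i))" .
    from factors_markov_right[OF fin f]
    have "markov_chain P (\<lambda>w. Y2 w ! i) (\<lambda>w. ((C w, ?u w), X2 w ! i)) (\<lambda>w. (X1 w ! i, Y1 w ! i))" by simp
    also have "?this \<longleftrightarrow> markov_chain P (\<lambda>w. Y2 w ! i) (\<lambda>w. (F w, X2 w ! i)) (\<lambda>w. (X1 w ! i, Y1 w ! i))"
      by (intro markov_chain_cong) (auto simp: Feq)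
    finally show "markov_chain P (\<lambda>w. Y2 w ! i) (\<lambda>w. (F w, X2 w ! i)) (\<lambda>w. (X1 w ! i, Y1 w ! i))" .
  qed
  ultimately show ?thesis
    unfolding interactive_def markov_chain_map F_def[symmetric] by (auto simp: lenF)
qed

section \<open>Bounding the auxiliary alphabets\<close>

lemma exists_linear_dependency:
  fixes a :: "'i \<Rightarrow> 'j \<Rightarrow> real"
  assumes "finite I" "finite J" "card I < card J"
  shows "\<exists>v. (\<exists>j\<in>J. v j \<noteq> 0) \<and> (\<forall>i\<in>I. (\<Sum>j\<in>J. v j * a i j) = 0)"
  using assms
proof (induction I arbitrary: J a rule: finite_induct)
  case empty
  then have "J \<noteq> {}" by auto
  then show ?case by (intro exI[of _ "\<lambda>_. 1"]) auto
next
  case (insert i0 I)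
  show ?case
  proof (cases "\<forall>j\<in>J. a i0 j = 0")
    case True
    obtain v where "\<exists>j\<in>J. v j \<noteq> 0" "\<forall>i\<in>I. (\<Sum>j\<in>J. v j * a i j) = 0"
      using insert.IH[of J a] insert.prems insert.hyps by auto
    with True show ?thesis by (intro exI[of _ v]) auto
  next
    case False
    then obtain j0 where j0: "j0 \<in> J" "a i0 j0 \<noteq> 0" by auto
    let ?J = "J - {j0}"
    \<comment> \<open>Gaussian elimination: equation \<open>i0\<close> is solved for the unknown
      \<open>j0\<close> and substituted into the others. The value recovered for that unknown is
      \<open>c\<close>.\<close>
    let ?a = "\<lambda>i j. a i j - a i j0 * a i0 j / a i0 j0"
    have "card I < card ?J" using insert.prems insert.hyps j0 by simp
    then obtain v where v: "\<exists>j\<in>?J. v j \<noteq> 0" "\<And>i. i \<in> I \<Longrightarrow> (\<Sum>j\<in>?J. v j * ?a i j) = 0"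
      using insert.IH[of ?J ?a] insert.prems by auto
    define c where "c = - (\<Sum>j\<in>?J. v j * a i0 j) / a i0 j0"
    define v' where "v' j = (if j = j0 then c else v j)" for j
    have split: "(\<Sum>j\<in>J. v' j * a i j) = c * a i j0 + (\<Sum>j\<in>?J. v j * a i j)" for i
    proof -
      have "(\<Sum>j\<in>?J. v' j * a i j) = (\<Sum>j\<in>?J. v j * a i j)"
        by (rule sum.cong) (auto simp: v'_def)
      then show ?thesis using sum.remove[OF insert.prems(1) j0(1), of "\<lambda>j. v' j * a i j"] by (simp add: v'_def)
    qed
    have "(\<Sum>j\<in>J. v' j * a i j) = 0" if "i \<in> insert i0 I" for i
    proof (cases "i = i0")
      case True
      then show ?thesis unfolding split c_def using j0 by simp
    next
      case False
      then have "i \<in> I" using that by simp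
      have "0 = (\<Sum>j\<in>?J. v j * a i j - (a i j0 / a i0 j0) * (v j * a i0 j))"
        using v(2)[OF \<open>i \<in> I\<close>] by (simp add: algebra_simps)
      also have "\<dots> = (\<Sum>j\<in>?J. v j * a i j) - (a i j0 / a i0 j0) * (\<Sum>j\<in>?J. v j * a i0 j)"
        by (simp add: sum_subtractf sum_distrib_left)
      finally show ?thesis unfolding split c_def by (simp add: field_simps)
    qed
    moreover have "\<exists>j\<in>J. v' j \<noteq> 0" using v(1) by (auto simp: v'_def)
    ultimately show ?thesis by blast
  qed
qed

text \<open>The constant 1 is feasible. If a feasible solution of least support had more nonzero
  entries than there are equations, a linear dependency among those columns would give a direction
  along which one entry can be driven to 0 while the others stay nonnegative.\<close>

lemma exists_basic_solution:
  fixes a :: "'i \<Rightarrow> 'j \<Rightarrow> real"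
  assumes I: "finite I" and J: "finite J"
  shows "\<exists>w. (\<forall>j. w j \<ge> 0) \<and> card {j\<in>J. w j \<noteq> 0} \<le> card I \<and>
    (\<forall>i\<in>I. (\<Sum>j\<in>J. w j * a i j) = (\<Sum>j\<in>J. a i j))"
proof -
  define feas where "feas w \<longleftrightarrow> (\<forall>j. w j \<ge> 0) \<and> (\<forall>i\<in>I. (\<Sum>j\<in>J. w j * a i j) = (\<Sum>j\<in>J. a i j))" for w
  let ?supp = "\<lambda>w. {j\<in>J. w j \<noteq> (0::real)}"
  have "feas (\<lambda>_. 1)" by (simp add: feas_def)
  from ex_has_least_nat[of feas, OF this, of "\<lambda>w. card (?supp w)"]
  obtain w where feas: "feas w" and least: "\<And>w'. feas w' \<Longrightarrow> card (?supp w) \<le> card (?supp w')"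
    by blast
  have w: "\<And>j. w j \<ge> 0" "\<And>i. i \<in> I \<Longrightarrow> (\<Sum>j\<in>J. w j * a i j) = (\<Sum>j\<in>J. a i j)"
    using feas by (auto simp: feas_def)
  have "card (?supp w) \<le> card I"
  proof (rule ccontr)
    assume "\<not> ?thesis"
    then have less: "card I < card (?supp w)" by simp
    have finS: "finite (?supp w)" using J by simp
    obtain v0 where v0: "\<exists>j\<in>?supp w. v0 j \<noteq> 0" "\<forall>i\<in>I. (\<Sum>j\<in>?supp w. v0 j * a i j) = 0"
      using exists_linear_dependency[OF I finS less] by blast
    \<comment> \<open>The sign is chosen so that some entry decreases when \<open>v\<close> is
      subtracted; otherwise no entry would ever reach 0.\<close>
    obtain v where v: "\<exists>j\<in>?supp w. v j > 0" "\<forall>i\<in>I. (\<Sum>j\<in>?supp w. v j * a i j) = 0"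
    proof (cases "\<exists>j\<in>?supp w. v0 j > 0")
      case True
      then show ?thesis using v0 that by blast
    next
      case False
      then have "\<exists>j\<in>?supp w. - v0 j > 0" using v0(1) by force
      moreover have "\<forall>i\<in>I. (\<Sum>j\<in>?supp w. - v0 j * a i j) = 0" using v0(2) by (simp add: sum_negf)
      ultimately show ?thesis by (rule that)
    qed
    \<comment> \<open>The ratio test: the least ratio \<open>t\<close> is the first moment at which
      an entry of \<open>w - t v\<close> vanishes.\<close>
    define B where "B = (\<lambda>j. w j / v j) ` {j\<in>?supp w. v j > 0}"
    have finB: "finite B" and neB: "B \<noteq> {}" using J v(1) by (auto simp: B_def)
    define t where "t = Min B"
    have "t \<in> B" unfolding t_def using finB neB by (rule Min_in)
    then obtain j1 where j1: "j1 \<in> ?supp w" "v j1 > 0" "t = w j1 / v j1" by (auto simp: B_def)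
    have t0: "t \<ge> 0" using j1 w by simp
    define w' where "w' j = (if j \<in> ?supp w then w j - t * v j else 0)" for j
    have "w' j \<ge> 0" for j
    proof (cases "j \<in> ?supp w \<and> v j > 0")
      case True
      then have "t \<le> w j / v j" unfolding t_def using finB by (intro Min_le) (auto simp: B_def)
      then show ?thesis using True by (simp add: w'_def field_simps)
    next
      case False
      then show ?thesis using w t0 by (auto simp: w'_def mult_nonneg_nonpos intro: order_trans[of _ 0])
    qed
    moreover have "(\<Sum>j\<in>J. w' j * a i j) = (\<Sum>j\<in>J. a i j)" if "i \<in> I" for i
    proof -
      have "(\<Sum>j\<in>J. w' j * a i j) = (\<Sum>j\<in>?supp w. (w j - t * v j) * a i j)"
        by (rule sum.mono_neutral_cong_right) (use J in \<open>auto simp: w'_def\<close>)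
      also have "\<dots> = (\<Sum>j\<in>?supp w. w j * a i j) - t * (\<Sum>j\<in>?supp w. v j * a i j)"
        by (simp add: sum_subtractf sum_distrib_left algebra_simps)
      also have "(\<Sum>j\<in>?supp w. v j * a i j) = 0" using v(2) that by blast
      also have "(\<Sum>j\<in>?supp w. w j * a i j) = (\<Sum>j\<in>J. w j * a i j)"
        by (rule sum.mono_neutral_left) (use J in auto)
      finally show ?thesis using w that by simp
    qed
    ultimately have "card (?supp w) \<le> card (?supp w')" by (intro least) (simp add: feas_def)
    moreover have "?supp w' \<subseteq> ?supp w - {j1}" using j1 by (auto simp: w'_def)
    then have "card (?supp w') \<le> card (?supp w - {j1})" using finS by (intro card_mono) auto
    moreover have "card (?supp w - {j1}) < card (?supp w)" using finS j1(1) by (intro psubset_card_mono) auto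
    ultimately show False by simp
  qed
  with w show ?thesis by blast
qed

lemma exists_pmf_finite:
  assumes "finite S" "\<And>x. f x \<ge> 0" "\<And>x. x \<notin> S \<Longrightarrow> f x = 0" "sum f S = 1"
  shows "\<exists>p. \<forall>x. pmf p x = f x"
proof -
  have "(\<integral>\<^sup>+ x. ennreal (f x) \<partial>count_space UNIV) = (\<Sum>x\<in>S. ennreal (f x))"
    by (rule nn_integral_count_space') (use assms in auto)
  also have "\<dots> = ennreal (sum f S)" by (rule sum_ennreal) (use assms in auto)
  finally have "(\<integral>\<^sup>+ x. ennreal (f x) \<partial>count_space UNIV) = 1" using assms by simp
  then show ?thesis using pmf_embed_pmf[of f] assms(2) by blast
qed

section \<open>Reweighting one auxiliary letter\<close>

definition info1 :: "(nat list \<times> 'x1 \<times> 'x2 \<times> 'y1 \<times> 'y2) pmf \<Rightarrow> real" where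
  "info1 p = cinf p rvX1 rvF rvX2"

definition info2 :: "(nat list \<times> 'x1 \<times> 'x2 \<times> 'y1 \<times> 'y2) pmf \<Rightarrow> real" where
  "info2 p = cinf p rvX2 rvF rvX1"

text \<open>Later letters are forgotten along with letter \<open>i\<close>; under reweighting, their
  conditional law given everything up to and including letter \<open>i\<close> is carried
  along.\<close>

definition history :: "nat \<Rightarrow> nat list \<times> 'z \<Rightarrow> nat list \<times> 'z" where
  "history i w = (take i (fst w), snd w)"

lemma fst_history [simp]: "fst (history i w) = take i (fst w)"
  and snd_history [simp]: "snd (history i w) = snd w"
  by (simp_all add: history_def)

text \<open>The defining identity is homogeneous: if the scaling factor depends on the conditioning
  value only, both sides are multiplied by its square.\<close>

lemma markov_chain_scaled:
  assumes "\<And>b. \<exists>c. \<forall>a d. pr p' (A && B && D) (a, b, d) = c * pr p (A && B && D) (a, b, d)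
    \<and> pr p' B b = c * pr p B b \<and> pr p' (A && B) (a, b) = c * pr p (A && B) (a, b)
    \<and> pr p' (B && D) (b, d) = c * pr p (B && D) (b, d)"
    and "markov_chain p A B D"
  shows "markov_chain p' A B D"
  unfolding markov_chain_pr
proof (intro allI)
  fix a b d
  obtain c where c: "pr p' (A && B && D) (a, b, d) = c * pr p (A && B && D) (a, b, d)"
    "pr p' B b = c * pr p B b" "pr p' (A && B) (a, b) = c * pr p (A && B) (a, b)"
    "pr p' (B && D) (b, d) = c * pr p (B && D) (b, d)"
    using assms(1)[of b] by blast
  have "pr p (A && B && D) (a, b, d) * pr p B b
     = pr p (A && B) (a, b) * pr p (B && D) (b, d)"
    using assms(2) unfolding markov_chain_pr by blast
  then show "pr p' (A && B && D) (a, b, d) * pr p' B b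
     = pr p' (A && B) (a, b) * pr p' (B && D) (b, d)"
    unfolding c by (simp add: mult.assoc mult.left_commute)
qed

text \<open>Reweighting the letter in position \<open>i\<close> while preserving the joint law of all earlier
  letters and of the source and output letters preserves the interactive structure.\<close>

context
  fixes p p' :: "(nat list \<times> 'x1 \<times> 'x2 \<times> 'y1 \<times> 'y2) pmf" and i :: nat and wt :: "nat \<Rightarrow> real"
  assumes fin: "finite (set_pmf p)" and wt: "\<And>j. wt j \<ge> 0"
    and pmf': "\<And>w. pmf p' w = wt (fst w ! i) * pmf p w"
    and history': "map_pmf (history i) p' = map_pmf (history i) p"
begin

lemma reweight_support: "set_pmf p' \<subseteq> set_pmf p"
  using pmf' by (auto simp: set_pmf_iff)

lemma reweight_finite: "finite (set_pmf p')"
  using reweight_support fin finite_subset by blast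

lemma reweight_pr:
  assumes "\<And>w. X w = x \<Longrightarrow> fst w ! i = j"
  shows "pr p' X x = wt j * pr p X x"
proof -
  have "pr p' X x = (\<Sum>w\<in>{w\<in>set_pmf p'. X w = x}. pmf p' w)"
    by (rule pr_finite_support[OF reweight_finite])
  also have "\<dots> = (\<Sum>w\<in>{w\<in>set_pmf p. X w = x}. pmf p' w)"
    by (rule sum.mono_neutral_left) (use fin reweight_support in \<open>auto simp: pmf_eq_0_set_pmf\<close>)
  also have "\<dots> = (\<Sum>w\<in>{w\<in>set_pmf p. X w = x}. wt j * pmf p w)"
    by (rule sum.cong) (use assms in \<open>auto simp: pmf'\<close>)
  finally show ?thesis by (simp add: pr_finite_support[OF fin] sum_distrib_left)
qed

lemma reweight_pr_history:
  assumes "\<And>w. X (history i w) = X w"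
  shows "pr p' X x = pr p X x"
proof -
  have "pr p' X x = pr (map_pmf (history i) p') X x" by (simp add: pr_map assms)
  also have "\<dots> = pr p X x" unfolding history' by (simp add: pr_map assms)
  finally show ?thesis .
qed

lemma reweight_ent_history:
  assumes "\<And>w. X (history i w) = X w"
  shows "ent p' X = ent p X"
proof -
  have "ent p' X = ent (map_pmf (history i) p') X" by (simp add: ent_map reweight_finite assms)
  also have "\<dots> = ent p X" unfolding history' by (simp add: ent_map fin assms)
  finally show ?thesis .
qed

text \<open>Here the conditioning value determines letter \<open>i\<close>, so all four
  probabilities are scaled by the same weight. This covers later rounds and the outputs.\<close>

lemma reweight_markov_later:
  assumes "\<And>w b. B w = b \<Longrightarrow> fst w ! i = \<beta> b" and "markov_chain p A B D"
  shows "markov_chain p' A B D"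
proof (rule markov_chain_scaled[OF _ assms(2)])
  fix b
  show "\<exists>c. \<forall>a d. pr p' (A && B && D) (a, b, d) = c * pr p (A && B && D) (a, b, d)
    \<and> pr p' B b = c * pr p B b \<and> pr p' (A && B) (a, b) = c * pr p (A && B) (a, b)
    \<and> pr p' (B && D) (b, d) = c * pr p (B && D) (b, d)"
    by (intro exI[of _ "wt (\<beta> b)"] allI conjI; rule reweight_pr; use assms(1) in simp)
qed

lemma reweight_markov_earlier:
  assumes "\<And>w. A (history i w) = A w" "\<And>w. B (history i w) = B w" "\<And>w. D (history i w) = D w"
    and "markov_chain p A B D"
  shows "markov_chain p' A B D"
proof (rule markov_chain_scaled[OF _ assms(4)])
  fix b
  show "\<exists>c. \<forall>a d. pr p' (A && B && D) (a, b, d) = c * pr p (A && B && D) (a, b, d)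
    \<and> pr p' B b = c * pr p B b \<and> pr p' (A && B) (a, b) = c * pr p (A && B) (a, b)
    \<and> pr p' (B && D) (b, d) = c * pr p (B && D) (b, d)"
    by (intro exI[of _ 1] allI conjI; unfold mult_1; rule reweight_pr_history; use assms(1-3) in simp)
qed

text \<open>Only the two probabilities that involve letter \<open>i\<close> are scaled, one on each
  side and by the same weight; the others are functions of the preserved history.\<close>

lemma reweight_markov_current:
  assumes "\<And>w. B (history i w) = B w" "\<And>w. D (history i w) = D w"
    and mc: "markov_chain p (\<lambda>w. fst w ! i) B D"
  shows "markov_chain p' (\<lambda>w. fst w ! i) B D"
  unfolding markov_chain_pr
proof (intro allI)
  fix a b d
  let ?A = "\<lambda>w. fst w ! i"
  have 1: "pr p' (?A && B && D) (a, b, d) = wt a * pr p (?A && B && D) (a, b, d)"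
    by (rule reweight_pr) simp
  have 2: "pr p' (?A && B) (a, b) = wt a * pr p (?A && B) (a, b)"
    by (rule reweight_pr) simp
  have 3: "pr p' B b = pr p B b" "pr p' (B && D) (b, d) = pr p (B && D) (b, d)"
    by (rule reweight_pr_history; use assms in simp)+
  have "pr p (?A && B && D) (a, b, d) * pr p B b
     = pr p (?A && B) (a, b) * pr p (B && D) (b, d)"
    using mc unfolding markov_chain_pr by blast
  then show "pr p' (?A && B && D) (a, b, d) * pr p' B b
     = pr p' (?A && B) (a, b) * pr p' (B && D) (b, d)"
    unfolding 1 2 3 by (simp add: mult.assoc)
qed

lemma reweight_interactive:
  assumes p: "interactive r p" and i: "i < r"
  shows "interactive r p'"
proof -
  have msg: "markov_chain p' (\<lambda>w. fst w ! k) (\<lambda>w. (take k (fst w), X w)) Z"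
    if mc: "markov_chain p (\<lambda>w. fst w ! k) (\<lambda>w. (take k (fst w), X w)) Z"
      and XZ: "\<And>w. X (history i w) = X w" "\<And>w. Z (history i w) = Z w"
    for k and X :: "nat list \<times> 'x1 \<times> 'x2 \<times> 'y1 \<times> 'y2 \<Rightarrow> 'b" and Z :: "nat list \<times> 'x1 \<times> 'x2 \<times> 'y1 \<times> 'y2 \<Rightarrow> 'c"
  proof -
    consider "k < i" | "k = i" | "k > i" by linarith
    then show ?thesis
    proof cases
      case 1
      show ?thesis by (rule reweight_markov_earlier[OF _ _ _ mc]) (use 1 XZ in \<open>simp_all add: prefix_def\<close>)
    next
      case 2
      show ?thesis unfolding 2 by (rule reweight_markov_current) (use mc XZ 2 in \<open>simp_all add: prefix_def\<close>)
    next
      case 3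
      show ?thesis by (rule reweight_markov_later[OF _ mc, where \<beta> = "\<lambda>b. fst b ! i"]) (use 3 in auto)
    qed
  qed
  have "markov_chain p' (rvMsg k) (rvHist1 k) rvX2"
    if "k < r" "even k" for k
    using msg[of k "\<lambda>w. fst (snd w)" "\<lambda>w. fst (snd (snd w))"] p that by (simp add: interactive_def case_prod_unfold prefix_def)
  moreover have "markov_chain p' (rvMsg k) (rvHist2 k) rvX1"
    if "k < r" "odd k" for k
    using msg[of k "\<lambda>w. fst (snd (snd w))" "\<lambda>w. fst (snd w)"] p that by (simp add: interactive_def case_prod_unfold prefix_def)
  moreover have "markov_chain p' rvY1 rvFX1 rvXY2"
    by (rule reweight_markov_later[where \<beta> = "\<lambda>b. fst b ! i"]) (use p in \<open>auto simp: interactive_def\<close>)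
  moreover have "markov_chain p' rvY2 rvFX2 rvXY1"
    by (rule reweight_markov_later[where \<beta> = "\<lambda>b. fst b ! i"]) (use p in \<open>auto simp: interactive_def\<close>)
  moreover have "\<forall>w\<in>set_pmf p'. length (fst w) = r"
    using p reweight_support by (auto simp: interactive_def)
  ultimately show ?thesis unfolding interactive_def by blast
qed

text \<open>The information is affine in the weights. The entropies without the auxiliary list are
  fixed by the history, and in the remaining difference both probabilities inside the logarithms
  carry the same weight, which cancels. An equation on the informations thus becomes a linear
  equation on the weights.\<close>

lemma reweight_cinf:
  assumes "\<And>w. A (history i w) = A w" "\<And>w. D (history i w) = D w"
  shows "cinf p' A fst D = ent p (A && D) - ent p D + (\<Sum>w\<in>set_pmf p. wt (fst w ! i) *
    (pmf p w * (log 2 (pr p (A && fst && D) (A w, fst w, D w)) - log 2 (pr p (fst && D) (fst w, D w)))))"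
proof -
  let ?a = "\<lambda>w. (A w, fst w, D w)" and ?b = "\<lambda>w. (fst w, D w)"
  have "ent p' ?b - ent p' ?a = (\<Sum>w\<in>set_pmf p'. pmf p' w * (log 2 (pr p' ?a (?a w)) - log 2 (pr p' ?b (?b w))))"
    unfolding ent_def by (simp add: sum_subtractf[symmetric] algebra_simps)
  also have "\<dots> = (\<Sum>w\<in>set_pmf p'. pmf p' w * (log 2 (pr p ?a (?a w)) - log 2 (pr p ?b (?b w))))"
  proof (intro sum.cong refl)
    fix w assume w: "w \<in> set_pmf p'"
    then have wp: "w \<in> set_pmf p" using reweight_support by auto
    have "wt (fst w ! i) \<noteq> 0" using w by (auto simp: set_pmf_iff pmf')
    then have "wt (fst w ! i) > 0" using wt[of "fst w ! i"] by simp
    moreover have "pr p' ?a (?a w) = wt (fst w ! i) * pr p ?a (?a w)" "pr p' ?b (?b w) = wt (fst w ! i) * pr p ?b (?b w)"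
      by (rule reweight_pr; simp)+
    ultimately show "pmf p' w * (log 2 (pr p' ?a (?a w)) - log 2 (pr p' ?b (?b w))) = pmf p' w * (log 2 (pr p ?a (?a w)) - log 2 (pr p ?b (?b w)))"
      using pr_pos[OF wp, of ?a] pr_pos[OF wp, of ?b] by (simp add: log_mult)
  qed
  also have "\<dots> = (\<Sum>w\<in>set_pmf p. pmf p' w * (log 2 (pr p ?a (?a w)) - log 2 (pr p ?b (?b w))))"
    by (rule sum.mono_neutral_left) (use fin reweight_support in \<open>auto simp: pmf_eq_0_set_pmf\<close>)
  finally have "ent p' ?b - ent p' ?a = (\<Sum>w\<in>set_pmf p. wt (fst w ! i) * (pmf p w * (log 2 (pr p ?a (?a w)) - log 2 (pr p ?b (?b w)))))"
    by (simp add: pmf' mult.assoc)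
  moreover have "ent p' (A && D) = ent p (A && D)" "ent p' D = ent p D"
    by (rule reweight_ent_history; use assms in simp)+
  ultimately show ?thesis unfolding cinf_def by simp
qed

end

text \<open>The unknowns are weights for the values of letter \<open>i\<close>. There is one
  equation for each attained history, fixing its probability, and one for the functional with
  coefficients \<open>l1\<close> and \<open>l2\<close>; a basic solution keeps no more values than
  there are equations.\<close>

lemma reduce_coordinate:
  fixes p :: "(nat list \<times> 'x1 \<times> 'x2 \<times> 'y1 \<times> 'y2) pmf" and l1 l2 :: real
  assumes fin: "finite (set_pmf p)" and p: "interactive r p" and i: "i < r"
  shows "\<exists>p'. set_pmf p' \<subseteq> set_pmf p \<and> interactive r p' \<and> map_pmf snd p' = map_pmf snd p \<and>
    card ((\<lambda>w. fst w ! i) ` set_pmf p') \<le> card (history i ` set_pmf p) + 1 \<and>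
    l1 * info1 p' + l2 * info2 p' = l1 * info1 p + l2 * info2 p"
proof -
  let ?S = "set_pmf p" and ?c = "\<lambda>w :: nat list \<times> 'x1 \<times> 'x2 \<times> 'y1 \<times> 'y2. fst w ! i"
  let ?X1 = "\<lambda>w :: nat list \<times> 'x1 \<times> 'x2 \<times> 'y1 \<times> 'y2. fst (snd w)"
  let ?X2 = "\<lambda>w :: nat list \<times> 'x1 \<times> 'x2 \<times> 'y1 \<times> 'y2. fst (snd (snd w))"
  define e1 where "e1 w = pmf p w * (log 2 (pr p (?X1 && fst && ?X2) (?X1 w, fst w, ?X2 w))
    - log 2 (pr p (fst && ?X2) (fst w, ?X2 w)))" for w
  define e2 where "e2 w = pmf p w * (log 2 (pr p (?X2 && fst && ?X1) (?X2 w, fst w, ?X1 w))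
    - log 2 (pr p (fst && ?X1) (fst w, ?X1 w)))" for w
  have cinf_wt: "info1 p'' = ent p (?X1 && ?X2) - ent p ?X2 + (\<Sum>w\<in>?S. wt (?c w) * e1 w)"
    "info2 p'' = ent p (?X2 && ?X1) - ent p ?X1 + (\<Sum>w\<in>?S. wt (?c w) * e2 w)"
    if "\<And>j. wt j \<ge> 0" "\<And>w. pmf p'' w = wt (fst w ! i) * pmf p w" "map_pmf (history i) p'' = map_pmf (history i) p" for p'' wt
    unfolding info1_def info2_def e1_def e2_def
    using reweight_cinf[OF fin that(1,2,3), of ?X1 ?X2] reweight_cinf[OF fin that(1,2,3), of ?X2 ?X1]
    by (simp_all add: prefix_def case_prod_unfold)
  \<comment> \<open>Row \<open>None\<close> is the functional, row \<open>Some t\<close> the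
    probability of the history \<open>t\<close>.\<close>
  define a where "a k j = (case k of None \<Rightarrow> \<Sum>w\<in>{w\<in>?S. ?c w = j}. l1 * e1 w + l2 * e2 w
     | Some t \<Rightarrow> \<Sum>w\<in>{w\<in>{w\<in>?S. history i w = t}. ?c w = j}. pmf p w)" for k j
  define I where "I = insert None (Some ` history i ` ?S)"
  define J where "J = ?c ` ?S"
  have finI: "finite I" and finJ: "finite J" using fin by (auto simp: I_def J_def)
  obtain wt where wt: "\<And>j. wt j \<ge> 0" "card {j\<in>J. wt j \<noteq> 0} \<le> card I"
      "\<And>k. k \<in> I \<Longrightarrow> (\<Sum>j\<in>J. wt j * a k j) = (\<Sum>j\<in>J. a k j)"
    using exists_basic_solution[OF finI finJ, of a] by blast
  have row: "(\<Sum>w\<in>{w\<in>?S. history i w = t}. wt (?c w) * pmf p w) = (\<Sum>w\<in>{w\<in>?S. history i w = t}. pmf p w)" for t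
  proof (cases "t \<in> history i ` ?S")
    case True
    have "(\<Sum>w\<in>{w\<in>?S. history i w = t}. wt (?c w) * pmf p w)
      = (\<Sum>j\<in>J. \<Sum>w\<in>{w\<in>{w\<in>?S. history i w = t}. ?c w = j}. wt (?c w) * pmf p w)"
      by (rule sum.group[symmetric]) (use fin in \<open>auto simp: J_def\<close>)
    also have "\<dots> = (\<Sum>j\<in>J. wt j * a (Some t) j)"
      unfolding a_def by (auto simp: sum_distrib_left intro!: sum.cong)
    also have "\<dots> = (\<Sum>j\<in>J. a (Some t) j)"
      by (rule wt(3)) (use True in \<open>auto simp: I_def\<close>)
    also have "\<dots> = (\<Sum>w\<in>{w\<in>?S. history i w = t}. pmf p w)"
      unfolding a_def option.case by (rule sum.group) (use fin in \<open>auto simp: J_def\<close>)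
    finally show ?thesis .
  next
    case False
    then have "{w\<in>?S. history i w = t} = {}" by auto
    then show ?thesis by (simp only: sum.empty)
  qed
  have func: "(\<Sum>w\<in>?S. wt (?c w) * (l1 * e1 w + l2 * e2 w)) = (\<Sum>w\<in>?S. l1 * e1 w + l2 * e2 w)"
  proof -
    have "(\<Sum>w\<in>?S. wt (?c w) * (l1 * e1 w + l2 * e2 w))
      = (\<Sum>j\<in>J. \<Sum>w\<in>{w\<in>?S. ?c w = j}. wt (?c w) * (l1 * e1 w + l2 * e2 w))"
      by (rule sum.group[symmetric]) (use fin in \<open>auto simp: J_def\<close>)
    also have "\<dots> = (\<Sum>j\<in>J. wt j * a None j)"
      unfolding a_def by (auto simp: sum_distrib_left intro!: sum.cong)
    also have "\<dots> = (\<Sum>j\<in>J. a None j)"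
      by (rule wt(3)) (auto simp: I_def)
    also have "\<dots> = (\<Sum>w\<in>?S. l1 * e1 w + l2 * e2 w)"
      unfolding a_def option.case by (rule sum.group) (use fin in \<open>auto simp: J_def\<close>)
    finally show ?thesis .
  qed
  \<comment> \<open>Normalization costs no separate equation: it is the sum of the history
    rows.\<close>
  have "(\<Sum>w\<in>?S. wt (?c w) * pmf p w) = (\<Sum>t\<in>history i ` ?S. \<Sum>w\<in>{w\<in>?S. history i w = t}. wt (?c w) * pmf p w)"
    by (rule sum.image_gen[OF fin])
  also have "\<dots> = (\<Sum>t\<in>history i ` ?S. \<Sum>w\<in>{w\<in>?S. history i w = t}. pmf p w)"
    unfolding row ..
  also have "\<dots> = (\<Sum>w\<in>?S. pmf p w)"
    by (rule sum.image_gen[OF fin, symmetric])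
  also have "\<dots> = 1" using fin by (simp add: sum_pmf_eq_1)
  finally have "\<exists>p'. \<forall>w. pmf p' w = wt (?c w) * pmf p w"
    by (intro exists_pmf_finite[OF fin]) (use wt(1) in \<open>auto simp: set_pmf_iff\<close>)
  then obtain p' where p': "\<And>w. pmf p' w = wt (fst w ! i) * pmf p w" by blast
  have sub: "set_pmf p' \<subseteq> ?S" using p' by (auto simp: set_pmf_iff)
  have fin': "finite (set_pmf p')" using sub fin finite_subset by blast
  have pre: "map_pmf (history i) p' = map_pmf (history i) p"
  proof (rule pmf_eqI)
    fix t
    have "pmf (map_pmf (history i) p') t = pr p' (history i) t" by (simp add: pmf_map pr_def vimage_def)
    also have "\<dots> = (\<Sum>w\<in>{w\<in>set_pmf p'. history i w = t}. pmf p' w)" by (rule pr_finite_support[OF fin'])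
    also have "\<dots> = (\<Sum>w\<in>{w\<in>?S. history i w = t}. pmf p' w)"
      by (rule sum.mono_neutral_left) (use fin sub in \<open>auto simp: pmf_eq_0_set_pmf\<close>)
    also have "\<dots> = (\<Sum>w\<in>{w\<in>?S. history i w = t}. pmf p w)" unfolding p' row ..
    also have "\<dots> = pr p (history i) t" by (rule pr_finite_support[OF fin, symmetric])
    also have "\<dots> = pmf (map_pmf (history i) p) t" by (simp add: pmf_map pr_def vimage_def)
    finally show "pmf (map_pmf (history i) p') t = pmf (map_pmf (history i) p) t" .
  qed
  have "map_pmf snd (map_pmf (history i) p') = map_pmf snd (map_pmf (history i) p)" unfolding pre ..
  then have "map_pmf snd p' = map_pmf snd p" by (simp add: map_pmf_comp prefix_def)
  moreover have "interactive r p'" by (rule reweight_interactive[OF fin wt(1) p' pre p i])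
  moreover have "card (?c ` set_pmf p') \<le> card (history i ` ?S) + 1"
  proof -
    have "?c ` set_pmf p' \<subseteq> {j\<in>J. wt j \<noteq> 0}" using sub by (auto simp: J_def set_pmf_iff p')
    then have "card (?c ` set_pmf p') \<le> card {j\<in>J. wt j \<noteq> 0}" using finJ by (intro card_mono) auto
    also have "\<dots> \<le> card I" by fact
    also have "\<dots> = card (history i ` ?S) + 1"
      unfolding I_def using fin by (subst card_insert_disjoint) (auto simp: card_image)
    finally show ?thesis .
  qed
  moreover have "l1 * info1 p' + l2 * info2 p' = l1 * info1 p + l2 * info2 p"
  proof -
    \<comment> \<open>The original law is the instance with all weights equal to 1.\<close>
    have eqs: "info1 p = ent p (?X1 && ?X2) - ent p ?X2 + (\<Sum>w\<in>?S. e1 w)"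
      "info2 p = ent p (?X2 && ?X1) - ent p ?X1 + (\<Sum>w\<in>?S. e2 w)"
      using cinf_wt[of "\<lambda>_. 1" p] by simp_all
    have "l1 * (\<Sum>w\<in>?S. wt (?c w) * e1 w) + l2 * (\<Sum>w\<in>?S. wt (?c w) * e2 w) = l1 * (\<Sum>w\<in>?S. e1 w) + l2 * (\<Sum>w\<in>?S. e2 w)"
      using func by (simp add: sum_distrib_left sum.distrib[symmetric] algebra_simps)
    then show ?thesis
      unfolding eqs cinf_wt(1)[OF wt(1) p' pre] cinf_wt(2)[OF wt(1) p' pre] by (simp add: distrib_left)
  qed
  ultimately show ?thesis using sub by blast
qed

section \<open>Reducing and renaming all auxiliary alphabets\<close>

primrec alphabet_prod :: "nat \<Rightarrow> nat \<Rightarrow> nat" where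
  "alphabet_prod N 0 = 1"
| "alphabet_prod N (Suc k) = alphabet_prod N k * (alphabet_prod N k * N + 1)"

text \<open>The largest alphabet sizes allowed by the recursive cardinality constraint of \<open>T2\<close>.\<close>

definition alphabet :: "nat \<Rightarrow> nat \<Rightarrow> nat" where
  "alphabet N k = alphabet_prod N k * N + 1"

lemma prod_alphabet: "(\<Prod>j<k. alphabet N j) = alphabet_prod N k"
  by (induction k) (simp_all add: alphabet_def)

lemma finite_card_coordinate_lists:
  assumes "\<And>j. j < i \<Longrightarrow> finite (V j)"
  shows "finite {f. length f = i \<and> (\<forall>j<i. f ! j \<in> V j)} \<and>
    card {f. length f = i \<and> (\<forall>j<i. f ! j \<in> V j)} \<le> (\<Prod>j<i. card (V j))"
  using assms
proof (induction i)
  case 0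
  have "{f :: 'a list. length f = 0 \<and> (\<forall>j<0. f ! j \<in> V j)} = {[]}" by auto
  then show ?case by simp
next
  case (Suc i)
  let ?L = "\<lambda>i. {f. length f = i \<and> (\<forall>j<i. f ! j \<in> V j)}"
  have IH: "finite (?L i)" "card (?L i) \<le> (\<Prod>j<i. card (V j))" using Suc by auto
  have fin: "finite (?L i \<times> V i)" using IH(1) Suc.prems by simp
  have sub: "?L (Suc i) \<subseteq> (\<lambda>(f, x). f @ [x]) ` (?L i \<times> V i)"
  proof
    fix f assume f: "f \<in> ?L (Suc i)"
    then have "f = take i f @ [f ! i]" by (metis (mono_tags, lifting) lessI mem_Collect_eq take_Suc_conv_app_nth take_all_iff order_refl)
    moreover have "(take i f, f ! i) \<in> ?L i \<times> V i" using f by auto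
    ultimately show "f \<in> (\<lambda>(f, x). f @ [x]) ` (?L i \<times> V i)" by (metis (no_types, lifting) case_prod_conv image_eqI)
  qed
  have "card (?L (Suc i)) \<le> card ((\<lambda>(f, x). f @ [x]) ` (?L i \<times> V i))"
    by (rule card_mono[OF finite_imageI[OF fin] sub])
  also have "\<dots> \<le> card (?L i \<times> V i)" by (rule card_image_le[OF fin])
  also have "\<dots> = card (?L i) * card (V i)" by (rule card_cartesian_product)
  also have "\<dots> \<le> (\<Prod>j<i. card (V j)) * card (V i)" using IH(2) by (rule mult_le_mono1)
  finally have "card (?L (Suc i)) \<le> (\<Prod>j<Suc i. card (V j))" by simp
  moreover have "finite (?L (Suc i))" by (rule finite_subset[OF sub finite_imageI[OF fin]])
  ultimately show ?case by simp
qed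

text \<open>Positions are treated in increasing order. Each reduction shrinks the support, so
  alphabets already small stay small, and the number of histories before position \<open>i\<close>
  is at most the product of the reduced alphabets times the number of source and output
  letters.\<close>

lemma reduce_alphabets:
  fixes p :: "(nat list \<times> 'x1::finite \<times> 'x2::finite \<times> 'y1::finite \<times> 'y2::finite) pmf" and l1 l2 :: real
  assumes fin: "finite (set_pmf p)" and p: "interactive r p" and m: "m \<le> r"
  shows "\<exists>p'. finite (set_pmf p') \<and> interactive r p' \<and> map_pmf snd p' = map_pmf snd p \<and>
    (\<forall>k<m. card ((\<lambda>w. fst w ! k) ` set_pmf p') \<le> alphabet CARD('x1 \<times> 'x2 \<times> 'y1 \<times> 'y2) k) \<and>
    l1 * info1 p' + l2 * info2 p' = l1 * info1 p + l2 * info2 p"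
  using m
proof (induction m)
  case 0
  then show ?case using fin p by auto
next
  case (Suc i)
  let ?N = "CARD('x1 \<times> 'x2 \<times> 'y1 \<times> 'y2)"
  have i: "i < r" using Suc.prems by simp
  obtain p1 where p1: "finite (set_pmf p1)" "interactive r p1" "map_pmf snd p1 = map_pmf snd p"
    "\<And>k. k < i \<Longrightarrow> card ((\<lambda>w. fst w ! k) ` set_pmf p1) \<le> alphabet ?N k"
    "l1 * info1 p1 + l2 * info2 p1 = l1 * info1 p + l2 * info2 p"
    using Suc by auto
  obtain p2 where p2: "set_pmf p2 \<subseteq> set_pmf p1" "interactive r p2" "map_pmf snd p2 = map_pmf snd p1"
    "card ((\<lambda>w. fst w ! i) ` set_pmf p2) \<le> card (history i ` set_pmf p1) + 1"
    "l1 * info1 p2 + l2 * info2 p2 = l1 * info1 p1 + l2 * info2 p1"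
    using reduce_coordinate[OF p1(1,2) i, of l1 l2] by blast
  have fin2: "finite (set_pmf p2)" using p2(1) p1(1) finite_subset by blast
  let ?V = "\<lambda>j. (\<lambda>w. fst w ! j) ` set_pmf p1"
  let ?L = "{f. length f = i \<and> (\<forall>j<i. f ! j \<in> ?V j)}"
  have L: "finite ?L" "card ?L \<le> (\<Prod>j<i. card (?V j))"
    using finite_card_coordinate_lists[of i ?V] p1(1) by auto
  have "history i w \<in> ?L \<times> UNIV" if "w \<in> set_pmf p1" for w
  proof -
    have "length (fst w) = r" using p1(2) that by (simp add: interactive_def)
    then show ?thesis using i imageI[OF that, of "\<lambda>w. fst w ! j" for j] by (simp add: mem_Times_iff)
  qed
  then have "history i ` set_pmf p1 \<subseteq> ?L \<times> UNIV" by blast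
  then have "card (history i ` set_pmf p1) \<le> card (?L \<times> (UNIV :: ('x1 \<times> 'x2 \<times> 'y1 \<times> 'y2) set))"
    using L(1) by (intro card_mono) auto
  also have "\<dots> = card ?L * ?N" by (rule card_cartesian_product)
  also have "card ?L \<le> (\<Prod>j<i. alphabet ?N j)"
    by (rule order_trans[OF L(2)]) (rule prod_mono, use p1(4) in auto)
  finally have "card (history i ` set_pmf p1) + 1 \<le> alphabet ?N i"
    unfolding alphabet_def[of _ i] prod_alphabet[symmetric] by simp
  moreover have "card ((\<lambda>w. fst w ! k) ` set_pmf p2) \<le> alphabet ?N k" if "k < i" for k
    using card_mono[OF finite_imageI[OF p1(1)] image_mono[OF p2(1)], of "\<lambda>w. fst w ! k"] p1(4)[OF that] by linarith
  ultimately have "card ((\<lambda>w. fst w ! k) ` set_pmf p2) \<le> alphabet ?N k" if "k < Suc i" for k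
    using that p2(4) by (cases "k = i") auto
  then show ?case using fin2 p1 p2 by (intro exI[of _ p2]) auto
qed

text \<open>A limit needs one finite support for all laws of a sequence, so the values are renamed
  into initial segments by an injection for each position. Chains and informations depend on induced
  partitions only and do not change.\<close>

lemma relabel_alphabets:
  fixes p :: "(nat list \<times> 'x1 \<times> 'x2 \<times> 'y1 \<times> 'y2) pmf"
  assumes fin: "finite (set_pmf p)" and p: "interactive r p"
    and K: "\<And>k. k < r \<Longrightarrow> card ((\<lambda>w. fst w ! k) ` set_pmf p) \<le> K k"
  shows "\<exists>p'. finite (set_pmf p') \<and> interactive r p' \<and> map_pmf snd p' = map_pmf snd p \<and>
    (\<forall>w\<in>set_pmf p'. \<forall>k<r. fst w ! k < K k) \<and> info1 p' = info1 p \<and> info2 p' = info2 p"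
proof -
  let ?V = "\<lambda>k. (\<lambda>w. fst w ! k) ` set_pmf p"
  have "\<exists>\<phi>. inj_on \<phi> (?V k) \<and> \<phi> ` ?V k \<subseteq> {..<K k}" if "k < r" for k
    using card_le_inj[of "?V k" "{..<K k}"] fin K[OF that] by auto
  then have "\<forall>k. \<exists>\<phi>. k < r \<longrightarrow> inj_on \<phi> (?V k) \<and> \<phi> ` ?V k \<subseteq> {..<K k}" by blast
  then obtain \<phi> where "\<forall>k. k < r \<longrightarrow> inj_on (\<phi> k) (?V k) \<and> \<phi> k ` ?V k \<subseteq> {..<K k}" by metis
  then have inj: "\<And>k. k < r \<Longrightarrow> inj_on (\<phi> k) (?V k)" and im: "\<And>k. k < r \<Longrightarrow> \<phi> k ` ?V k \<subseteq> {..<K k}" by auto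
  have len: "length (fst w) = r" if "w \<in> set_pmf p" for w using p that by (auto simp: interactive_def)
  define F where "F w = map (\<lambda>k. \<phi> k (fst w ! k)) [0..<r]" for w :: "nat list \<times> 'x1 \<times> 'x2 \<times> 'y1 \<times> 'y2"
  define T where "T w = (F w, snd w)" for w
  have nth: "F v ! k = F w ! k \<longleftrightarrow> fst v ! k = fst w ! k" if "v \<in> set_pmf p" "w \<in> set_pmf p" "k < r" for v w k
    using inj_on_eq_iff[OF inj[OF that(3)], of "fst v ! k" "fst w ! k"] that by (simp add: F_def)
  have take: "take m (F v) = take m (F w) \<longleftrightarrow> take m (fst v) = take m (fst w)"
    if "v \<in> set_pmf p" "w \<in> set_pmf p" for v w m
    using nth[OF that] len[OF that(1)] len[OF that(2)]
    by (auto simp: list_eq_iff_nth_eq F_def[of v, THEN arg_cong[where f = length], simplified]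
        F_def[of w, THEN arg_cong[where f = length], simplified])
  have all: "F v = F w \<longleftrightarrow> fst v = fst w" if "v \<in> set_pmf p" "w \<in> set_pmf p" for v w
    using take[OF that, of r] len that by (simp add: F_def)
  define p' where "p' = map_pmf T p"
  have "interactive r p'"
    unfolding interactive_def p'_def markov_chain_map
  proof (intro conjI allI impI)
    show "\<forall>w\<in>set_pmf (map_pmf T p). length (fst w) = r" by (auto simp: T_def F_def)
  next
    fix i assume i: "i < r" "even i"
    have "markov_chain p (rvMsg i) (rvHist1 i) rvX2"
      using p i by (auto simp: interactive_def)
    then show "markov_chain p (\<lambda>w. rvMsg i (T w))
      (\<lambda>w. rvHist1 i (T w)) (\<lambda>w. rvX2 (T w))"
      by (rule markov_chain_cong[THEN iffD1, rotated -1]) (use i in \<open>simp_all add: T_def case_prod_unfold nth take\<close>)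
  next
    fix i assume i: "i < r" "odd i"
    have "markov_chain p (rvMsg i) (rvHist2 i) rvX1"
      using p i by (auto simp: interactive_def)
    then show "markov_chain p (\<lambda>w. rvMsg i (T w))
      (\<lambda>w. rvHist2 i (T w)) (\<lambda>w. rvX1 (T w))"
      by (rule markov_chain_cong[THEN iffD1, rotated -1]) (use i in \<open>simp_all add: T_def case_prod_unfold nth take\<close>)
  next
    have "markov_chain p rvY1 rvFX1 rvXY2"
      using p by (auto simp: interactive_def)
    then show "markov_chain p (\<lambda>w. rvY1 (T w))
      (\<lambda>w. rvFX1 (T w)) (\<lambda>w. rvXY2 (T w))"
      by (rule markov_chain_cong[THEN iffD1, rotated -1]) (simp_all add: T_def case_prod_unfold all)
  next
    have "markov_chain p rvY2 rvFX2 rvXY1"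
      using p by (auto simp: interactive_def)
    then show "markov_chain p (\<lambda>w. rvY2 (T w))
      (\<lambda>w. rvFX2 (T w)) (\<lambda>w. rvXY1 (T w))"
      by (rule markov_chain_cong[THEN iffD1, rotated -1]) (simp_all add: T_def case_prod_unfold all)
  qed
  moreover have "finite (set_pmf p')" using fin by (simp add: p'_def)
  moreover have "map_pmf snd p' = map_pmf snd p" by (simp add: p'_def map_pmf_comp T_def)
  moreover have "\<forall>w\<in>set_pmf p'. \<forall>k<r. fst w ! k < K k" using im by (auto simp: p'_def T_def F_def)
  moreover have "info1 p' = info1 p"
    unfolding info1_def cinf_def p'_def ent_map[OF fin]
    by (intro arg_cong2[where f = "(-)"] arg_cong2[where f = "(+)"] ent_cong) (simp_all add: T_def case_prod_unfold all)
  moreover have "info2 p' = info2 p"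
    unfolding info2_def cinf_def p'_def ent_map[OF fin]
    by (intro arg_cong2[where f = "(-)"] arg_cong2[where f = "(+)"] ent_cong) (simp_all add: T_def case_prod_unfold all)
  ultimately show ?thesis by blast
qed

section \<open>Limits and separation\<close>

lemma convergent_subsequence_finite:
  fixes g :: "nat \<Rightarrow> 's \<Rightarrow> real"
  assumes "finite S" "\<And>m s. s \<in> S \<Longrightarrow> \<bar>g m s\<bar> \<le> B s"
  shows "\<exists>\<sigma> :: nat \<Rightarrow> nat. strict_mono \<sigma> \<and> (\<forall>s\<in>S. \<exists>l. (\<lambda>m. g (\<sigma> m) s) \<longlonglongrightarrow> l)"
  using assms
proof (induction S rule: finite_induct)
  case empty
  then show ?case by (intro exI[of _ id]) (simp add: strict_mono_def)
next
  case (insert s S)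
  then obtain \<sigma> :: "nat \<Rightarrow> nat" where \<sigma>: "strict_mono \<sigma>" "\<And>t. t \<in> S \<Longrightarrow> \<exists>l. (\<lambda>m. g (\<sigma> m) t) \<longlonglongrightarrow> l"
    by auto
  have "seq_compact {- B s..B s}" by (intro compact_imp_seq_compact compact_Icc)
  moreover have "\<forall>m. g (\<sigma> m) s \<in> {- B s..B s}" using insert.prems[of s] by (simp add: abs_le_iff minus_le_iff)
  ultimately obtain l \<tau> where \<tau>: "strict_mono \<tau>" "((\<lambda>m. g (\<sigma> m) s) \<circ> \<tau>) \<longlonglongrightarrow> l"
    by (rule seq_compactE) auto
  have "\<exists>l. (\<lambda>m. g (\<sigma> (\<tau> m)) t) \<longlonglongrightarrow> l" if t: "t \<in> insert s S" for t
  proof (cases "t = s")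
    case True
    then show ?thesis using \<tau>(2) by (auto simp: o_def)
  next
    case False
    then obtain l where "(\<lambda>m. g (\<sigma> m) t) \<longlonglongrightarrow> l" using \<sigma>(2)[of t] t by auto
    from LIMSEQ_subseq_LIMSEQ[OF this \<tau>(1)] show ?thesis by (auto simp: o_def)
  qed
  moreover have "strict_mono (\<lambda>m. \<sigma> (\<tau> m))" using strict_mono_o[OF \<sigma>(1) \<tau>(1)] by (simp only: o_def)
  ultimately show ?case by (intro exI[of _ "\<lambda>m. \<sigma> (\<tau> m)"] conjI ballI)
qed

text \<open>At limit 0 the logarithm is not continuous; there \<open>abs_xlnx_le_sqrt\<close> forces
  convergence to 0, which agrees with the value of \<open>0 * log 2 0\<close>.\<close>

lemma tendsto_xlogx:
  fixes f :: "nat \<Rightarrow> real"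
  assumes f: "f \<longlonglongrightarrow> l" and bd: "\<And>m. 0 \<le> f m" "\<And>m. f m \<le> 1"
  shows "(\<lambda>m. f m * log 2 (f m)) \<longlonglongrightarrow> l * log 2 l"
proof (cases "l = 0")
  case True
  have "(\<lambda>m. f m * ln (f m)) \<longlonglongrightarrow> 0"
  proof (rule Lim_null_comparison)
    show "\<forall>\<^sub>F m in sequentially. norm (f m * ln (f m)) \<le> 2 * sqrt (f m)"
      unfolding real_norm_def by (intro always_eventually allI abs_xlnx_le_sqrt bd)
    have "(\<lambda>m. 2 * sqrt (f m)) \<longlonglongrightarrow> 2 * sqrt l" by (intro tendsto_intros f)
    then show "(\<lambda>m. 2 * sqrt (f m)) \<longlonglongrightarrow> 0" using True by simp
  qed
  then have "(\<lambda>m. f m * ln (f m) / ln 2) \<longlonglongrightarrow> 0 / ln 2" by (rule tendsto_divide) auto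
  then show ?thesis using True by (simp add: log_def)
next
  case False
  have "l \<ge> 0" by (rule LIMSEQ_le_const[OF f]) (use bd in auto)
  then have "l > 0" using False by simp
  then show ?thesis unfolding log_def by (intro tendsto_intros f) auto
qed

context
  fixes P :: "nat \<Rightarrow> 'o pmf" and p :: "'o pmf" and S :: "'o set"
  assumes fin: "finite S" and sub: "\<And>m. set_pmf (P m) \<subseteq> S" "set_pmf p \<subseteq> S"
    and lim: "\<And>w. w \<in> S \<Longrightarrow> (\<lambda>m. pmf (P m) w) \<longlonglongrightarrow> pmf p w"
begin

lemma tendsto_pr: "(\<lambda>m. pr (P m) X x) \<longlonglongrightarrow> pr p X x"
  unfolding pr_finite_superset[OF fin sub(1)] pr_finite_superset[OF fin sub(2)]
  by (intro tendsto_sum lim) auto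

lemma tendsto_ent: "(\<lambda>m. ent (P m) X) \<longlonglongrightarrow> ent p X"
proof -
  have "ent (P m) X = (\<Sum>x\<in>X ` S. - (pr (P m) X x * log 2 (pr (P m) X x)))" for m
    by (rule ent_alt) (use fin sub finite_subset in blast)+
  moreover have "ent p X = (\<Sum>x\<in>X ` S. - (pr p X x * log 2 (pr p X x)))"
    by (rule ent_alt) (use fin sub finite_subset in blast)+
  ultimately show ?thesis
    by (simp only:) (intro tendsto_sum tendsto_minus tendsto_xlogx tendsto_pr pr_nonneg pr_le_1)
qed

lemma tendsto_cinf: "(\<lambda>m. cinf (P m) A B C) \<longlonglongrightarrow> cinf p A B C"
  unfolding cinf_def by (intro tendsto_intros tendsto_ent)

text \<open>In product form, without division, the condition is a polynomial identity between
  probabilities and hence closed; conditioning values whose probability tends to 0 cause no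
  trouble.\<close>

lemma markov_chain_limit:
  assumes "\<And>m. markov_chain (P m) A B C"
  shows "markov_chain p A B C"
  unfolding markov_chain_pr
proof (intro allI)
  fix a b c
  have "(\<lambda>m. pr (P m) (A && B && C) (a, b, c) * pr (P m) B b)
      \<longlonglongrightarrow> pr p (A && B && C) (a, b, c) * pr p B b"
    by (intro tendsto_intros tendsto_pr)
  moreover have "(\<lambda>m. pr (P m) (A && B && C) (a, b, c) * pr (P m) B b)
      \<longlonglongrightarrow> pr p (A && B) (a, b) * pr p (B && C) (b, c)"
    using assms unfolding markov_chain_pr by (simp only:) (intro tendsto_intros tendsto_pr)
  ultimately show "pr p (A && B && C) (a, b, c) * pr p B b
      = pr p (A && B) (a, b) * pr p (B && C) (b, c)"
    by (rule LIMSEQ_unique)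
qed

end

lemma exists_limit_pmf:
  assumes fin: "finite S" and sub: "\<And>m. set_pmf (P m) \<subseteq> S"
    and lim: "\<And>w. w \<in> S \<Longrightarrow> (\<lambda>m. pmf (P m) w) \<longlonglongrightarrow> L w"
  shows "\<exists>p. set_pmf p \<subseteq> S \<and> (\<forall>w\<in>S. pmf p w = L w)"
proof -
  define f where "f w = (if w \<in> S then L w else 0)" for w
  have "f w \<ge> 0" for w
    unfolding f_def by (auto intro: LIMSEQ_le_const[OF lim])
  moreover have "(\<lambda>m. \<Sum>w\<in>S. pmf (P m) w) \<longlonglongrightarrow> (\<Sum>w\<in>S. L w)" by (intro tendsto_sum lim)
  then have "(\<lambda>m. 1 :: real) \<longlonglongrightarrow> (\<Sum>w\<in>S. L w)" by (simp add: sum_pmf_eq_1[OF fin sub])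
  then have "(\<Sum>w\<in>S. L w) = 1" by (simp add: LIMSEQ_const_iff)
  then have "sum f S = 1" by (simp add: f_def)
  ultimately obtain p where "\<And>w. pmf p w = f w"
    using exists_pmf_finite[OF fin, of f] by (auto simp: f_def)
  then show ?thesis by (intro exI[of _ p]) (auto simp: f_def set_pmf_iff split: if_splits)
qed

section \<open>From approximate points with slacks to the region\<close>

definition output_info :: "('x1 \<times> 'x2 \<times> 'y1 \<times> 'y2) pmf \<Rightarrow> real" where
  "output_info q = cinf q (\<lambda>(x1, x2, y1, y2). y1) (\<lambda>(x1, x2, y1, y2). y2) (\<lambda>(x1, x2, y1, y2). (x1, x2))"

lemma R2_points_I:
  fixes q :: "('x1::finite \<times> 'x2::finite \<times> 'y1::finite \<times> 'y2::finite) pmf"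
  assumes fin: "finite (set_pmf p)" and p: "interactive r p" and q: "map_pmf snd p = q"
    and K: "\<And>w k. w \<in> set_pmf p \<Longrightarrow> k < r \<Longrightarrow> fst w ! k < alphabet CARD('x1 \<times> 'x2 \<times> 'y1 \<times> 'y2) k"
    and R: "info1 p \<le> R12" "info2 p \<le> R21" "info1 p + info2 p + output_info q \<le> R12 + R21"
  shows "(R12, R21) \<in> R2_points q r"
proof -
  let ?N = "CARD('x1 \<times> 'x2 \<times> 'y1 \<times> 'y2)"
  have cnt: "countable (UNIV :: 'x1 set)" "countable (UNIV :: 'x2 set)" "countable (UNIV :: 'y1 set)"
    "countable (UNIV :: 'y2 set)" "countable (UNIV :: ('x1 \<times> 'x2) set)" "countable (UNIV :: nat list set)"
    by (auto intro: countable_finite)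
  have "p \<in> T2 q r"
    unfolding T2_def mem_Collect_eq
  proof (intro conjI)
    show "map_pmf (\<lambda>(f, x1, x2, y1, y2). (x1, x2, y1, y2)) p = q"
      unfolding q[symmetric] by (rule map_pmf_cong) auto
    show "\<exists>A. (\<forall>i<r. finite (A i) \<and> card (A i) \<le> (\<Prod>j<i. card (A j)) * CARD('x1) * CARD('y1) * CARD('x2) * CARD('y2) + 1) \<and>
        (\<forall>(f, x1, x2, y1, y2)\<in>set_pmf p. length f = r \<and> (\<forall>i<r. f ! i \<in> A i))"
    \<comment> \<open>The bound on each alphabet refers to the cardinalities of the earlier ones, so
      a small alphabet would tighten the later bounds. Sets as large as allowed turn every bound
      into an equality.\<close>
    proof (intro exI[of _ "\<lambda>i. {..<alphabet ?N i}"] conjI allI impI)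
      fix i
      have "alphabet ?N i = (\<Prod>j<i. alphabet ?N j) * ?N + 1"
        unfolding prod_alphabet by (simp add: alphabet_def)
      then show "card {..<alphabet ?N i} \<le> (\<Prod>j<i. card {..<alphabet ?N j}) * CARD('x1) * CARD('y1) * CARD('x2) * CARD('y2) + 1"
        by (simp add: mult_ac)
    next
      show "\<forall>(f, x1, x2, y1, y2)\<in>set_pmf p. length f = r \<and> (\<forall>i<r. f ! i \<in> {..<alphabet ?N i})"
        using p K unfolding interactive_def by fastforce
    qed simp
  qed (use p in \<open>simp_all add: interactive_def\<close>)
  moreover have "cmi p rvX1 rvF rvX2 = info1 p"
    unfolding info1_def by (rule cmi_eq_cinf[OF fin]) (rule cnt)+
  moreover have "cmi p rvX2 rvF rvX1 = info2 p"
    unfolding info2_def by (rule cmi_eq_cinf[OF fin]) (rule cnt)+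
  moreover have "cmi p rvY1 rvY2 rvX12 = output_info q"
  proof -
    have "cmi p rvY1 rvY2 rvX12
        = cinf p rvY1 rvY2 rvX12"
      by (rule cmi_eq_cinf[OF fin]) (rule cnt)+
    also have "\<dots> = output_info q"
      unfolding output_info_def cinf_def q[symmetric] ent_map[OF fin] by (simp add: case_prod_unfold)
    finally show ?thesis .
  qed
  ultimately show ?thesis
    unfolding R2_points_def using R by (auto simp: Let_def intro!: bexI[of _ p])
qed

text \<open>The slacks \<open>s1\<close> and \<open>s2\<close> are the excess of the rates over the
  informations. The bound \<open>B\<close> does not depend on \<open>\<epsilon>\<close>, so they too
  have convergent subsequences, and the alphabet reduction leaves them alone because it preserves
  the functional of the informations.\<close>

lemma approximations_imp_R2_point:
  fixes q :: "('x1::finite \<times> 'x2::finite \<times> 'y1::finite \<times> 'y2::finite) pmf" and l1 l2 R12 R21 B :: real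
  assumes approx: "\<And>\<epsilon>. \<epsilon> > 0 \<Longrightarrow> \<exists>p s1 s2. finite (set_pmf p) \<and> interactive r p \<and>
      (\<forall>z. \<bar>pmf (map_pmf snd p) z - pmf q z\<bar> \<le> \<epsilon>) \<and> 0 \<le> s1 \<and> s1 \<le> B \<and> 0 \<le> s2 \<and> s2 \<le> B \<and>
      output_info q - \<epsilon> \<le> s1 + s2 \<and>
      l1 * (info1 p + s1) + l2 * (info2 p + s2) \<le> l1 * R12 + l2 * R21 + \<epsilon>"
  shows "\<exists>a b. (a, b) \<in> R2_points q r \<and> l1 * a + l2 * b \<le> l1 * R12 + l2 * R21"
proof -
  let ?N = "CARD('x1 \<times> 'x2 \<times> 'y1 \<times> 'y2)"
  let ?e = "\<lambda>m. inverse (real (Suc m))"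
  let ?K = "alphabet ?N"
  define S where "S = {f. length f = r \<and> (\<forall>k<r. f ! k \<in> {..<?K k})} \<times> (UNIV :: ('x1 \<times> 'x2 \<times> 'y1 \<times> 'y2) set)"
  have finS: "finite S"
    unfolding S_def using finite_card_coordinate_lists[of r "\<lambda>k. {..<?K k}"] by (intro finite_cartesian_product) auto
  have "\<exists>p s1 s2. set_pmf p \<subseteq> S \<and> interactive r p \<and> (\<forall>z. \<bar>pmf (map_pmf snd p) z - pmf q z\<bar> \<le> ?e m) \<and>
      0 \<le> s1 \<and> s1 \<le> B \<and> 0 \<le> s2 \<and> s2 \<le> B \<and> output_info q - ?e m \<le> s1 + s2 \<and>
      l1 * (info1 p + s1) + l2 * (info2 p + s2) \<le> l1 * R12 + l2 * R21 + ?e m" for m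
  proof -
    obtain p s1 s2 where p: "finite (set_pmf p)" "interactive r p" "\<forall>z. \<bar>pmf (map_pmf snd p) z - pmf q z\<bar> \<le> ?e m"
      and s: "0 \<le> s1" "s1 \<le> B" "0 \<le> s2" "s2 \<le> B" "output_info q - ?e m \<le> s1 + s2"
        "l1 * (info1 p + s1) + l2 * (info2 p + s2) \<le> l1 * R12 + l2 * R21 + ?e m"
      using approx[of "?e m"] by auto
    obtain p1 where p1: "finite (set_pmf p1)" "interactive r p1" "map_pmf snd p1 = map_pmf snd p"
      "\<And>k. k < r \<Longrightarrow> card ((\<lambda>w. fst w ! k) ` set_pmf p1) \<le> ?K k"
      "l1 * info1 p1 + l2 * info2 p1 = l1 * info1 p + l2 * info2 p"
      using reduce_alphabets[OF p(1,2) order_refl, of l1 l2] by auto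
    obtain p2 where p2: "interactive r p2" "map_pmf snd p2 = map_pmf snd p1"
      "\<forall>w\<in>set_pmf p2. \<forall>k<r. fst w ! k < ?K k" "info1 p2 = info1 p1" "info2 p2 = info2 p1"
      using relabel_alphabets[OF p1(1,2,4)] by auto
    have "set_pmf p2 \<subseteq> S" using p2(1,3) by (auto simp: S_def interactive_def)
    then show ?thesis
      using p(3) p1(3,5) p2 s by (intro exI[of _ p2] exI[of _ s1] exI[of _ s2]) (auto simp: distrib_left)
  qed
  then obtain P s1 s2 where P: "\<And>m. set_pmf (P m) \<subseteq> S" "\<And>m. interactive r (P m)"
      "\<And>m z. \<bar>pmf (map_pmf snd (P m)) z - pmf q z\<bar> \<le> ?e m"
    and s: "\<And>m. 0 \<le> s1 m" "\<And>m. s1 m \<le> B" "\<And>m. 0 \<le> s2 m" "\<And>m. s2 m \<le> B"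
      "\<And>m. output_info q - ?e m \<le> s1 m + s2 m"
      "\<And>m. l1 * (info1 (P m) + s1 m) + l2 * (info2 (P m) + s2 m) \<le> l1 * R12 + l2 * R21 + ?e m"
    by metis
  \<comment> \<open>The probabilities and the two slacks form one finite vector, so that a single
    subsequence serves them all.\<close>
  define g where "g m = case_sum (pmf (P m)) (\<lambda>b. if b then s1 m else s2 m)" for m
  have "\<exists>\<sigma> :: nat \<Rightarrow> nat. strict_mono \<sigma> \<and> (\<forall>t\<in>S <+> UNIV. \<exists>l. (\<lambda>m. g (\<sigma> m) t) \<longlonglongrightarrow> l)"
    by (rule convergent_subsequence_finite[where B = "\<lambda>t. max 1 B"])
      (use finS s in \<open>auto simp: g_def pmf_le_1 le_max_iff_disj\<close>)
  then obtain \<sigma> :: "nat \<Rightarrow> nat" where \<sigma>: "strict_mono \<sigma>" "\<And>t. t \<in> S <+> UNIV \<Longrightarrow> \<exists>l. (\<lambda>m. g (\<sigma> m) t) \<longlonglongrightarrow> l"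
    by blast
  have "\<exists>l. (\<lambda>m. pmf (P (\<sigma> m)) w) \<longlonglongrightarrow> l" if "w \<in> S" for w
    using \<sigma>(2)[of "Inl w"] that by (auto simp: g_def)
  then obtain L where L: "\<And>w. w \<in> S \<Longrightarrow> (\<lambda>m. pmf (P (\<sigma> m)) w) \<longlonglongrightarrow> L w" by metis
  obtain t1 where t1: "(\<lambda>m. s1 (\<sigma> m)) \<longlonglongrightarrow> t1" using \<sigma>(2)[of "Inr True"] by (auto simp: g_def)
  obtain t2 where t2: "(\<lambda>m. s2 (\<sigma> m)) \<longlonglongrightarrow> t2" using \<sigma>(2)[of "Inr False"] by (auto simp: g_def)
  obtain p where p: "set_pmf p \<subseteq> S" "\<And>w. w \<in> S \<Longrightarrow> pmf p w = L w"
    using exists_limit_pmf[of S "\<lambda>m. P (\<sigma> m)" L, OF finS P(1) L] by auto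
  have lim: "(\<lambda>m. pmf (P (\<sigma> m)) w) \<longlonglongrightarrow> pmf p w" if "w \<in> S" for w
    using L[OF that] p(2)[OF that] by simp
  note lims = finS P(1)[of "\<sigma> m" for m] p(1) lim
  have e: "(\<lambda>m. ?e (\<sigma> m)) \<longlonglongrightarrow> 0"
    using LIMSEQ_subseq_LIMSEQ[OF LIMSEQ_inverse_real_of_nat \<sigma>(1)] by (simp add: o_def)
  have finp: "finite (set_pmf p)" using p(1) finS finite_subset by blast
  have "interactive r p"
    unfolding interactive_def
    using p(1) P(2) by (auto simp: S_def interactive_def intro!: markov_chain_limit[OF lims])
  moreover have "map_pmf snd p = q"
  proof (rule pmf_eqI)
    fix z
    have "pmf (map_pmf snd p') z = pr p' snd z" for p' :: "(nat list \<times> 'x1 \<times> 'x2 \<times> 'y1 \<times> 'y2) pmf"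
      by (simp add: pmf_map pr_def vimage_def)
    then have "(\<lambda>m. pmf (map_pmf snd (P (\<sigma> m))) z) \<longlonglongrightarrow> pmf (map_pmf snd p) z"
      using tendsto_pr[OF lims, of snd z] by simp
    moreover have "(\<lambda>m. pmf (map_pmf snd (P (\<sigma> m))) z) \<longlonglongrightarrow> pmf q z"
    proof (rule LIM_zero_cancel, rule Lim_null_comparison[OF _ e])
      show "\<forall>\<^sub>F m in sequentially. norm (pmf (map_pmf snd (P (\<sigma> m))) z - pmf q z) \<le> ?e (\<sigma> m)"
        using P(3) by simp
    qed
    ultimately show "pmf (map_pmf snd p) z = pmf q z" by (rule LIMSEQ_unique)
  qed
  moreover have "\<And>w k. w \<in> set_pmf p \<Longrightarrow> k < r \<Longrightarrow> fst w ! k < ?K k" using p(1) by (auto simp: S_def)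
  moreover have "0 \<le> t1" "0 \<le> t2"
    by (rule LIMSEQ_le_const[OF t1], use s in auto) (rule LIMSEQ_le_const[OF t2], use s in auto)
  moreover have "output_info q \<le> t1 + t2"
  proof (rule LIMSEQ_le)
    show "(\<lambda>m. output_info q - ?e (\<sigma> m)) \<longlonglongrightarrow> output_info q"
      using tendsto_diff[OF tendsto_const e, of "output_info q"] by simp
    show "(\<lambda>m. s1 (\<sigma> m) + s2 (\<sigma> m)) \<longlonglongrightarrow> t1 + t2" by (intro tendsto_intros t1 t2)
  qed (use s in auto)
  ultimately have "(info1 p + t1, info2 p + t2) \<in> R2_points q r"
    by (intro R2_points_I[OF finp]) auto
  moreover have "l1 * (info1 p + t1) + l2 * (info2 p + t2) \<le> l1 * R12 + l2 * R21"
  proof (rule LIMSEQ_le)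
    show "(\<lambda>m. l1 * (info1 (P (\<sigma> m)) + s1 (\<sigma> m)) + l2 * (info2 (P (\<sigma> m)) + s2 (\<sigma> m)))
        \<longlonglongrightarrow> l1 * (info1 p + t1) + l2 * (info2 p + t2)"
      unfolding info1_def info2_def by (intro tendsto_intros t1 t2 tendsto_cinf[OF lims])
    show "(\<lambda>m. l1 * R12 + l2 * R21 + ?e (\<sigma> m)) \<longlonglongrightarrow> l1 * R12 + l2 * R21"
      using tendsto_add[OF tendsto_const e, of "l1 * R12 + l2 * R21"] by simp
  qed (use s in auto)
  ultimately show ?thesis by blast
qed

text \<open>The separating functional may have coefficients of any sign, which is why the hypothesis
  ranges over all \<open>l1\<close> and \<open>l2\<close>.\<close>

lemma mem_R2_if_separation:
  fixes q :: "('x1::finite \<times> 'x2::finite \<times> 'y1::finite \<times> 'y2::finite) pmf"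
  assumes "\<And>l1 l2. \<exists>a b. (a, b) \<in> R2_points q r \<and> l1 * a + l2 * b \<le> l1 * R12 + l2 * R21"
  shows "(R12, R21) \<in> R2 q r"
proof (rule ccontr)
  assume "(R12, R21) \<notin> R2 q r"
  moreover have "convex (R2 q r)" "closed (R2 q r)"
    unfolding R2_def by (auto intro: convex_closure convex_convex_hull)
  ultimately obtain l b where l: "inner l (R12, R21) < b" "\<forall>x\<in>R2 q r. inner l x > b"
    using separating_hyperplane_closed_point by blast
  obtain a1 a2 where a: "(a1, a2) \<in> R2_points q r" "fst l * a1 + snd l * a2 \<le> fst l * R12 + snd l * R21"
    using assms by blast
  have "(a1, a2) \<in> R2 q r"
    unfolding R2_def using a(1) closure_subset hull_subset[of "R2_points q r" convex] by blast
  then have "inner l (a1, a2) > b" using l(2) by blast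
  then show False using l(1) a(2) by (simp add: inner_prod_def)
qed

section \<open>The law of a code\<close>

lemma take_msgs: "k \<le> r \<Longrightarrow> take k (msgs e1 e2 r a b m1 m2) = msgs e1 e2 k a b m1 m2"
  and length_msgs: "length (msgs e1 e2 r a b m1 m2) = r"
proof -
  show len: "length (msgs e1 e2 r a b m1 m2) = r" for r by (induction r) (simp_all add: Let_def)
  show "k \<le> r \<Longrightarrow> take k (msgs e1 e2 r a b m1 m2) = msgs e1 e2 k a b m1 m2"
    by (induction r) (auto simp: Let_def len le_Suc_eq)
qed

lemma msgs_nth:
  assumes "k < r"
  shows "msgs e1 e2 r a b m1 m2 ! k = (if even k then e1 (Suc k) (msgs e1 e2 k a b m1 m2) a m1
    else e2 (Suc k) (msgs e1 e2 k a b m1 m2) b m2)"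
proof -
  have "msgs e1 e2 r a b m1 m2 ! k = take (Suc k) (msgs e1 e2 r a b m1 m2) ! k" by simp
  also have "\<dots> = msgs e1 e2 (Suc k) a b m1 m2 ! k" using assms by (subst take_msgs) auto
  also have "\<dots> = (if even k then e1 (Suc k) (msgs e1 e2 k a b m1 m2) a m1
    else e2 (Suc k) (msgs e1 e2 k a b m1 m2) b m2)"
    by (simp add: Let_def nth_append length_msgs)
  finally show ?thesis .
qed

text \<open>The transcript \<open>g\<close> replaces the actual history, so the condition concerns
  the first node's block and randomness alone.\<close>

definition consistent1 where
  "consistent1 e1 k g a = {m. \<forall>j<k. even j \<longrightarrow> e1 (Suc j) (take j g) a m = g ! j}"

definition consistent2 where
  "consistent2 e2 k g b = {m. \<forall>j<k. odd j \<longrightarrow> e2 (Suc j) (take j g) b m = g ! j}"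

text \<open>Rectangle property of interactive protocols: for fixed blocks, the private randomness
  leading to a given transcript forms a product set. All product forms below originate here.\<close>

lemma msgs_eq_iff:
  "msgs e1 e2 k a b m1 m2 = g \<longleftrightarrow> length g = k \<and> m1 \<in> consistent1 e1 k g a \<and> m2 \<in> consistent2 e2 k g b"
proof (induction k arbitrary: g)
  case 0
  then show ?case by (auto simp: consistent1_def consistent2_def)
next
  case (Suc k)
  show ?case
  proof (cases "length g = Suc k")
    case False
    then show ?thesis using length_msgs[of e1 e2 "Suc k" a b m1 m2] by auto
  next
    case True
    let ?x = "if even k then e1 (Suc k) (msgs e1 e2 k a b m1 m2) a m1 else e2 (Suc k) (msgs e1 e2 k a b m1 m2) b m2"
    have g: "g = take k g @ [g ! k]" using True by (metis lessI take_Suc_conv_app_nth take_all_iff order_refl)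
    have "msgs e1 e2 (Suc k) a b m1 m2 = g \<longleftrightarrow> msgs e1 e2 k a b m1 m2 = take k g \<and> ?x = g ! k"
      by (subst g) (simp add: Let_def)
    also have "\<dots> \<longleftrightarrow> msgs e1 e2 k a b m1 m2 = take k g \<and>
        (if even k then e1 (Suc k) (take k g) a m1 else e2 (Suc k) (take k g) b m2) = g ! k" by auto
    also have "\<dots> \<longleftrightarrow> length g = Suc k \<and> m1 \<in> consistent1 e1 (Suc k) g a \<and> m2 \<in> consistent2 e2 (Suc k) g b"
      unfolding Suc.IH using True
      by (auto simp: consistent1_def consistent2_def less_Suc_eq min_absorb1)
    finally show ?thesis .
  qed
qed

text \<open>Passes from a general probability space to a finitely supported law, to which the
  entropy calculus applies. On the discrete target every predicate is measurable.\<close>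

lemma exists_finite_law:
  assumes M: "prob_space M" and T: "T \<in> measurable M (count_space UNIV)"
    and fin: "finite \<Omega>" and range: "\<And>w. w \<in> space M \<Longrightarrow> T w \<in> \<Omega>"
  shows "\<exists>P. set_pmf P \<subseteq> \<Omega> \<and> (\<forall>Q. measure_pmf.prob P {v. Q v} = measure M {w \<in> space M. Q (T w)})"
proof -
  let ?D = "distr M (count_space UNIV) T"
  interpret D: prob_space ?D using M T by (rule prob_space.prob_space_distr)
  have D: "measure ?D E = measure M {w \<in> space M. T w \<in> E}" for E
    by (subst measure_distr[OF T]) (auto intro!: arg_cong[where f = "measure M"])
  have sum: "measure ?D E = (\<Sum>v\<in>E. measure ?D {v})" if "finite E" for E
    by (rule D.finite_measure_eq_sum_singleton[OF that]) simp
  have "measure ?D {v} = 0" if "v \<notin> \<Omega>" for v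
  proof -
    have "{w \<in> space M. T w \<in> {v}} = {}" using that range by auto
    then show ?thesis unfolding D by (simp only: measure_empty)
  qed
  moreover have "(\<Sum>v\<in>\<Omega>. measure ?D {v}) = 1"
  proof -
    have "{w \<in> space M. T w \<in> \<Omega>} = space M" using range by auto
    then have "measure ?D \<Omega> = 1" unfolding D using prob_space.prob_space[OF M] by (simp only:)
    then show ?thesis using sum[OF fin] by (simp only:)
  qed
  ultimately obtain P where P: "\<And>v. pmf P v = measure ?D {v}"
    using exists_pmf_finite[OF fin, of "\<lambda>v. measure ?D {v}"] by auto
  have sub: "set_pmf P \<subseteq> \<Omega>"
    using \<open>\<And>v. v \<notin> \<Omega> \<Longrightarrow> measure ?D {v} = 0\<close> by (force simp: set_pmf_iff P)
  have "measure_pmf.prob P {v. Q v} = measure M {w \<in> space M. Q (T w)}" for Q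
  proof -
    have finE: "finite {v\<in>\<Omega>. Q v}" using fin by simp
    have "measure_pmf.prob P {v. Q v} = measure_pmf.prob P ({v. Q v} \<inter> set_pmf P)" by (simp add: measure_Int_set_pmf)
    also have "{v. Q v} \<inter> set_pmf P = {v\<in>\<Omega>. Q v} \<inter> set_pmf P" using sub by auto
    also have "measure_pmf.prob P \<dots> = measure_pmf.prob P {v\<in>\<Omega>. Q v}" by (simp add: measure_Int_set_pmf)
    also have "\<dots> = (\<Sum>v\<in>{v\<in>\<Omega>. Q v}. measure ?D {v})"
      by (subst measure_measure_pmf_finite[OF finE]) (simp add: P)
    also have "\<dots> = measure ?D {v\<in>\<Omega>. Q v}" by (rule sum[OF finE, symmetric])
    also have "\<dots> = measure M {w \<in> space M. T w \<in> {v\<in>\<Omega>. Q v}}" by (rule D)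
    also have "{w \<in> space M. T w \<in> {v\<in>\<Omega>. Q v}} = {w \<in> space M. Q (T w)}" using range by auto
    finally show ?thesis .
  qed
  then show ?thesis using sub by blast
qed

lemma countable_finite_list: "countable (UNIV :: 'x::finite list set)"
  using countable_lists[OF countable_finite[of "UNIV :: 'x set"]] by simp

text \<open>The conditions of \<open>is_code\<close> other than the rate bounds. Truncated encoders
  satisfy them again, so the facts proved here apply to both codes.\<close>

locale interactive_code =
  fixes n r :: nat and q :: "('x1::finite \<times> 'x2::finite \<times> 'y1::finite \<times> 'y2::finite) pmf"
    and mu1 mu2 :: "real measure"
    and e1 :: "nat \<Rightarrow> nat list \<Rightarrow> 'x1 list \<Rightarrow> real \<Rightarrow> nat" and e2 :: "nat \<Rightarrow> nat list \<Rightarrow> 'x2 list \<Rightarrow> real \<Rightarrow> nat"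
    and d1 :: "nat list \<Rightarrow> 'x1 list \<Rightarrow> real \<Rightarrow> 'y1 list" and d2 :: "nat list \<Rightarrow> 'x2 list \<Rightarrow> real \<Rightarrow> 'y2 list"
  assumes prob1: "prob_space mu1" and sets1: "sets mu1 = sets borel"
    and prob2: "prob_space mu2" and sets2: "sets mu2 = sets borel"
    and e1_meas: "\<And>k h a. e1 k h a \<in> measurable mu1 (count_space UNIV)"
    and e2_meas: "\<And>k h b. e2 k h b \<in> measurable mu2 (count_space UNIV)"
    and d1_meas: "\<And>c a. d1 c a \<in> measurable mu1 (count_space UNIV)"
    and d2_meas: "\<And>c b. d2 c b \<in> measurable mu2 (count_space UNIV)"
    and d1_len: "\<And>c a m. length (d1 c a m) = n" and d2_len: "\<And>c b m. length (d2 c b m) = n"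
begin

abbreviation "cs \<equiv> code_space n q mu1 mu2"
abbreviation "qX \<equiv> map_pmf (\<lambda>(x1, x2, y1, y2). (x1, x2)) q"
abbreviation "src \<equiv> replicate_pmf n qX"

lemma space_mu [simp]: "space mu1 = UNIV" "space mu2 = UNIV"
  using sets_eq_imp_space_eq[OF sets1] sets_eq_imp_space_eq[OF sets2] by auto

lemma space_cs [simp]: "space cs = UNIV"
  by (simp add: code_space_def space_pair_measure)

lemma prob_space_cs: "prob_space cs"
  unfolding code_space_def
  by (intro prob_space_pair prob1 prob2 prob_space_measure_pmf)

lemma sets_cs_rect:
  assumes "A1 \<in> sets mu1" "A2 \<in> sets mu2"
  shows "{w. fst w \<in> Z \<and> fst (snd w) \<in> A1 \<and> snd (snd w) \<in> A2} \<in> sets cs"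
proof -
  have "{w. fst w \<in> Z \<and> fst (snd w) \<in> A1 \<and> snd (snd w) \<in> A2} = Z \<times> (A1 \<times> A2)" by auto
  then show ?thesis unfolding code_space_def using assms by simp
qed

lemma measure_cs_rect:
  assumes "A1 \<in> sets mu1" "A2 \<in> sets mu2"
  shows "measure cs {w. fst w \<in> Z \<and> fst (snd w) \<in> A1 \<and> snd (snd w) \<in> A2}
    = measure_pmf.prob src Z * measure mu1 A1 * measure mu2 A2"
proof -
  interpret m1: prob_space mu1 by (rule prob1)
  interpret m2: prob_space mu2 by (rule prob2)
  interpret m12: prob_space "mu1 \<Otimes>\<^sub>M mu2" by (intro prob_space_pair prob1 prob2)
  have "{w. fst w \<in> Z \<and> fst (snd w) \<in> A1 \<and> snd (snd w) \<in> A2} = Z \<times> (A1 \<times> A2)" by auto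
  then show ?thesis
    unfolding code_space_def measure_def using assms
    by (simp add: m12.emeasure_pair_measure_Times m2.emeasure_pair_measure_Times enn2real_mult mult.assoc)
qed

text \<open>The sample space contains lists of every length; identities about blocks hold only off
  this null set.\<close>

lemma AE_length: "AE w in cs. length (fst w) = n"
proof -
  interpret prob_space cs by (rule prob_space_cs)
  have "measure cs {w. fst w \<in> {z. length z \<noteq> n} \<and> fst (snd w) \<in> UNIV \<and> snd (snd w) \<in> UNIV} =
     measure_pmf.prob src {z. length z \<noteq> n} * measure mu1 UNIV * measure mu2 UNIV"
    by (rule measure_cs_rect) (use sets.top[of mu1] sets.top[of mu2] in auto)
  also have "measure_pmf.prob src {z. length z \<noteq> n} = 0"
    unfolding measure_pmf_zero_iff set_replicate_pmf by auto
  finally have "measure cs {w. length (fst w) \<noteq> n} = 0" by simp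
  moreover have "{w. length (fst w) \<noteq> n} \<in> sets cs"
    using sets_cs_rect[of UNIV UNIV "{z. length z \<noteq> n}"] sets.top[of mu1] sets.top[of mu2] by simp
  ultimately show ?thesis
    by (intro AE_I[of _ _ "{w. length (fst w) \<noteq> n}"]) (auto simp: emeasure_eq_measure)
qed

text \<open>The history that is fed back into the encoders takes countably many values, so
  measurability for each fixed history is enough.\<close>

lemma msgs_measurable:
  "(\<lambda>m. msgs e1 e2 k a b (fst m) (snd m)) \<in> measurable (mu1 \<Otimes>\<^sub>M mu2) (count_space UNIV)"
proof (induction k)
  case 0
  then show ?case by simp
next
  case (Suc k)
  let ?h = "\<lambda>m. msgs e1 e2 k a b (fst m) (snd m)"
  have "(\<lambda>m. h @ [if even k then e1 (Suc k) h a (fst m) else e2 (Suc k) h b (snd m)])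
      \<in> measurable (mu1 \<Otimes>\<^sub>M mu2) (count_space UNIV)" for h
    using measurable_compose[OF measurable_compose[OF measurable_fst e1_meas[of "Suc k" h a]], of "\<lambda>x. h @ [x]" "count_space UNIV" mu2]
      measurable_compose[OF measurable_compose[OF measurable_snd e2_meas[of "Suc k" h b]], of "\<lambda>x. h @ [x]" "count_space UNIV" mu1]
    by (cases "even k") auto
  then have "(\<lambda>m. (\<lambda>h m. h @ [if even k then e1 (Suc k) h a (fst m) else e2 (Suc k) h b (snd m)]) (?h m) m)
      \<in> measurable (mu1 \<Otimes>\<^sub>M mu2) (count_space UNIV)"
    by (rule measurable_compose_countable[OF _ Suc])
  then show ?case by (simp add: Let_def)
qed

text \<open>The private randomness is forgotten here; its effect survives only in the factors of the
  law.\<close>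

definition outcome :: "('x1 \<times> 'x2) list \<times> real \<times> real \<Rightarrow> nat list \<times> ('x1 \<times> 'x2 \<times> 'y1 \<times> 'y2) list" where
  "outcome w = (code_msgs e1 e2 r w, code_output e1 e2 d1 d2 r w)"

lemma measurable_cs_I:
  assumes "\<And>z. (\<lambda>m. f (z, m)) \<in> measurable (mu1 \<Otimes>\<^sub>M mu2) (count_space UNIV)"
  shows "f \<in> measurable cs (count_space UNIV)"
proof -
  have cnt: "countable (UNIV :: ('x1 \<times> 'x2) list set)" by (rule countable_finite_list)
  have "f \<in> measurable (count_space UNIV \<Otimes>\<^sub>M (mu1 \<Otimes>\<^sub>M mu2)) (count_space UNIV)"
    by (rule measurable_pair_measure_countable1[OF cnt]) (rule assms)
  also have "measurable (count_space UNIV \<Otimes>\<^sub>M (mu1 \<Otimes>\<^sub>M mu2)) (count_space UNIV) = measurable cs (count_space UNIV)"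
    unfolding code_space_def by (intro measurable_cong_sets sets_pair_measure_cong refl) simp
  finally show ?thesis .
qed

lemma code_msgs_measurable: "code_msgs e1 e2 k \<in> measurable cs (count_space UNIV)"
  by (rule measurable_cs_I) (simp add: code_msgs_def msgs_measurable)

lemma outcome_measurable: "outcome \<in> measurable cs (count_space UNIV)"
proof (rule measurable_cs_I)
  fix z :: "('x1 \<times> 'x2) list"
  let ?a = "map fst z" and ?b = "map snd z" and ?M = "mu1 \<Otimes>\<^sub>M mu2"
  let ?f = "\<lambda>c m. (c, zip ?a (zip ?b (zip (d1 c ?a (fst m)) (d2 c ?b (snd m)))))"
  have pair: "count_space (UNIV :: 'y1 list set) \<Otimes>\<^sub>M count_space (UNIV :: 'y2 list set) = count_space UNIV"
    using pair_measure_countable[OF countable_finite_list[where 'x = 'y1] countable_finite_list[where 'x = 'y2]] by simp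
  have "?f c \<in> measurable ?M (count_space UNIV)" for c
  proof -
    have "(\<lambda>m. (d1 c ?a (fst m), d2 c ?b (snd m))) \<in> measurable ?M (count_space UNIV \<Otimes>\<^sub>M count_space UNIV)"
      by (intro measurable_Pair measurable_compose[OF measurable_fst d1_meas] measurable_compose[OF measurable_snd d2_meas])
    then have "(\<lambda>m. (d1 c ?a (fst m), d2 c ?b (snd m))) \<in> measurable ?M (count_space UNIV)" unfolding pair .
    from measurable_compose[OF this, of "\<lambda>y. (c, zip ?a (zip ?b (zip (fst y) (snd y))))" "count_space UNIV"]
    show ?thesis by simp
  qed
  then have "(\<lambda>m. ?f (msgs e1 e2 r ?a ?b (fst m) (snd m)) m) \<in> measurable ?M (count_space UNIV)"
    by (rule measurable_compose_countable[OF _ msgs_measurable])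
  then show "(\<lambda>m. outcome (z, m)) \<in> measurable ?M (count_space UNIV)"
    by (simp add: outcome_def code_msgs_def code_output_def Let_def)
qed

end

text \<open>Bounded messages make the law of \<open>outcome\<close> finitely supported.\<close>

locale bounded_code = interactive_code n r q mu1 mu2 e1 e2 d1 d2
  for n r :: nat and q :: "('x1::finite \<times> 'x2::finite \<times> 'y1::finite \<times> 'y2::finite) pmf"
    and mu1 mu2 :: "real measure" and e1 e2 d1 d2 +
  fixes N :: nat
  assumes e1_le: "\<And>k h a m. e1 k h a m \<le> N" and e2_le: "\<And>k h b m. e2 k h b m \<le> N"
begin

lemma msgs_bounded: "set (msgs e1 e2 k a b m1 m2) \<subseteq> {..N}"
  by (induction k) (auto simp: Let_def e1_le e2_le)

lemma exists_law:
  "\<exists>P. finite (set_pmf P) \<and> (\<forall>v\<in>set_pmf P. length (fst v) = r \<and> set (fst v) \<subseteq> {..N} \<and> length (snd v) = n) \<and>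
    (\<forall>Q. measure_pmf.prob P {v. Q v} = measure cs {w. Q (outcome w)})"
proof -
  \<comment> \<open>The output is a \<open>zip\<close> with lists of length \<open>n\<close>, so on
    the null set of wrong source lengths it can be shorter than \<open>n\<close> but never
    longer.\<close>
  let ?\<Omega> = "{c. set c \<subseteq> {..N} \<and> length c = r} \<times> {z :: ('x1 \<times> 'x2 \<times> 'y1 \<times> 'y2) list. set z \<subseteq> UNIV \<and> length z \<le> n}"
  have fin: "finite ?\<Omega>" by (intro finite_cartesian_product finite_lists_length_eq finite_lists_length_le) auto
  have range: "outcome w \<in> ?\<Omega>" for w
    using msgs_bounded by (auto simp: outcome_def code_msgs_def code_output_def Let_def length_msgs d1_len d2_len)
  obtain P where P: "set_pmf P \<subseteq> ?\<Omega>" "\<And>Q. measure_pmf.prob P {v. Q v} = measure cs {w. Q (outcome w)}"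
    using exists_finite_law[OF prob_space_cs outcome_measurable fin] range by auto
  interpret prob_space cs by (rule prob_space_cs)
  have "measure_pmf.prob P {v. length (snd v) \<noteq> n} = measure cs {w. length (snd (outcome w)) \<noteq> n}" by (rule P(2))
  also have "\<dots> = 0"
  proof -
    have "AE w in cs. length (snd (outcome w)) = n"
      using AE_length by eventually_elim (simp add: outcome_def code_output_def Let_def d1_len d2_len)
    moreover have "{w. length (snd (outcome w)) \<noteq> n} \<in> sets cs"
      using measurable_sets[OF outcome_measurable, of "{v. length (snd v) \<noteq> n}"] by (simp add: vimage_def)
    ultimately show ?thesis
      using prob_eq_0[of "{w. length (snd (outcome w)) \<noteq> n}"] by simp
  qed
  finally have "set_pmf P \<inter> {v. length (snd v) \<noteq> n} = {}" unfolding measure_pmf_zero_iff .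
  then have "length (snd v) = n" if "v \<in> set_pmf P" for v using that by blast
  moreover have "length (fst v) = r \<and> set (fst v) \<subseteq> {..N}" if "v \<in> set_pmf P" for v
    using subsetD[OF P(1) that] by (simp add: mem_Times_iff)
  ultimately show ?thesis using P(2) finite_subset[OF P(1) fin] by blast
qed

definition law :: "(nat list \<times> ('x1 \<times> 'x2 \<times> 'y1 \<times> 'y2) list) pmf" where
  "law = (SOME P. finite (set_pmf P) \<and> (\<forall>v\<in>set_pmf P. length (fst v) = r \<and> set (fst v) \<subseteq> {..N} \<and> length (snd v) = n) \<and>
    (\<forall>Q. measure_pmf.prob P {v. Q v} = measure cs {w. Q (outcome w)}))"

lemma law_finite: "finite (set_pmf law)"
  and law_support: "v \<in> set_pmf law \<Longrightarrow> length (fst v) = r \<and> set (fst v) \<subseteq> {..N} \<and> length (snd v) = n"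
  and law_prob: "measure_pmf.prob law {v. Q v} = measure cs {w. Q (outcome w)}"
  using someI_ex[OF exists_law, folded law_def] by blast+

lemma law_pr: "pr law X x = measure cs {w. X (outcome w) = x}"
  unfolding pr_def by (rule law_prob)

definition X1 :: "nat list \<times> ('x1 \<times> 'x2 \<times> 'y1 \<times> 'y2) list \<Rightarrow> 'x1 list" where
  "X1 v = map (\<lambda>(x1, x2, y1, y2). x1) (snd v)"

definition X2 :: "nat list \<times> ('x1 \<times> 'x2 \<times> 'y1 \<times> 'y2) list \<Rightarrow> 'x2 list" where
  "X2 v = map (\<lambda>(x1, x2, y1, y2). x2) (snd v)"

definition Y1 :: "nat list \<times> ('x1 \<times> 'x2 \<times> 'y1 \<times> 'y2) list \<Rightarrow> 'y1 list" where
  "Y1 v = map (\<lambda>(x1, x2, y1, y2). y1) (snd v)"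

definition Y2 :: "nat list \<times> ('x1 \<times> 'x2 \<times> 'y1 \<times> 'y2) list \<Rightarrow> 'y2 list" where
  "Y2 v = map (\<lambda>(x1, x2, y1, y2). y2) (snd v)"

lemma outcome_components:
  assumes "length (fst w) = n"
  shows "X1 (outcome w) = map fst (fst w)" "X2 (outcome w) = map snd (fst w)"
    "Y1 (outcome w) = d1 (code_msgs e1 e2 r w) (map fst (fst w)) (fst (snd w))"
    "Y2 (outcome w) = d2 (code_msgs e1 e2 r w) (map snd (fst w)) (snd (snd w))"
  using assms unfolding X1_def X2_def Y1_def Y2_def outcome_def
  by (auto simp: code_output_def code_msgs_def Let_def d1_len d2_len intro!: nth_equalityI)

lemma consistent_sets: "consistent1 e1 k g a \<in> sets mu1" "consistent2 e2 k g b \<in> sets mu2"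
proof -
  have "consistent1 e1 k g a = {m \<in> space mu1. \<forall>j\<in>{j. j < k \<and> even j}. e1 (Suc j) (take j g) a m = g ! j}"
    by (auto simp: consistent1_def)
  also have "\<dots> \<in> sets mu1"
  proof (rule sets.sets_Collect_finite_All)
    show "{m \<in> space mu1. e1 (Suc j) (take j g) a m = g ! j} \<in> sets mu1" for j
      using measurable_sets[OF e1_meas[of "Suc j" "take j g" a], of "{g ! j}"] by (simp add: vimage_def)
  qed simp
  finally show "consistent1 e1 k g a \<in> sets mu1" .
  have "consistent2 e2 k g b = {m \<in> space mu2. \<forall>j\<in>{j. j < k \<and> odd j}. e2 (Suc j) (take j g) b m = g ! j}"
    by (auto simp: consistent2_def)
  also have "\<dots> \<in> sets mu2"
  proof (rule sets.sets_Collect_finite_All)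
    show "{m \<in> space mu2. e2 (Suc j) (take j g) b m = g ! j} \<in> sets mu2" for j
      using measurable_sets[OF e2_meas[of "Suc j" "take j g" b], of "{g ! j}"] by (simp add: vimage_def)
  qed simp
  finally show "consistent2 e2 k g b \<in> sets mu2" .
qed

text \<open>Given the blocks and a transcript prefix, the event is a rectangle in the private
  randomness by \<open>msgs_eq_iff\<close>, and the maps \<open>\<phi>\<close> and
  \<open>\<psi>\<close> each use one side only. Independence turns its probability into source
  weight times two measures. The choice of \<open>\<phi>\<close> and \<open>\<psi>\<close> covers
  messages as well as outputs.\<close>

lemma law_factors:
  assumes k: "k \<le> r"
    and A: "\<And>w. length (fst w) = n \<Longrightarrow> A (outcome w) = \<phi> (code_msgs e1 e2 k w) (map fst (fst w)) (fst (snd w))"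
    and C: "\<And>w. length (fst w) = n \<Longrightarrow> C (outcome w) = \<psi> (code_msgs e1 e2 k w) (map snd (fst w)) (snd (snd w))"
    and m1: "\<And>g x. \<phi> g x \<in> measurable mu1 (count_space UNIV)"
    and m2: "\<And>g x. \<psi> g x \<in> measurable mu2 (count_space UNIV)"
  shows "factors law A (\<lambda>v. take k (fst v)) C X1 X2 (block_weight n (pmf qX))
    (\<lambda>a g x. if length g = k then measure mu1 (consistent1 e1 k g x \<inter> {m. \<phi> g x m = a}) else 0)
    (\<lambda>g y c. measure mu2 (consistent2 e2 k g y \<inter> {m. \<psi> g y m = c}))"
  unfolding factors_def
proof (intro allI)
  fix a g c x y
  interpret prob_space cs by (rule prob_space_cs)
  let ?V = "\<lambda>v. (A v, take k (fst v), C v, X1 v, X2 v)"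
  define A1 where "A1 = consistent1 e1 k g x \<inter> {m. \<phi> g x m = a}"
  define A2 where "A2 = consistent2 e2 k g y \<inter> {m. \<psi> g y m = c}"
  \<comment> \<open>The length condition on \<open>g\<close> is put with the source event; it ends
    up as the guard in the first factor.\<close>
  define Z where "Z = {z. map fst z = x \<and> map snd z = y \<and> length g = k}"
  have A1: "A1 \<in> sets mu1"
    unfolding A1_def using measurable_sets[OF m1[of g x], of "{a}"] by (intro sets.Int consistent_sets) (auto simp: vimage_def)
  have A2: "A2 \<in> sets mu2"
    unfolding A2_def using measurable_sets[OF m2[of g y], of "{c}"] by (intro sets.Int consistent_sets) (auto simp: vimage_def)
  have "pr law ?V (a, g, c, x, y) = measure cs {w. ?V (outcome w) = (a, g, c, x, y)}"
    by (rule law_pr)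
  also have "\<dots> = measure cs {w. fst w \<in> Z \<and> fst (snd w) \<in> A1 \<and> snd (snd w) \<in> A2}"
  proof (rule finite_measure_eq_AE)
    show "AE w in cs. w \<in> {w. ?V (outcome w) = (a, g, c, x, y)} \<longleftrightarrow> w \<in> {w. fst w \<in> Z \<and> fst (snd w) \<in> A1 \<and> snd (snd w) \<in> A2}"
      using AE_length
    proof eventually_elim
      case (elim w)
      have "take k (fst (outcome w)) = code_msgs e1 e2 k w"
        by (simp add: outcome_def code_msgs_def take_msgs k)
      moreover have "code_msgs e1 e2 k w = g \<longleftrightarrow> length g = k \<and> fst (snd w) \<in> consistent1 e1 k g (map fst (fst w))
          \<and> snd (snd w) \<in> consistent2 e2 k g (map snd (fst w))"
        unfolding code_msgs_def by (rule msgs_eq_iff)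
      ultimately show ?case
        using A[OF elim] C[OF elim] outcome_components(1,2)[OF elim] by (auto simp: A1_def A2_def Z_def)
    qed
    show "{w. ?V (outcome w) = (a, g, c, x, y)} \<in> sets cs"
      using measurable_sets[OF outcome_measurable, of "{v. ?V v = (a, g, c, x, y)}"] by (simp add: vimage_def)
    show "{w. fst w \<in> Z \<and> fst (snd w) \<in> A1 \<and> snd (snd w) \<in> A2} \<in> sets cs"
      by (rule sets_cs_rect[OF A1 A2])
  qed
  also have "\<dots> = measure_pmf.prob src Z * measure mu1 A1 * measure mu2 A2"
    by (rule measure_cs_rect[OF A1 A2])
  also have "measure_pmf.prob src Z = (if length g = k then block_weight n (pmf qX) x y else 0)"
  proof (cases "length x = length y \<and> length g = k")
    case True
    have "z = zip x y \<longleftrightarrow> map fst z = x \<and> map snd z = y" for z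
      using True zip_map_fst_snd[of z] by auto
    then have "Z = {zip x y}" using True by (auto simp: Z_def)
    then show ?thesis using True by (simp add: measure_pmf_single pmf_replicate_pmf block_weight_def)
  next
    case False
    then have "Z = {}" unfolding Z_def by (auto dest: arg_cong[where f = length])
    then show ?thesis using False by (auto simp: block_weight_def)
  qed
  finally show "pr law ?V (a, g, c, x, y) = block_weight n (pmf qX) x y *
      (if length g = k then measure mu1 (consistent1 e1 k g x \<inter> {m. \<phi> g x m = a}) else 0) *
      measure mu2 (consistent2 e2 k g y \<inter> {m. \<psi> g y m = c})"
    by (simp add: A1_def A2_def)
qed

lemma law_source: "map_pmf (\<lambda>v. zip (X1 v) (X2 v)) law = src"
proof (rule pmf_eqI)
  fix z
  interpret prob_space cs by (rule prob_space_cs)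
  have U: "UNIV \<in> sets mu1" "UNIV \<in> sets mu2" using sets.top[of mu1] sets.top[of mu2] by auto
  have "pmf (map_pmf (\<lambda>v. zip (X1 v) (X2 v)) law) z = pr law (\<lambda>v. zip (X1 v) (X2 v)) z"
    by (simp add: pmf_map pr_def vimage_def)
  also have "\<dots> = measure cs {w. zip (X1 (outcome w)) (X2 (outcome w)) = z}" by (rule law_pr)
  also have "\<dots> = measure cs {w. fst w \<in> {z} \<and> fst (snd w) \<in> UNIV \<and> snd (snd w) \<in> UNIV}"
  proof (rule finite_measure_eq_AE)
    show "AE w in cs. w \<in> {w. zip (X1 (outcome w)) (X2 (outcome w)) = z} \<longleftrightarrow>
        w \<in> {w. fst w \<in> {z} \<and> fst (snd w) \<in> UNIV \<and> snd (snd w) \<in> UNIV}"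
      using AE_length by eventually_elim (simp add: outcome_components zip_map_fst_snd)
    show "{w. zip (X1 (outcome w)) (X2 (outcome w)) = z} \<in> sets cs"
      using measurable_sets[OF outcome_measurable, of "{v. zip (X1 v) (X2 v) = z}"] by (simp add: vimage_def)
  qed (rule sets_cs_rect[OF U])
  also have "\<dots> = measure_pmf.prob src {z} * measure mu1 UNIV * measure mu2 UNIV" by (rule measure_cs_rect[OF U])
  also have "\<dots> = pmf src z"
    using prob_space.prob_space[OF prob1] prob_space.prob_space[OF prob2] by (simp add: measure_pmf_single)
  finally show "pmf (map_pmf (\<lambda>v. zip (X1 v) (X2 v)) law) z = pmf src z" .
qed

lemma law_message_even:
  assumes "k < r" "even k"
  shows "factors law (\<lambda>v. fst v ! k) (\<lambda>v. take k (fst v)) (\<lambda>_. ()) X1 X2 (block_weight n (pmf qX))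
    (\<lambda>a g x. if length g = k then measure mu1 (consistent1 e1 k g x \<inter> {m. e1 (Suc k) g x m = a}) else 0)
    (\<lambda>g y c. measure mu2 (consistent2 e2 k g y \<inter> {m. () = c}))"
  by (rule law_factors) (use assms e1_meas in \<open>auto simp: outcome_def code_msgs_def msgs_nth\<close>)

lemma law_message_odd:
  assumes "k < r" "odd k"
  shows "factors law (\<lambda>_. ()) (\<lambda>v. take k (fst v)) (\<lambda>v. fst v ! k) X1 X2 (block_weight n (pmf qX))
    (\<lambda>a g x. if length g = k then measure mu1 (consistent1 e1 k g x \<inter> {m. () = a}) else 0)
    (\<lambda>g y c. measure mu2 (consistent2 e2 k g y \<inter> {m. e2 (Suc k) g y m = c}))"
  by (rule law_factors) (use assms e2_meas in \<open>auto simp: outcome_def code_msgs_def msgs_nth\<close>)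

text \<open>Before the first round no constraint has been put on the second node's randomness, so
  its factor is a total probability.\<close>

lemma law_message_first:
  assumes "0 < r"
  shows "factors law (\<lambda>v. fst v ! 0) (\<lambda>v. take 0 (fst v)) (\<lambda>_. ()) X1 X2 (block_weight n (pmf qX))
    (\<lambda>a g x. if length g = 0 then measure mu1 (consistent1 e1 0 g x \<inter> {m. e1 (Suc 0) g x m = a}) else 0) (\<lambda>_ _ _. 1)"
proof -
  have "(\<lambda>g y c. measure mu2 (consistent2 e2 0 g y \<inter> {m. () = c})) = (\<lambda>_ _ _. 1)"
    using prob_space.prob_space[OF prob2] by (auto simp: consistent2_def fun_eq_iff)
  then show ?thesis using law_message_even[of 0] assms by simp
qed

lemma law_output:
  assumes f: "\<And>w. length (fst w) = n \<Longrightarrow> A (outcome w) = F (d1 (code_msgs e1 e2 r w) (map fst (fst w)) (fst (snd w)))"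
    and g: "\<And>w. length (fst w) = n \<Longrightarrow> C (outcome w) = G (d2 (code_msgs e1 e2 r w) (map snd (fst w)) (snd (snd w)))"
  shows "\<exists>\<alpha> \<beta>. factors law A fst C X1 X2 (block_weight n (pmf qX)) \<alpha> \<beta>"
proof -
  have "\<exists>\<alpha> \<beta>. factors law A (\<lambda>v. take r (fst v)) C X1 X2 (block_weight n (pmf qX)) \<alpha> \<beta>"
    by (intro exI, rule law_factors[where \<phi> = "\<lambda>c x m. F (d1 c x m)" and \<psi> = "\<lambda>c x m. G (d2 c x m)"])
      (use f g in \<open>auto intro: measurable_compose[OF d1_meas] measurable_compose[OF d2_meas]\<close>)
  moreover have "pr law (\<lambda>w. (A w, take r (fst w), C w, X1 w, X2 w)) t = pr law (A && fst && C && X1 && X2) t" for t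
    by (rule pr_cong_support) (simp add: law_support)
  ultimately show ?thesis by (simp add: factors_def)
qed

end

section \<open>Single-letter approximants of a code\<close>

lemma exists_le_average:
  fixes f :: "nat \<Rightarrow> real"
  assumes "n > 0" "(\<Sum>i<n. f i) \<le> real n * c"
  shows "\<exists>i<n. f i \<le> c"
proof (rule ccontr)
  assume "\<not> ?thesis"
  then have "(\<Sum>i<n. c) < (\<Sum>i<n. f i)" using assms(1) by (intro sum_strict_mono) auto
  then show False using assms(2) by simp
qed

context bounded_code
begin

text \<open>The auxiliary letters of \<open>T2\<close> are natural numbers, so the first message and
  the two pieces of the source blocks are packed into one.\<close>

definition enc :: "nat \<times> 'x1 list \<times> 'x2 list \<Rightarrow> nat" where
  "enc = to_nat_on UNIV"

lemma inj_enc: "inj enc"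
proof -
  have "countable (UNIV \<times> UNIV \<times> UNIV :: (nat \<times> 'x1 list \<times> 'x2 list) set)"
    by (intro countable_SIGMA countable_finite_list) auto
  then show ?thesis unfolding enc_def by (intro inj_on_to_nat_on) simp
qed

definition letter :: "nat \<Rightarrow> nat list \<times> ('x1 \<times> 'x2 \<times> 'y1 \<times> 'y2) list \<Rightarrow> nat list \<times> 'x1 \<times> 'x2 \<times> 'y1 \<times> 'y2" where
  "letter i v = (enc (fst v ! 0, take i (X1 v), drop (Suc i) (X2 v)) # tl (fst v),
      X1 v ! i, X2 v ! i, Y1 v ! i, Y2 v ! i)"

lemma lengths:
  assumes "v \<in> set_pmf law"
  shows "length (X1 v) = n" "length (X2 v) = n" "length (Y1 v) = n" "length (Y2 v) = n" "length (fst v) = r" "length (snd v) = n"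
  using law_support[OF assms] by (auto simp: X1_def X2_def Y1_def Y2_def)

lemma interactive_letter:
  assumes "i < n" "0 < r"
  shows "interactive r (map_pmf (letter i) law)"
  unfolding letter_def[abs_def]
proof (rule interactive_single_letter[OF law_finite assms(1) _ inj_enc])
  show "1 \<le> r" using assms by simp
  show "\<exists>\<alpha> \<beta>. factors law (\<lambda>w. fst w ! k) (\<lambda>w. take k (fst w)) (\<lambda>_. ()) X1 X2 (block_weight n (pmf qX)) \<alpha> \<beta>"
    if "k < r" "even k" for k
    using law_message_even[OF that] by blast
  show "factors law (\<lambda>v. fst v ! 0) (\<lambda>v. take 0 (fst v)) (\<lambda>_. ()) X1 X2 (block_weight n (pmf qX))
    (\<lambda>a g x. if length g = 0 then measure mu1 (consistent1 e1 0 g x \<inter> {m. e1 (Suc 0) g x m = a}) else 0) (\<lambda>_ _ _. 1)"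
    by (rule law_message_first[OF assms(2)])
  show "\<exists>\<alpha> \<beta>. factors law (\<lambda>_. ()) (\<lambda>w. take k (fst w)) (\<lambda>w. fst w ! k) X1 X2 (block_weight n (pmf qX)) \<alpha> \<beta>"
    if "k < r" "odd k" for k
    using law_message_odd[OF that] by blast
  show "\<exists>\<alpha> \<beta>. factors law (\<lambda>w. Y1 w ! i) fst (\<lambda>w. Y2 w ! i) X1 X2 (block_weight n (pmf qX)) \<alpha> \<beta>"
    by (rule law_output[where F = "\<lambda>y. y ! i" and G = "\<lambda>y. y ! i"]) (simp_all add: outcome_components)
qed (auto simp: lengths)

lemma letter_fst_eq_iff:
  assumes "v \<in> set_pmf law" "w \<in> set_pmf law" "0 < r"
  shows "fst (letter i v) = fst (letter i w) \<longleftrightarrow>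
    (fst v, take i (X1 v), drop (Suc i) (X2 v)) = (fst w, take i (X1 w), drop (Suc i) (X2 w))"
  using lengths(5)[OF assms(1)] lengths(5)[OF assms(2)] assms(3) inj_eq[OF inj_enc]
  by (cases "fst v"; cases "fst w") (auto simp: letter_def)

abbreviation "aux i v \<equiv> (fst v, take i (X1 v), drop (Suc i) (X2 v))"

lemma info_letter:
  assumes "0 < r"
  shows "info1 (map_pmf (letter i) law) = cinf law (\<lambda>v. X1 v ! i) (aux i) (\<lambda>v. X2 v ! i)"
    and "info2 (map_pmf (letter i) law) = cinf law (\<lambda>v. X2 v ! i) (aux i) (\<lambda>v. X1 v ! i)"
proof -
  have "info1 (map_pmf (letter i) law) = cinf law (\<lambda>v. X1 v ! i) (\<lambda>v. fst (letter i v)) (\<lambda>v. X2 v ! i)"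
    "info2 (map_pmf (letter i) law) = cinf law (\<lambda>v. X2 v ! i) (\<lambda>v. fst (letter i v)) (\<lambda>v. X1 v ! i)"
    unfolding info1_def info2_def cinf_map[OF law_finite] by (simp_all add: letter_def)
  then show "info1 (map_pmf (letter i) law) = cinf law (\<lambda>v. X1 v ! i) (aux i) (\<lambda>v. X2 v ! i)"
    and "info2 (map_pmf (letter i) law) = cinf law (\<lambda>v. X2 v ! i) (aux i) (\<lambda>v. X1 v ! i)"
    using cinf_cong[of law "\<lambda>v. X1 v ! i" "\<lambda>v. X1 v ! i" "\<lambda>v. fst (letter i v)" "aux i" "\<lambda>v. X2 v ! i" "\<lambda>v. X2 v ! i"]
      cinf_cong[of law "\<lambda>v. X2 v ! i" "\<lambda>v. X2 v ! i" "\<lambda>v. fst (letter i v)" "aux i" "\<lambda>v. X1 v ! i" "\<lambda>v. X1 v ! i"]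
      letter_fst_eq_iff[OF _ _ assms] by simp_all
qed

lemma finite_qX: "finite (set_pmf qX)"
  by simp

lemma ent_source:
  "ent law (\<lambda>v. g (zip (X1 v) (X2 v))) = ent src g"
  using ent_map[OF law_finite, of "\<lambda>v. zip (X1 v) (X2 v)" g] by (simp add: law_source)

lemma ent_source_block:
  "ent law (X1 && X2) = real n * ent qX (\<lambda>x. x)" "ent law X1 = real n * ent qX fst" "ent law X2 = real n * ent qX snd"
proof -
  have "ent law (X1 && X2) = ent law (\<lambda>v. map (\<lambda>x. x) (zip (X1 v) (X2 v)))"
  proof (rule ent_cong)
    fix v w assume vw: "v \<in> set_pmf law" "w \<in> set_pmf law"
    note l = lengths[OF vw(1)] lengths[OF vw(2)]
    have "X1 v = map fst (zip (X1 v) (X2 v))" "X2 v = map snd (zip (X1 v) (X2 v))"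
      "X1 w = map fst (zip (X1 w) (X2 w))" "X2 w = map snd (zip (X1 w) (X2 w))" using l by simp_all
    then show "(X1 v, X2 v) = (X1 w, X2 w) \<longleftrightarrow> map (\<lambda>x. x) (zip (X1 v) (X2 v)) = map (\<lambda>x. x) (zip (X1 w) (X2 w))"
      by (metis list.map_ident prod.inject)
  qed
  also have "\<dots> = real n * ent qX (\<lambda>x. x)"
    unfolding ent_source[of "map (\<lambda>x. x)"] by (rule ent_replicate_pmf[OF finite_qX])
  finally show "ent law (X1 && X2) = real n * ent qX (\<lambda>x. x)" .
  have "ent law X1 = ent law (\<lambda>v. map fst (zip (X1 v) (X2 v)))"
    by (rule ent_cong) (simp add: lengths)
  also have "\<dots> = real n * ent qX fst"
    unfolding ent_source[of "map fst"] by (rule ent_replicate_pmf[OF finite_qX])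
  finally show "ent law X1 = real n * ent qX fst" .
  have "ent law X2 = ent law (\<lambda>v. map snd (zip (X1 v) (X2 v)))"
    by (rule ent_cong) (simp add: lengths)
  also have "\<dots> = real n * ent qX snd"
    unfolding ent_source[of "map snd"] by (rule ent_replicate_pmf[OF finite_qX])
  finally show "ent law X2 = real n * ent qX snd" .
qed

lemma ent_source_letter:
  assumes "i < n"
  shows "ent law (\<lambda>v. g (X1 v ! i, X2 v ! i)) = ent qX g"
proof -
  have "ent law (\<lambda>v. g (X1 v ! i, X2 v ! i)) = ent law (\<lambda>v. g (zip (X1 v) (X2 v) ! i))"
    by (rule ent_cong) (simp add: lengths assms)
  also have "\<dots> = ent src (\<lambda>z. g (z ! i))" by (rule ent_source)
  also have "\<dots> = ent (map_pmf (\<lambda>z. z ! i) src) g"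
    by (rule ent_map[symmetric]) (rule finite_set_replicate_pmf[OF finite_qX])
  also have "\<dots> = ent qX g" by (simp add: nth_replicate_pmf assms)
  finally show ?thesis .
qed

text \<open>For independent pairs the single-letter values of \<open>H(X1|X2)\<close> add up exactly
  to the block value, so the inequality comes from \<open>single_letter_forward\<close>
  alone.\<close>

lemma sum_info1_le:
  assumes "0 < r"
  shows "(\<Sum>i<n. info1 (map_pmf (letter i) law)) \<le> cinf law X1 fst X2"
proof -
  have h: "ent law (\<lambda>v. (X1 v ! i, X2 v ! i)) = ent qX (\<lambda>x. x)" "ent law (\<lambda>v. X2 v ! i) = ent qX snd" if "i < n" for i
    using ent_source_letter[OF that, of "\<lambda>x. x"] ent_source_letter[OF that, of snd] by simp_all
  have "(\<Sum>i<n. info1 (map_pmf (letter i) law)) = (\<Sum>i<n. (ent qX (\<lambda>x. x) - ent qX snd)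
      - (ent law (\<lambda>w. (X1 w ! i, (fst w, take i (X1 w), drop (Suc i) (X2 w)), X2 w ! i))
         - ent law (\<lambda>w. ((fst w, take i (X1 w), drop (Suc i) (X2 w)), X2 w ! i))))"
    by (intro sum.cong refl) (simp add: info_letter(1)[OF assms] cinf_def h)
  also have "\<dots> \<le> real n * (ent qX (\<lambda>x. x) - ent qX snd) - (ent law (X1 && fst && X2) - ent law (fst && X2))"
    unfolding sum_subtractf[of "\<lambda>_. ent qX (\<lambda>x. x) - ent qX snd"]
    using single_letter_forward[OF law_finite, of X1 n fst X2] lengths by simp
  also have "\<dots> = cinf law X1 fst X2"
    unfolding cinf_def ent_source_block by (simp add: algebra_simps)
  finally show ?thesis .
qed

lemma sum_info2_le:
  assumes "0 < r"
  shows "(\<Sum>i<n. info2 (map_pmf (letter i) law)) \<le> cinf law X2 fst X1"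
proof -
  have h: "ent law (\<lambda>v. (X2 v ! i, X1 v ! i)) = ent qX (\<lambda>x. (snd x, fst x))" "ent law (\<lambda>v. X1 v ! i) = ent qX fst" if "i < n" for i
    using ent_source_letter[OF that, of "\<lambda>x. (snd x, fst x)"] ent_source_letter[OF that, of fst] by simp_all
  have swap: "ent qX (\<lambda>x. (snd x, fst x)) = ent qX (\<lambda>x. x)" "ent law (X2 && X1) = ent law (X1 && X2)"
    by (rule ent_cong; auto simp: prod_eq_iff)+
  have "(\<Sum>i<n. info2 (map_pmf (letter i) law)) = (\<Sum>i<n. (ent qX (\<lambda>x. x) - ent qX fst)
      - (ent law (\<lambda>w. (X2 w ! i, (fst w, take i (X1 w), drop (Suc i) (X2 w)), X1 w ! i))
         - ent law (\<lambda>w. ((fst w, take i (X1 w), drop (Suc i) (X2 w)), X1 w ! i))))"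
    by (intro sum.cong refl) (simp add: info_letter(2)[OF assms] cinf_def h swap)
  also have "\<dots> \<le> real n * (ent qX (\<lambda>x. x) - ent qX fst) - (ent law (X2 && fst && X1) - ent law (fst && X1))"
    unfolding sum_subtractf[of "\<lambda>_. ent qX (\<lambda>x. x) - ent qX fst"]
    using single_letter_backward[OF law_finite, of X2 n fst X1] lengths by simp
  also have "\<dots> = cinf law X2 fst X1"
    unfolding cinf_def swap ent_source_block by (simp add: algebra_simps)
  finally show ?thesis .
qed

lemma law_message_markov:
  "k < r \<Longrightarrow> even k \<Longrightarrow> markov_chain law (\<lambda>v. fst v ! k) (\<lambda>v. (take k (fst v), X1 v)) X2"
  "k < r \<Longrightarrow> odd k \<Longrightarrow> markov_chain law (\<lambda>v. fst v ! k) (\<lambda>v. (take k (fst v), X2 v)) X1"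
proof -
  assume k: "k < r" "even k"
  have "markov_chain law (\<lambda>v. fst v ! k) (\<lambda>v. (take k (fst v), X1 v)) (\<lambda>v. (X2 v, ()))"
    by (rule factors_markov_left[OF law_finite law_message_even[OF k]])
  then show "markov_chain law (\<lambda>v. fst v ! k) (\<lambda>v. (take k (fst v), X1 v)) X2"
    by (rule markov_chain_cong[THEN iffD1, rotated -1]) auto
next
  assume k: "k < r" "odd k"
  have "markov_chain law (\<lambda>v. fst v ! k) (\<lambda>v. (take k (fst v), X2 v)) (\<lambda>v. (X1 v, ()))"
    by (rule factors_markov_right[OF law_finite law_message_odd[OF k]])
  then show "markov_chain law (\<lambda>v. fst v ! k) (\<lambda>v. (take k (fst v), X2 v)) X1"
    by (rule markov_chain_cong[THEN iffD1, rotated -1]) auto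
qed

lemma law_output_markov: "markov_chain law Y1 (fst && X1 && X2) Y2"
proof -
  obtain \<alpha> \<beta> where "factors law Y1 fst Y2 X1 X2 (block_weight n (pmf qX)) \<alpha> \<beta>"
    using law_output[of Y1 "\<lambda>y. y" Y2 "\<lambda>y. y"] by (auto simp: outcome_components)
  then show ?thesis by (rule factors_markov_both[OF law_finite])
qed

abbreviation "rate1 \<equiv> \<Sum>k\<in>{k. k < r \<and> even k}. ent law (\<lambda>v. fst v ! k)"
abbreviation "rate2 \<equiv> \<Sum>k\<in>{k. k < r \<and> odd k}. ent law (\<lambda>v. fst v ! k)"

lemma block_rates:
  "cinf law X1 fst X2 \<le> rate1"
  "cinf law X2 fst X1 \<le> rate2"
  "cinf law X1 fst X2 + cinf law X2 fst X1 + cinf law Y1 Y2 (X1 && X2)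
    \<le> rate1 + rate2"
proof -
  note len = lengths(5)
  show "cinf law X1 fst X2 \<le> rate1"
    by (rule rate_bound[OF law_finite len law_message_markov(2)])
  show "cinf law X2 fst X1 \<le> rate2"
    by (rule rate_bound[OF law_finite len law_message_markov(1)]) simp_all
  have "cinf law X1 fst X2 + cinf law X2 fst X1 + cinf law Y1 Y2 (X1 && X2)
      \<le> (\<Sum>k<r. ent law (\<lambda>v. fst v ! k))"
    by (rule sum_rate_bound[OF law_finite len law_message_markov law_output_markov])
  also have "(\<Sum>k<r. ent law (\<lambda>v. fst v ! k)) = (\<Sum>k\<in>{k. k < r \<and> even k} \<union> {k. k < r \<and> odd k}. ent law (\<lambda>v. fst v ! k))"
    by (rule sum.cong) auto
  also have "\<dots> = rate1 + rate2"
    by (rule sum.union_disjoint) auto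
  finally show "cinf law X1 fst X2 + cinf law X2 fst X1 + cinf law Y1 Y2 (X1 && X2)
    \<le> rate1 + rate2" .
qed

section \<open>Outputs close to the i.i.d. law, and the choice of a letter\<close>

lemma map_snd_eq_iff:
  assumes "v \<in> set_pmf law" "w \<in> set_pmf law"
  shows "map f (snd v) = map f (snd w) \<longleftrightarrow> (\<forall>i<n. f (snd v ! i) = f (snd w ! i))"
  using assms by (simp add: list_eq_iff_nth_eq lengths)

abbreviation "blocks \<equiv> {z :: ('x1 \<times> 'x2 \<times> 'y1 \<times> 'y2) list. length z = n}"

lemma finite_blocks: "finite blocks" and card_blocks: "card blocks = CARD('x1 \<times> 'x2 \<times> 'y1 \<times> 'y2) ^ n"
  using finite_lists_length_eq[of "UNIV :: ('x1 \<times> 'x2 \<times> 'y1 \<times> 'y2) set" n]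
    card_lists_length_eq[of "UNIV :: ('x1 \<times> 'x2 \<times> 'y1 \<times> 'y2) set" n] by auto

context
  fixes d :: real
  assumes d: "(\<Sum>z\<in>blocks. \<bar>pmf (map_pmf snd law) z - pmf (replicate_pmf n q) z\<bar>) \<le> d"
begin

lemma supports_blocks: "set_pmf (map_pmf snd law) \<subseteq> blocks" "set_pmf (replicate_pmf n q) \<subseteq> blocks"
  using lengths(6) by (auto simp: set_replicate_pmf)

lemma ent_output_close:
  "\<bar>ent law (\<lambda>v. map g (snd v)) - real n * ent q g\<bar> \<le> (1 + d + d * (real n * ln (CARD('x1 \<times> 'x2 \<times> 'y1 \<times> 'y2)))) / ln 2"
proof -
  have "ent law (\<lambda>v. map g (snd v)) = ent (map_pmf snd law) (map g)" by (rule ent_map[OF law_finite, symmetric])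
  moreover have "real n * ent q g = ent (replicate_pmf n q) (map g)" by (rule ent_replicate_pmf[symmetric]) simp
  moreover have "ln (real (card blocks)) = real n * ln (CARD('x1 \<times> 'x2 \<times> 'y1 \<times> 'y2))"
    unfolding card_blocks by (simp only: of_nat_power ln_realpow)
  ultimately show ?thesis
    using ent_continuity_bound[OF finite_blocks supports_blocks d, of "map g"] by simp
qed

text \<open>The factor 4 counts the entropies in \<open>cinf\<close>; each is the entropy of a
  letterwise image of the block and moves by at most the bound of
  \<open>ent_output_close\<close>.\<close>

lemma output_info_close:
  "real n * output_info q - 4 * ((1 + d + d * (real n * ln (CARD('x1 \<times> 'x2 \<times> 'y1 \<times> 'y2)))) / ln 2)
    \<le> cinf law Y1 Y2 (X1 && X2)"
proof -
  note defs = X1_def X2_def Y1_def Y2_def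
  have eq: "ent law (Y1 && X1 && X2) = ent law (\<lambda>v. map (\<lambda>z. case z of (x1, x2, y1, y2) \<Rightarrow> (y1, (x1, x2))) (snd v))"
    "ent law (Y2 && X1 && X2) = ent law (\<lambda>v. map (\<lambda>z. case z of (x1, x2, y1, y2) \<Rightarrow> (y2, (x1, x2))) (snd v))"
    "ent law (Y1 && Y2 && X1 && X2) = ent law (\<lambda>v. map (\<lambda>z. case z of (x1, x2, y1, y2) \<Rightarrow> (y1, y2, (x1, x2))) (snd v))"
    "ent law (X1 && X2) = ent law (\<lambda>v. map (\<lambda>z. case z of (x1, x2, y1, y2) \<Rightarrow> (x1, x2)) (snd v))"
    by (rule ent_cong, simp only: defs prod.inject map_snd_eq_iff case_prod_unfold, blast)+
  define c where "c = (1 + d + d * (real n * ln (CARD('x1 \<times> 'x2 \<times> 'y1 \<times> 'y2)))) / ln 2"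
  note close = ent_output_close[folded c_def]
  have "output_info q = ent q (\<lambda>z. case z of (x1, x2, y1, y2) \<Rightarrow> (y1, (x1, x2))) + ent q (\<lambda>z. case z of (x1, x2, y1, y2) \<Rightarrow> (y2, (x1, x2)))
      - ent q (\<lambda>z. case z of (x1, x2, y1, y2) \<Rightarrow> (y1, y2, (x1, x2))) - ent q (\<lambda>z. case z of (x1, x2, y1, y2) \<Rightarrow> (x1, x2))"
    unfolding output_info_def cinf_def by (simp add: case_prod_unfold)
  then have "real n * output_info q = real n * ent q (\<lambda>z. case z of (x1, x2, y1, y2) \<Rightarrow> (y1, (x1, x2))) + real n * ent q (\<lambda>z. case z of (x1, x2, y1, y2) \<Rightarrow> (y2, (x1, x2)))
      - real n * ent q (\<lambda>z. case z of (x1, x2, y1, y2) \<Rightarrow> (y1, y2, (x1, x2))) - real n * ent q (\<lambda>z. case z of (x1, x2, y1, y2) \<Rightarrow> (x1, x2))"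
    by (simp only: distrib_left right_diff_distrib)
  then show ?thesis
    using close[of "\<lambda>z. case z of (x1, x2, y1, y2) \<Rightarrow> (y1, (x1, x2))"]
      close[of "\<lambda>z. case z of (x1, x2, y1, y2) \<Rightarrow> (y2, (x1, x2))"]
      close[of "\<lambda>z. case z of (x1, x2, y1, y2) \<Rightarrow> (y1, y2, (x1, x2))"]
      close[of "\<lambda>z. case z of (x1, x2, y1, y2) \<Rightarrow> (x1, x2)"]
    unfolding cinf_def eq c_def[symmetric] abs_le_iff by linarith
qed

text \<open>Summation over all blocks with a prescribed letter does not increase the l1
  distance.\<close>

lemma letter_marginal_close:
  assumes i: "i < n"
  shows "\<bar>pmf (map_pmf snd (map_pmf (letter i) law)) t - pmf q t\<bar> \<le> d"
proof -
  have nth: "(\<lambda>v. snd (letter i v)) v = snd v ! i" if "v \<in> set_pmf law" for v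
    using lengths(6)[OF that] i by (simp add: letter_def X1_def X2_def Y1_def Y2_def case_prod_unfold)
  have "pmf (map_pmf snd (map_pmf (letter i) law)) t = pr law (\<lambda>v. snd (letter i v)) t"
    by (simp add: pmf_map pr_def vimage_def map_pmf_comp)
  also have "\<dots> = pr law (\<lambda>v. snd v ! i) t" by (rule pr_cong_support) (simp add: nth)
  also have "\<dots> = pr (map_pmf snd law) (\<lambda>z. z ! i) t" by (simp add: pr_map)
  also have "\<dots> = (\<Sum>z\<in>{z\<in>blocks. z ! i = t}. pmf (map_pmf snd law) z)"
    by (rule pr_finite_superset[OF finite_blocks supports_blocks(1)])
  finally have 1: "pmf (map_pmf snd (map_pmf (letter i) law)) t = (\<Sum>z\<in>{z\<in>blocks. z ! i = t}. pmf (map_pmf snd law) z)" .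
  have "pmf q t = pmf (map_pmf (\<lambda>z. z ! i) (replicate_pmf n q)) t" by (simp add: nth_replicate_pmf i)
  also have "\<dots> = pr (replicate_pmf n q) (\<lambda>z. z ! i) t" by (simp add: pmf_map pr_def vimage_def)
  also have "\<dots> = (\<Sum>z\<in>{z\<in>blocks. z ! i = t}. pmf (replicate_pmf n q) z)"
    by (rule pr_finite_superset[OF finite_blocks supports_blocks(2)])
  finally have "\<bar>pmf (map_pmf snd (map_pmf (letter i) law)) t - pmf q t\<bar>
      = \<bar>\<Sum>z\<in>{z\<in>blocks. z ! i = t}. pmf (map_pmf snd law) z - pmf (replicate_pmf n q) z\<bar>"
    unfolding 1 by (simp add: sum_subtractf)
  also have "\<dots> \<le> (\<Sum>z\<in>{z\<in>blocks. z ! i = t}. \<bar>pmf (map_pmf snd law) z - pmf (replicate_pmf n q) z\<bar>)"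
    by (rule sum_abs)
  also have "\<dots> \<le> (\<Sum>z\<in>blocks. \<bar>pmf (map_pmf snd law) z - pmf (replicate_pmf n q) z\<bar>)"
    by (rule sum_mono2) (use finite_blocks in auto)
  also have "\<dots> \<le> d" by (rule d)
  finally show ?thesis .
qed

text \<open>Since the slacks are defined by the averages over all letters, their sum inherits the
  block sum-rate bound. The individual letter then has to satisfy only one inequality, which some
  letter does because it holds on average.\<close>

lemma exists_single_letter:
  fixes a1 a2 l1 l2 :: real
  assumes n: "0 < n" and r: "0 < r"
    and S1: "rate1 \<le> real n * a1"
    and S2: "rate2 \<le> real n * a2"
  shows "\<exists>p s1 s2. finite (set_pmf p) \<and> interactive r p \<and>
      (\<forall>z. \<bar>pmf (map_pmf snd p) z - pmf q z\<bar> \<le> d) \<and> 0 \<le> s1 \<and> s1 \<le> a1 \<and> 0 \<le> s2 \<and> s2 \<le> a2 \<and>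
      output_info q - 4 * (((1 + d) / real n + d * ln (CARD('x1 \<times> 'x2 \<times> 'y1 \<times> 'y2))) / ln 2) \<le> s1 + s2 \<and>
      l1 * (info1 p + s1) + l2 * (info2 p + s2) \<le> l1 * a1 + l2 * a2"
proof -
  let ?p = "\<lambda>i. map_pmf (letter i) law"
  define A1 where "A1 = (\<Sum>i<n. info1 (?p i))"
  define A2 where "A2 = (\<Sum>i<n. info2 (?p i))"
  define s1 where "s1 = a1 - A1 / real n"
  define s2 where "s2 = a2 - A2 / real n"
  have n0: "real n > 0" using n by simp
  have fin: "finite (set_pmf (?p i))" for i using law_finite by simp
  have "A1 \<ge> 0" "A2 \<ge> 0" unfolding A1_def A2_def
    by (intro sum_nonneg; simp only: info1_def info2_def; rule cinf_nonneg[OF fin])+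
  then have s_le: "s1 \<le> a1" "s2 \<le> a2" using n0 by (auto simp: s1_def s2_def)
  have A: "A1 \<le> cinf law X1 fst X2" "A2 \<le> cinf law X2 fst X1"
    unfolding A1_def A2_def by (rule sum_info1_le[OF r], rule sum_info2_le[OF r])
  have "A1 \<le> real n * a1" "A2 \<le> real n * a2" using A block_rates(1,2) S1 S2 by linarith+
  then have s_ge: "0 \<le> s1" "0 \<le> s2" using n0 by (auto simp: s1_def s2_def field_simps)
  have "real n * output_info q - 4 * ((1 + d + d * (real n * ln (CARD('x1 \<times> 'x2 \<times> 'y1 \<times> 'y2)))) / ln 2)
      \<le> real n * a1 + real n * a2 - A1 - A2"
    using output_info_close block_rates(3) A S1 S2 by linarith
  then have "(real n * output_info q - 4 * ((1 + d + d * (real n * ln (CARD('x1 \<times> 'x2 \<times> 'y1 \<times> 'y2)))) / ln 2)) / real n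
      \<le> (real n * a1 + real n * a2 - A1 - A2) / real n" using n0 by (intro divide_right_mono) auto
  moreover have "(real n * a1 + real n * a2 - A1 - A2) / real n = s1 + s2"
    using n0 by (simp add: s1_def s2_def field_simps)
  moreover have "(real n * output_info q - 4 * ((1 + d + d * (real n * ln (CARD('x1 \<times> 'x2 \<times> 'y1 \<times> 'y2)))) / ln 2)) / real n
      = output_info q - 4 * (((1 + d) / real n + d * ln (CARD('x1 \<times> 'x2 \<times> 'y1 \<times> 'y2))) / ln 2)"
    using n0 by (simp add: field_simps)
  ultimately have s_sum: "output_info q - 4 * (((1 + d) / real n + d * ln (CARD('x1 \<times> 'x2 \<times> 'y1 \<times> 'y2))) / ln 2) \<le> s1 + s2"
    by (simp only:)
  have "(\<Sum>i<n. l1 * (info1 (?p i) + s1) + l2 * (info2 (?p i) + s2)) = l1 * (A1 + real n * s1) + l2 * (A2 + real n * s2)"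
    unfolding A1_def A2_def by (simp add: sum.distrib sum_distrib_left[symmetric])
  also have "A1 + real n * s1 = real n * a1" using n0 by (simp add: s1_def field_simps)
  also have "A2 + real n * s2 = real n * a2" using n0 by (simp add: s2_def field_simps)
  finally have "(\<Sum>i<n. l1 * (info1 (?p i) + s1) + l2 * (info2 (?p i) + s2)) \<le> real n * (l1 * a1 + l2 * a2)"
    by (simp add: algebra_simps)
  from exists_le_average[OF n this]
  obtain i where i: "i < n" "l1 * (info1 (?p i) + s1) + l2 * (info2 (?p i) + s2) \<le> l1 * a1 + l2 * a2" by blast
  show ?thesis
    using fin[of i] interactive_letter[OF i(1) r] letter_marginal_close[OF i(1)] s_ge s_le s_sum i(2) by blast
qed

end

end

section \<open>Truncating the messages\<close>

text \<open>The symbol \<open>N\<close> marks an overflow and is repeated once it has been sent; hence the truncated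
  messages still form an interactive protocol, and they agree with the original ones as long as
  no overflow occurs.\<close>

definition truncated :: "nat \<Rightarrow> (nat \<Rightarrow> nat list \<Rightarrow> 'x \<Rightarrow> real \<Rightarrow> nat) \<Rightarrow> nat \<Rightarrow> nat list \<Rightarrow> 'x \<Rightarrow> real \<Rightarrow> nat" where
  "truncated N e k h a m = (if N \<in> set h then N else min N (e k h a m))"

lemma truncated_msgs_no_overflow:
  assumes "\<forall>x\<in>set (msgs e1 e2 k a b m1 m2). x < N"
  shows "msgs (truncated N e1) (truncated N e2) k a b m1 m2 = msgs e1 e2 k a b m1 m2"
  using assms by (induction k) (auto simp: Let_def truncated_def split: if_splits)

lemma truncated_msgs_eq:
  assumes "N \<notin> set (msgs (truncated N e1) (truncated N e2) k a b m1 m2)"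
  shows "msgs (truncated N e1) (truncated N e2) k a b m1 m2 = msgs e1 e2 k a b m1 m2"
  using assms by (induction k) (auto simp: Let_def truncated_def min_def split: if_splits)

text \<open>Since an overflow is repeated for ever, a symbol other than \<open>N\<close> in round
  \<open>k\<close> certifies that no earlier overflow has altered the history.\<close>

lemma truncated_msgs_nth:
  assumes "k < r" "msgs (truncated N e1) (truncated N e2) r a b m1 m2 ! k \<noteq> N"
  shows "msgs (truncated N e1) (truncated N e2) r a b m1 m2 ! k = msgs e1 e2 r a b m1 m2 ! k"
proof -
  have "N \<notin> set (msgs (truncated N e1) (truncated N e2) k a b m1 m2)"
    using assms(2) unfolding msgs_nth[OF assms(1)] by (auto simp: truncated_def split: if_splits)
  then have "msgs (truncated N e1) (truncated N e2) k a b m1 m2 = msgs e1 e2 k a b m1 m2"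
    by (rule truncated_msgs_eq)
  then show ?thesis
    using assms(2) unfolding msgs_nth[OF assms(1)] by (auto simp: truncated_def min_def split: if_splits)
qed

text \<open>Truncation may raise the entropy of a message, as an overflow can stem from an earlier
  round and so need not be a function of the message itself. With \<open>s\<close> the truncated and
  \<open>t\<close> the original law, the atoms below \<open>N\<close> lose mass at most
  \<open>\<delta>\<close> in total and cost at most that much in nats; the new atom \<open>N\<close>
  costs at most \<open>2 * sqrt \<delta>\<close>.\<close>

lemma entropy_perturbation:
  fixes s t :: "nat \<Rightarrow> real"
  assumes s: "\<And>c. 0 \<le> s c" "(\<Sum>c\<le>N. s c) = 1" "s N \<le> \<delta>"
    and t: "\<And>c. c < N \<Longrightarrow> s c \<le> t c" "(\<Sum>c<N. t c) \<le> 1"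
  shows "(\<Sum>c\<le>N. - (s c * log 2 (s c))) \<le> (\<Sum>c<N. - (t c * log 2 (t c))) + (\<delta> + 2 * sqrt \<delta>) / ln 2"
proof -
  have t0: "0 \<le> t c" "t c \<le> 1" if "c < N" for c
  proof -
    show "0 \<le> t c" using s(1)[of c] t(1)[OF that] by linarith
    have "t c \<le> (\<Sum>c<N. t c)" by (rule member_le_sum) (use that s(1) t(1) order_trans in \<open>auto, blast\<close>)
    then show "t c \<le> 1" using t(2) by linarith
  qed
  have sN: "s N = 1 - (\<Sum>c<N. s c)" using s(2) by (simp add: lessThan_Suc_atMost[symmetric])
  have "s N \<le> 1" unfolding sN using s(1) by (simp add: sum_nonneg)
  have "\<bar>s N * ln (s N)\<bar> \<le> 2 * sqrt (s N)" by (rule abs_xlnx_le_sqrt[OF s(1) \<open>s N \<le> 1\<close>])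
  also have "\<dots> \<le> 2 * sqrt \<delta>" using s(3) by simp
  finally have N: "- (s N * ln (s N)) \<le> 2 * sqrt \<delta>" by linarith
  have "(\<Sum>c<N. - (s c * ln (s c))) \<le> (\<Sum>c<N. - (t c * ln (t c)) + (t c - s c))"
  proof (rule sum_mono)
    fix c assume "c \<in> {..<N}"
    then have c: "c < N" by simp
    have "t c * ln (t c) - s c * ln (s c) \<le> t c - s c"
      by (rule xlnx_increment_le[OF s(1) t(1)[OF c] t0(2)[OF c]])
    then show "- (s c * ln (s c)) \<le> - (t c * ln (t c)) + (t c - s c)" by linarith
  qed
  also have "\<dots> = (\<Sum>c<N. - (t c * ln (t c))) + ((\<Sum>c<N. t c) - (\<Sum>c<N. s c))"
    by (simp add: sum.distrib sum_subtractf sum_negf)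
  also have "\<dots> \<le> (\<Sum>c<N. - (t c * ln (t c))) + \<delta>" using t(2) s(3) sN by linarith
  finally have "(\<Sum>c\<le>N. - (s c * ln (s c))) \<le> (\<Sum>c<N. - (t c * ln (t c))) + (\<delta> + 2 * sqrt \<delta>)"
    using N by (simp add: lessThan_Suc_atMost[symmetric])
  then have "(\<Sum>c\<le>N. - (s c * ln (s c))) / ln 2 \<le> ((\<Sum>c<N. - (t c * ln (t c))) + (\<delta> + 2 * sqrt \<delta>)) / ln 2"
    by (intro divide_right_mono) auto
  then show ?thesis by (simp add: log_def sum_divide_distrib add_divide_distrib)
qed

lemma (in prob_space) sum_prob_values_le:
  assumes T: "T \<in> measurable M (count_space UNIV)" and E: "E \<in> sets M" and F: "finite F"
  shows "(\<Sum>z\<in>F. prob ({w \<in> space M. T w = z} \<inter> E)) \<le> prob E"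
proof -
  have m: "{w \<in> space M. T w = z} \<inter> E \<in> sets M" for z
    using measurable_sets[OF T, of "{z}"] E by (intro sets.Int) (auto simp: vimage_def Int_def conj_commute)
  have "(\<Sum>z\<in>F. prob ({w \<in> space M. T w = z} \<inter> E)) = prob (\<Union>z\<in>F. {w \<in> space M. T w = z} \<inter> E)"
    by (rule finite_measure_finite_Union[symmetric, OF F]) (use m in \<open>auto simp: disjoint_family_on_def\<close>)
  also have "\<dots> \<le> prob E" by (rule finite_measure_mono) (use E in auto)
  finally show ?thesis .
qed

text \<open>Off \<open>E\<close> the two events for each value coincide, and inside \<open>E\<close>
  each of the two families of events is disjoint, contributing at most the probability of
  \<open>E\<close>.\<close>

lemma (in prob_space) sum_prob_difference_le:
  assumes T: "T \<in> measurable M (count_space UNIV)" and T': "T' \<in> measurable M (count_space UNIV)"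
    and E: "E \<in> sets M" and F: "finite F" and eq: "\<And>w. w \<in> space M \<Longrightarrow> w \<notin> E \<Longrightarrow> T w = T' w"
  shows "(\<Sum>z\<in>F. \<bar>prob {w \<in> space M. T w = z} - prob {w \<in> space M. T' w = z}\<bar>) \<le> 2 * prob E"
proof -
  have m: "{w \<in> space M. T w = z} \<in> sets M" "{w \<in> space M. T' w = z} \<in> sets M" for z
    using measurable_sets[OF T, of "{z}"] measurable_sets[OF T', of "{z}"] by (auto simp: vimage_def Int_def conj_commute)
  have "\<bar>prob {w \<in> space M. T w = z} - prob {w \<in> space M. T' w = z}\<bar>
      \<le> prob ({w \<in> space M. T w = z} \<inter> E) + prob ({w \<in> space M. T' w = z} \<inter> E)" for z
  proof -
    have "prob {w \<in> space M. T w = z} = prob ({w \<in> space M. T w = z} \<inter> E) + prob ({w \<in> space M. T w = z} - E)"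
      "prob {w \<in> space M. T' w = z} = prob ({w \<in> space M. T' w = z} \<inter> E) + prob ({w \<in> space M. T' w = z} - E)"
      using finite_measure_Diff'[OF m(1) E] finite_measure_Diff'[OF m(2) E] by simp_all
    moreover have "{w \<in> space M. T w = z} - E = {w \<in> space M. T' w = z} - E" using eq by auto
    ultimately show ?thesis by (simp add: abs_le_iff)
  qed
  then have "(\<Sum>z\<in>F. \<bar>prob {w \<in> space M. T w = z} - prob {w \<in> space M. T' w = z}\<bar>)
      \<le> (\<Sum>z\<in>F. prob ({w \<in> space M. T w = z} \<inter> E) + prob ({w \<in> space M. T' w = z} \<inter> E))"
    by (rule sum_mono)
  also have "\<dots> \<le> 2 * prob E"
    using sum_prob_values_le[OF T E F] sum_prob_values_le[OF T' E F] by (simp add: sum.distrib)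
  finally show ?thesis .
qed

lemma sum_le_entropy_nat:
  assumes "entropy_nat P C \<noteq> \<infinity>" "prob_space P"
  shows "(\<Sum>c<N. - (measure P {w \<in> space P. C w = c} * log 2 (measure P {w \<in> space P. C w = c}))) \<le> enn2real (entropy_nat P C)"
proof -
  let ?h = "\<lambda>c. - measure P {w \<in> space P. C w = c} * log 2 (measure P {w \<in> space P. C w = c})"
  have h0: "0 \<le> ?h c" for c
    using prob_space.prob_le_1[OF assms(2)] measure_nonneg[of P "{w \<in> space P. C w = c}"]
    by (cases "measure P {w \<in> space P. C w = c} = 0") (auto simp: mult_nonneg_nonpos2 zero_less_measure_iff intro!: mult_nonneg_nonpos)
  have "ennreal (\<Sum>c<N. ?h c) = (\<Sum>c<N. ennreal (?h c))" by (rule sum_ennreal[symmetric]) (rule h0)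
  also have "\<dots> \<le> (\<Sum>c. ennreal (?h c))" by (rule sum_le_suminf) auto
  also have "\<dots> = entropy_nat P C" by (simp add: entropy_nat_def)
  finally have "enn2real (ennreal (\<Sum>c<N. ?h c)) \<le> enn2real (entropy_nat P C)"
    using assms(1) by (intro enn2real_mono) (auto simp: less_top)
  then show ?thesis using sum_nonneg[of "{..<N}" ?h] h0 by simp
qed

section \<open>The cost of truncation\<close>

context interactive_code
begin

abbreviation "t1 N \<equiv> truncated N e1"
abbreviation "t2 N \<equiv> truncated N e2"
abbreviation "tlaw N \<equiv> bounded_code.law n r q mu1 mu2 (t1 N) (t2 N) d1 d2 N"

lemma bounded_code_truncated: "bounded_code n mu1 mu2 (t1 N) (t2 N) d1 d2 N"
proof (intro bounded_code.intro interactive_code.intro bounded_code_axioms.intro)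
  show "truncated N e1 k h a \<in> measurable mu1 (count_space UNIV)" for k h a
    using measurable_compose[OF e1_meas[of k h a], of "\<lambda>x. if N \<in> set h then N else min N x" "count_space UNIV"]
    by (simp add: truncated_def[abs_def])
  show "truncated N e2 k h a \<in> measurable mu2 (count_space UNIV)" for k h a
    using measurable_compose[OF e2_meas[of k h a], of "\<lambda>x. if N \<in> set h then N else min N x" "count_space UNIV"]
    by (simp add: truncated_def[abs_def])
qed (rule prob1 prob2 sets1 sets2 d1_meas d2_meas d1_len d2_len | simp add: truncated_def)+

definition overflow :: "nat \<Rightarrow> (('x1 \<times> 'x2) list \<times> real \<times> real) set" where
  "overflow N = {w. \<exists>x\<in>set (code_msgs e1 e2 r w). N \<le> x}"

lemma overflow_sets: "overflow N \<in> sets cs"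
  using measurable_sets[OF code_msgs_measurable[of r], of "{c. \<exists>x\<in>set c. N \<le> x}"]
  by (simp add: overflow_def vimage_def)

text \<open>Every single transcript has a largest message, so the decreasing overflow events have
  empty intersection.\<close>

lemma overflow_tendsto: "(\<lambda>N. measure cs (overflow N)) \<longlonglongrightarrow> 0"
proof -
  interpret prob_space cs by (rule prob_space_cs)
  have "(\<lambda>N. measure cs (overflow N)) \<longlonglongrightarrow> measure cs (\<Inter>N. overflow N)"
    by (rule finite_Lim_measure_decseq)
      (use overflow_sets in \<open>auto simp: decseq_def overflow_def intro: order_trans\<close>)
  moreover have "(\<Inter>N. overflow N) = {}"
  proof -
    have "w \<notin> overflow (Suc (Max (set (code_msgs e1 e2 r w))))" for w
    proof
      assume "w \<in> overflow (Suc (Max (set (code_msgs e1 e2 r w))))"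
      then obtain x where x: "x \<in> set (code_msgs e1 e2 r w)" "Suc (Max (set (code_msgs e1 e2 r w))) \<le> x"
        by (auto simp: overflow_def)
      then show False using Max_ge[OF List.finite_set x(1)] by linarith
    qed
    then show ?thesis by blast
  qed
  ultimately show ?thesis by simp
qed

lemma no_overflow:
  assumes "w \<notin> overflow N"
  shows "code_msgs (t1 N) (t2 N) r w = code_msgs e1 e2 r w"
    "code_output (t1 N) (t2 N) d1 d2 r w = code_output e1 e2 d1 d2 r w"
proof -
  have "\<forall>x\<in>set (msgs e1 e2 r (map fst (fst w)) (map snd (fst w)) (fst (snd w)) (snd (snd w))). x < N"
    using assms by (auto simp: overflow_def code_msgs_def not_le)
  note truncated_msgs_no_overflow[OF this]
  then show "code_msgs (t1 N) (t2 N) r w = code_msgs e1 e2 r w"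
    "code_output (t1 N) (t2 N) d1 d2 r w = code_output e1 e2 d1 d2 r w"
    by (simp_all add: code_msgs_def code_output_def Let_def)
qed

lemma truncated_output_close:
  "(\<Sum>z\<in>{z. length z = n}. \<bar>pmf (map_pmf snd (tlaw N)) z - pmf (replicate_pmf n q) z\<bar>)
    \<le> code_l1 n q mu1 mu2 e1 e2 d1 d2 r + 2 * measure cs (overflow N)"
proof -
  interpret T: bounded_code n r q mu1 mu2 "t1 N" "t2 N" d1 d2 N by (rule bounded_code_truncated)
  interpret prob_space cs by (rule prob_space_cs)
  let ?F = "{z :: ('x1 \<times> 'x2 \<times> 'y1 \<times> 'y2) list. length z = n}"
  let ?u = "\<lambda>z. measure cs {w. code_output (t1 N) (t2 N) d1 d2 r w = z}"
  let ?v = "\<lambda>z. measure cs {w. code_output e1 e2 d1 d2 r w = z}"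
  have u: "pmf (map_pmf snd T.law) z = ?u z" for z
  proof -
    have "pmf (map_pmf snd T.law) z = pr T.law snd z" by (simp add: pmf_map pr_def vimage_def)
    then show ?thesis by (simp add: T.law_pr T.outcome_def)
  qed
  have m: "code_output e1 e2 d1 d2 r \<in> measurable cs (count_space UNIV)"
    "code_output (t1 N) (t2 N) d1 d2 r \<in> measurable cs (count_space UNIV)"
    using measurable_compose[OF outcome_measurable, of snd "count_space UNIV"]
      measurable_compose[OF T.outcome_measurable, of snd "count_space UNIV"]
    by (simp_all add: outcome_def T.outcome_def)
  have "(\<Sum>z\<in>?F. \<bar>pmf (map_pmf snd T.law) z - pmf (replicate_pmf n q) z\<bar>)
      \<le> (\<Sum>z\<in>?F. \<bar>?u z - ?v z\<bar> + \<bar>?v z - pmf (replicate_pmf n q) z\<bar>)"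
    unfolding u by (rule sum_mono) linarith
  also have "\<dots> = (\<Sum>z\<in>?F. \<bar>?u z - ?v z\<bar>) + code_l1 n q mu1 mu2 e1 e2 d1 d2 r"
    by (simp add: sum.distrib code_l1_def Let_def)
  also have "(\<Sum>z\<in>?F. \<bar>?u z - ?v z\<bar>) \<le> 2 * measure cs (overflow N)"
    using sum_prob_difference_le[OF m(2,1) overflow_sets[of N] T.finite_blocks no_overflow(2)] by simp
  finally show ?thesis by simp
qed

lemma truncated_entropy_le:
  fixes N :: nat
  assumes k: "k < r" and H: "entropy_nat cs (\<lambda>w. code_msgs e1 e2 r w ! k) \<noteq> \<infinity>"
  defines "\<delta> \<equiv> measure cs (overflow N)"
  shows "ent (tlaw N) (\<lambda>v. fst v ! k)
    \<le> enn2real (entropy_nat cs (\<lambda>w. code_msgs e1 e2 r w ! k)) + (\<delta> + 2 * sqrt \<delta>) / ln 2"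
proof -
  interpret T: bounded_code n r q mu1 mu2 "t1 N" "t2 N" d1 d2 N by (rule bounded_code_truncated)
  interpret prob_space cs by (rule prob_space_cs)
  define s where "s c = pr T.law (\<lambda>v. fst v ! k) c" for c
  define t where "t c = measure cs {w \<in> space cs. code_msgs e1 e2 r w ! k = c}" for c
  have s: "s c = measure cs {w. code_msgs (t1 N) (t2 N) r w ! k = c}" for c
    unfolding s_def T.law_pr by (simp add: T.outcome_def)
  have range: "(\<lambda>v. fst v ! k) ` set_pmf T.law \<subseteq> {..N}"
  proof
    fix c assume "c \<in> (\<lambda>v. fst v ! k) ` set_pmf T.law"
    then obtain v where v: "v \<in> set_pmf T.law" "c = fst v ! k" by auto
    then have "c \<in> set (fst v)" using T.law_support[OF v(1)] k by simp
    then show "c \<in> {..N}" using T.law_support[OF v(1)] by blast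
  qed
  have m: "(\<lambda>w. code_msgs e1 e2 r w ! k) \<in> measurable cs (count_space UNIV)"
    "(\<lambda>w. code_msgs (t1 N) (t2 N) r w ! k) \<in> measurable cs (count_space UNIV)"
    using measurable_compose[OF code_msgs_measurable[of r], of "\<lambda>c. c ! k" "count_space UNIV"]
      measurable_compose[OF T.code_msgs_measurable[of r], of "\<lambda>c. c ! k" "count_space UNIV"] by simp_all
  have len: "length (code_msgs e1 e2 r w) = r" for w by (simp add: code_msgs_def length_msgs)
  have "ent T.law (\<lambda>v. fst v ! k) = (\<Sum>c\<le>N. - (s c * log 2 (s c)))"
    unfolding s_def by (rule ent_alt[OF T.law_finite _ range]) simp
  also have "\<dots> \<le> (\<Sum>c<N. - (t c * log 2 (t c))) + (\<delta> + 2 * sqrt \<delta>) / ln 2"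
  proof (rule entropy_perturbation)
    show "0 \<le> s c" for c by (simp add: s_def)
    show "(\<Sum>c\<le>N. s c) = 1" unfolding s_def by (rule sum_pr_eq_1[OF T.law_finite _ range]) simp
    show "s N \<le> \<delta>"
      unfolding s \<delta>_def
    proof (rule finite_measure_mono[OF _ overflow_sets], rule subsetI, rule ccontr)
      fix w assume "w \<in> {w. code_msgs (t1 N) (t2 N) r w ! k = N}" and w: "w \<notin> overflow N"
      then have "code_msgs e1 e2 r w ! k = N" using no_overflow(1)[OF w] by simp
      moreover have "code_msgs e1 e2 r w ! k \<in> set (code_msgs e1 e2 r w)" using k by (simp add: len)
      ultimately show False using w by (auto simp: overflow_def)
    qed
    show "s c \<le> t c" if "c < N" for c
      unfolding s t_def
    proof (rule finite_measure_mono)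
      show "{w. code_msgs (t1 N) (t2 N) r w ! k = c} \<subseteq> {w \<in> space cs. code_msgs e1 e2 r w ! k = c}"
        using that truncated_msgs_nth[OF k, of N e1 e2] by (fastforce simp: code_msgs_def)
      show "{w \<in> space cs. code_msgs e1 e2 r w ! k = c} \<in> sets cs"
        using measurable_sets[OF m(1), of "{c}"] by (simp add: vimage_def)
    qed
    show "(\<Sum>c<N. t c) \<le> 1"
      using sum_prob_values_le[OF m(1) sets.top finite_lessThan[of N]] prob_space unfolding t_def by simp
  qed
  also have "(\<Sum>c<N. - (t c * log 2 (t c))) \<le> enn2real (entropy_nat cs (\<lambda>w. code_msgs e1 e2 r w ! k))"
    unfolding t_def by (rule sum_le_entropy_nat[OF H prob_space_cs])
  finally show ?thesis by simp
qed

lemma truncated_rate_le: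
  fixes N :: nat
  assumes K: "K \<subseteq> {..<r}"
    and S: "(\<Sum>k\<in>K. entropy_nat cs (\<lambda>w. code_msgs e1 e2 r w ! k)) \<noteq> \<infinity>"
      "enn2real (\<Sum>k\<in>K. entropy_nat cs (\<lambda>w. code_msgs e1 e2 r w ! k)) \<le> c"
  defines "\<delta> \<equiv> measure cs (overflow N)"
  shows "(\<Sum>k\<in>K. ent (tlaw N) (\<lambda>v. fst v ! k))
    \<le> c + real r * ((\<delta> + 2 * sqrt \<delta>) / ln 2)"
proof -
  let ?H = "\<lambda>k. entropy_nat cs (\<lambda>w. code_msgs e1 e2 r w ! k)"
  have finK: "finite K" using K finite_subset by blast
  have fin: "?H k \<noteq> \<infinity>" if "k \<in> K" for k
    using S(1) member_le_sum[OF that, of ?H] finK by (auto simp: top_unique)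
  have \<delta>0: "0 \<le> (\<delta> + 2 * sqrt \<delta>) / ln 2" by (simp add: \<delta>_def)
  have "(\<Sum>k\<in>K. ent (tlaw N) (\<lambda>v. fst v ! k))
      \<le> (\<Sum>k\<in>K. enn2real (?H k) + (\<delta> + 2 * sqrt \<delta>) / ln 2)"
    unfolding \<delta>_def by (rule sum_mono) (use K fin in \<open>auto intro!: truncated_entropy_le\<close>)
  also have "\<dots> = enn2real (\<Sum>k\<in>K. ?H k) + real (card K) * ((\<delta> + 2 * sqrt \<delta>) / ln 2)"
    using fin by (subst enn2real_sum) (auto simp: sum.distrib less_top)
  also have "\<dots> \<le> c + real r * ((\<delta> + 2 * sqrt \<delta>) / ln 2)"
    using S(2) card_mono[OF _ K] \<delta>0 by (intro add_mono mult_right_mono) auto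
  finally show ?thesis .
qed

end

text \<open>As \<open>e\<close> below is at most 1, the bound \<open>max R12 R21 + 1\<close> on the
  slacks is the same for all \<open>\<epsilon>\<close>, as the passage to the limit demands.\<close>

lemma admissible_approximation:
  fixes q :: "('x1::finite \<times> 'x2::finite \<times> 'y1::finite \<times> 'y2::finite) pmf" and l1 l2 R12 R21 \<epsilon> :: real
  assumes adm: "admissible q r R12 R21" and r: "0 < r" and \<epsilon>: "\<epsilon> > 0"
  shows "\<exists>p s1 s2. finite (set_pmf p) \<and> interactive r p \<and>
      (\<forall>z. \<bar>pmf (map_pmf snd p) z - pmf q z\<bar> \<le> \<epsilon>) \<and> 0 \<le> s1 \<and> s1 \<le> max R12 R21 + 1 \<and>
      0 \<le> s2 \<and> s2 \<le> max R12 R21 + 1 \<and> output_info q - \<epsilon> \<le> s1 + s2 \<and>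
      l1 * (info1 p + s1) + l2 * (info2 p + s2) \<le> l1 * R12 + l2 * R21 + \<epsilon>"
proof -
  let ?M = "ln (real CARD('x1 \<times> 'x2 \<times> 'y1 \<times> 'y2))"
  have "0 < CARD('x1 \<times> 'x2 \<times> 'y1 \<times> 'y2)" by (rule zero_less_card_finite)
  then have "1 \<le> real CARD('x1 \<times> 'x2 \<times> 'y1 \<times> 'y2)" by linarith
  then have M0: "0 \<le> ?M" by (rule ln_ge_zero)
  \<comment> \<open>Collects the losses per unit of \<open>e\<close>: the marginals, the rates
    inside the functional, and the output information, whose error is four entropy errors with
    \<open>(1 + e) / n <= 2 * e\<close>.\<close>
  define D where "D = 1 + \<bar>l1\<bar> + \<bar>l2\<bar> + 4 * (2 + ?M) / ln 2"
  have "4 * (2 + ?M) / ln 2 \<ge> 0" using M0 by (intro divide_nonneg_nonneg) auto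
  then have D: "D \<ge> 1" "\<bar>l1\<bar> + \<bar>l2\<bar> \<le> D" "4 * (2 + ?M) / ln 2 \<le> D" by (auto simp: D_def)
  define e where "e = min 1 (\<epsilon> / D)"
  have e: "0 < e" "e \<le> 1" "e * D \<le> \<epsilon>"
    using \<epsilon> D(1) by (auto simp: e_def min_def field_simps)
  have "e * 1 \<le> e * D" using e(1) D(1) by (intro mult_left_mono) auto
  then have e\<epsilon>: "e \<le> \<epsilon>" using e(3) by simp
  \<comment> \<open>Half of \<open>e\<close> is left for truncation, which adds twice an overflow
    probability below \<open>e / 4\<close>.\<close>
  obtain n0 where n0: "\<And>n. n \<ge> n0 \<Longrightarrow> \<exists>mu1 mu2 e1 e2 d1 d2.
      is_code n r R12 R21 q mu1 mu2 e1 e2 d1 d2 \<and> code_l1 n q mu1 mu2 e1 e2 d1 d2 r \<le> e / 2"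
    using adm e(1) unfolding admissible_def by (meson half_gt_zero)
  \<comment> \<open>The block is also made long enough for \<open>1 / n <= e\<close>, to absorb the
    constant term of the entropy continuity bound.\<close>
  define n where "n = max n0 (nat \<lceil>1 / e\<rceil>)"
  have "1 / e \<le> real (nat \<lceil>1 / e\<rceil>)" by (rule real_nat_ceiling_ge)
  also have "\<dots> \<le> real n" by (simp add: n_def)
  finally have ne: "1 / e \<le> real n" .
  moreover have "1 / e \<ge> 1" using e by simp
  ultimately have n1: "real n \<ge> 1" by linarith
  have "1 / real n \<le> 1 / (1 / e)" using e(1) ne n1 by (intro divide_left_mono) auto
  then have n: "real n \<ge> 1" "1 / real n \<le> e" using n1 by simp_all
  obtain mu1 mu2 e1 e2 d1 d2 where cd: "is_code n r R12 R21 q mu1 mu2 e1 e2 d1 d2"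
    and dist: "code_l1 n q mu1 mu2 e1 e2 d1 d2 r \<le> e / 2"
    using n0[of n] by (auto simp: n_def)
  interpret interactive_code n r q mu1 mu2 e1 e2 d1 d2
    using cd unfolding is_code_def by (intro interactive_code.intro) auto
  let ?H = "\<lambda>k. entropy_nat cs (\<lambda>w. code_msgs e1 e2 r w ! k)"
  have S: "(\<Sum>k\<in>{k. k < r \<and> even k}. ?H k) \<noteq> \<infinity>" "enn2real (\<Sum>k\<in>{k. k < r \<and> even k}. ?H k) \<le> real n * R12"
    "(\<Sum>k\<in>{k. k < r \<and> odd k}. ?H k) \<noteq> \<infinity>" "enn2real (\<Sum>k\<in>{k. k < r \<and> odd k}. ?H k) \<le> real n * R21"
    using cd unfolding is_code_def Let_def by auto
  let ?\<delta> = "\<lambda>N. measure cs (overflow N)"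
  \<comment> \<open>The code is fixed at this point, so the truncation level may depend on
    it.\<close>
  have "(\<lambda>N. real r * ((?\<delta> N + 2 * sqrt (?\<delta> N)) / ln 2)) \<longlonglongrightarrow> real r * ((0 + 2 * sqrt 0) / ln 2)"
    by (intro tendsto_intros overflow_tendsto) auto
  then have "\<forall>\<^sub>F N in sequentially. real r * ((?\<delta> N + 2 * sqrt (?\<delta> N)) / ln 2) < e"
    using e(1) by (intro order_tendstoD(2)) auto
  moreover have "\<forall>\<^sub>F N in sequentially. ?\<delta> N < e / 4"
    using e(1) by (intro order_tendstoD(2)[OF overflow_tendsto]) auto
  ultimately have "\<forall>\<^sub>F N in sequentially. real r * ((?\<delta> N + 2 * sqrt (?\<delta> N)) / ln 2) < e \<and> ?\<delta> N < e / 4"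
    by (rule eventually_conj)
  then obtain N where N: "real r * ((?\<delta> N + 2 * sqrt (?\<delta> N)) / ln 2) < e" "?\<delta> N < e / 4"
    unfolding eventually_sequentially by blast
  interpret T: bounded_code n r q mu1 mu2 "t1 N" "t2 N" d1 d2 N by (rule bounded_code_truncated)
  have en: "e \<le> real n * e" using n(1) e(1) by simp
  have S1: "T.rate1 \<le> real n * (R12 + e)"
  proof -
    have "{k. k < r \<and> even k} \<subseteq> {..<r}" by auto
    from truncated_rate_le[OF this S(1,2), of N] show ?thesis using N(1) en by (simp add: distrib_left)
  qed
  have S2: "T.rate2 \<le> real n * (R21 + e)"
  proof -
    have "{k. k < r \<and> odd k} \<subseteq> {..<r}" by auto
    from truncated_rate_le[OF this S(3,4), of N] show ?thesis using N(1) en by (simp add: distrib_left)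
  qed
  have d: "(\<Sum>z\<in>T.blocks. \<bar>pmf (map_pmf snd T.law) z - pmf (replicate_pmf n q) z\<bar>) \<le> e"
    using truncated_output_close[of N] dist N(2) by linarith
  obtain p s1 s2 where p: "finite (set_pmf p)" "interactive r p" "\<forall>z. \<bar>pmf (map_pmf snd p) z - pmf q z\<bar> \<le> e"
    and s: "0 \<le> s1" "s1 \<le> R12 + e" "0 \<le> s2" "s2 \<le> R21 + e"
      "output_info q - 4 * (((1 + e) / real n + e * ?M) / ln 2) \<le> s1 + s2"
      "l1 * (info1 p + s1) + l2 * (info2 p + s2) \<le> l1 * (R12 + e) + l2 * (R21 + e)"
    using T.exists_single_letter[OF d _ r S1 S2, of l1 l2] n(1) by auto
  have "4 * (((1 + e) / real n + e * ?M) / ln 2) \<le> e * (4 * (2 + ?M) / ln 2)"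
  proof -
    have "(1 + e) * (1 / real n) \<le> 2 * e" using n e by (intro mult_mono) auto
    then have "((1 + e) / real n + e * ?M) / ln 2 \<le> (e * (2 + ?M)) / ln 2"
      by (intro divide_right_mono) (auto simp: algebra_simps)
    then have "4 * (((1 + e) / real n + e * ?M) / ln 2) \<le> 4 * ((e * (2 + ?M)) / ln 2)"
      by (rule mult_left_mono) simp
    also have "\<dots> = e * (4 * (2 + ?M) / ln 2)"
      by (simp only: times_divide_eq_right mult.left_commute)
    finally show ?thesis .
  qed
  also have "\<dots> \<le> e * D" using D(3) e(1) by (intro mult_left_mono) auto
  also have "\<dots> \<le> \<epsilon>" by (rule e(3))
  finally have s_sum: "output_info q - \<epsilon> \<le> s1 + s2" using s(5) by linarith
  have "l1 * e + l2 * e \<le> (\<bar>l1\<bar> + \<bar>l2\<bar>) * e" using e(1) by (simp add: distrib_right add_mono)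
  also have "\<dots> \<le> D * e" using D(2) e(1) by (intro mult_right_mono) auto
  also have "\<dots> \<le> \<epsilon>" using e(3) by (simp add: mult.commute)
  finally have "l1 * (info1 p + s1) + l2 * (info2 p + s2) \<le> l1 * R12 + l2 * R21 + \<epsilon>"
    using s(6) by (simp add: distrib_left)
  moreover have "\<forall>z. \<bar>pmf (map_pmf snd p) z - pmf q z\<bar> \<le> \<epsilon>" using p(3) e\<epsilon> order_trans by blast
  moreover have "s1 \<le> max R12 R21 + 1" "s2 \<le> max R12 R21 + 1" using s e(2) by auto
  ultimately show ?thesis using p(1,2) s(1,3) s_sum by blast
qed

theorem theorem2:
  fixes q :: "('x1::finite \<times> 'x2::finite \<times> 'y1::finite \<times> 'y2::finite) pmf"
    and r :: nat and R12 R21 :: real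
  assumes "r \<ge> 2"
    and "admissible q r R12 R21"
  shows "(R12, R21) \<in> R2 q r"
proof (rule mem_R2_if_separation)
  fix l1 l2
  have "0 < r" using assms(1) by simp
  show "\<exists>a b. (a, b) \<in> R2_points q r \<and> l1 * a + l2 * b \<le> l1 * R12 + l2 * R21"
    by (rule approximations_imp_R2_point[OF admissible_approximation[OF assms(2) \<open>0 < r\<close>]])
qed

end
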